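(* For every fixed $k,m\in\mathbb N$ the following problem is decidable: given finite alphabets $A,B$ and a timed automaton with $\varepsilon$-transitions recognising (with Büchi acceptance) a timed $\omega$-language $W\subseteq (A\times B\times\mathbb R_{\ge0})^\omega$ over the alphabet $A\times B$, decide whether Player II has a winning $k,m$-controller in the timed synthesis game $G(A,B,W)$.
   Context: Timed words and clock constraints: a timed word over $\Sigma$ is a sequence $(a_1,t_1)(a_2,t_2)\cdots$, $a_i\in\Sigma$, $0\le t_1\le t_2\le\cdots$ reals; clock constraints over clocks $X$ are Boolean combinations of $x\sim z$, $x-y\sim z$ ($z\in\mathbb Z$, $\sim\in\{<,\le,=,\ge,>\}$). A timed automaton with $\varepsilon$-transitions $(\Sigma,L,X,I,F,\Delta)$ has rules $(p,a,\varphi,Y,q)$, $a\in\Sigma\cup\{\varepsilon\}$, taken after a time elapse when the current valuation satisfies $\varphi$, resetting $Y$ to $0$; runs start in $I$ with all clocks $0$. Its timed $\omega$-language consists of the infinite timed words over $\Sigma$ obtained, by deleting $\varepsilon$-letters, from infinite accepted words (runs visiting $F$ infinitely often), keeping only infinite results. For a set of clocks $X$ and $m\in\mathbb N$, two valuations are $(X,m)$-region equivalent if they satisfy the same clock constraints over $X$ with constants of absolute value at most $m$; the equivalence classes (finitely many) are regions. Timed synthesis game $G(A,B,W)$: in rounds $i=1,2,\dots$ Player I chooses $a_i\in A$ and $t_i\in\mathbb R_{\ge0}$ with $t_i\ge t_{i-1}$ ($t_0=0$), then Player II chooses $b_i\in B$; Player I wins iff the play $(a_1,b_1,t_1)(a_2,b_2,t_2)\cdots\in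 W$. A $k,m$-controller for Player II is $(A,B,L,\ell_0,\delta)$ with finite memory set $L$, $\ell_0\in L$, a set $X$ of $k$ clocks, and $\delta: L\times A\times\mathrm{Regions}(X,m)\to L\times B\times 2^X$. It plays as follows: starting from $\ell_0$ and the all-zero valuation $\mu_0$, on Player I's move $(a_{n+1},t_{n+1})$ with current $(\ell_n,\mu_n)$, let $\nu=\mu_n+(t_{n+1}-t_n)$ and $\delta(\ell_n,a_{n+1},[\nu])=(\ell',b,Y)$; it answers $b_{n+1}=b$ and updates to $\ell_{n+1}=\ell'$, $\mu_{n+1}=\nu$ with clocks in $Y$ reset to $0$. It is winning if no infinite play consistent with it belongs to $W$. *)

theory Defs
  imports Complex_Main "HOL-Library.Nat_Bijection"
begin

datatype recf = Z | S | Id nat | Cn recf "recf list" | Pr recf recf | Mn recf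

inductive eval :: "recf \<Rightarrow> nat list \<Rightarrow> nat \<Rightarrow> bool" where
  eval_Z: "eval Z xs 0"
| eval_S: "eval S [x] (Suc x)"
| eval_Id: "i < length xs \<Longrightarrow> eval (Id i) xs (xs ! i)"
| eval_Cn: "length ys = length gs \<Longrightarrow> (\<forall>i<length gs. eval (gs ! i) xs (ys ! i))
             \<Longrightarrow> eval f ys z \<Longrightarrow> eval (Cn f gs) xs z"
| eval_Pr0: "eval f xs y \<Longrightarrow> eval (Pr f g) (0 # xs) y"
| eval_PrS: "eval (Pr f g) (n # xs) y \<Longrightarrow> eval g (n # y # xs) z
             \<Longrightarrow> eval (Pr f g) (Suc n # xs) z"
| eval_Mn: "eval f (n # xs) 0 \<Longrightarrow> (\<forall>i<n. \<exists>y. eval f (i # xs) y \<and> y > 0)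
             \<Longrightarrow> eval (Mn f) xs n"

definition decidable_set :: "nat set \<Rightarrow> bool" where
  "decidable_set P \<longleftrightarrow> (\<exists>f. \<forall>n. eval f [n] (if n \<in> P then 1 else 0))"

type_synonym clock = nat
type_synonym valuation = "clock \<Rightarrow> real"

datatype cmp = CLt | CLe | CEq | CGe | CGt

datatype cc =
    CTrue
  | CAtom clock cmp int
  | CDiff clock clock cmp int
  | CNot cc
  | CAnd cc cc
  | COr cc cc

fun cmp_sem :: "cmp \<Rightarrow> real \<Rightarrow> real \<Rightarrow> bool" where
  "cmp_sem CLt a b = (a < b)"
| "cmp_sem CLe a b = (a \<le> b)"
| "cmp_sem CEq a b = (a = b)"
| "cmp_sem CGe a b = (a \<ge> b)"
| "cmp_sem CGt a b = (a > b)"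

fun sat :: "cc \<Rightarrow> valuation \<Rightarrow> bool" where
  "sat CTrue v = True"
| "sat (CAtom x c z) v = cmp_sem c (v x) (of_int z)"
| "sat (CDiff x y c z) v = cmp_sem c (v x - v y) (of_int z)"
| "sat (CNot \<phi>) v = (\<not> sat \<phi> v)"
| "sat (CAnd \<phi> \<psi>) v = (sat \<phi> v \<and> sat \<psi> v)"
| "sat (COr \<phi> \<psi>) v = (sat \<phi> v \<or> sat \<psi> v)"

fun cc_over :: "clock set \<Rightarrow> nat \<Rightarrow> cc \<Rightarrow> bool" where
  "cc_over X m CTrue = True"
| "cc_over X m (CAtom x c z) = (x \<in> X \<and> \<bar>z\<bar> \<le> int m)"
| "cc_over X m (CDiff x y c z) = (x \<in> X \<and> y \<in> X \<and> \<bar>z\<bar> \<le> int m)"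
| "cc_over X m (CNot \<phi>) = cc_over X m \<phi>"
| "cc_over X m (CAnd \<phi> \<psi>) = (cc_over X m \<phi> \<and> cc_over X m \<psi>)"
| "cc_over X m (COr \<phi> \<psi>) = (cc_over X m \<phi> \<and> cc_over X m \<psi>)"

definition region_equiv :: "clock set \<Rightarrow> nat \<Rightarrow> valuation \<Rightarrow> valuation \<Rightarrow> bool" where
  "region_equiv X m \<nu> \<mu> \<longleftrightarrow> (\<forall>\<phi>. cc_over X m \<phi> \<longrightarrow> (sat \<phi> \<nu> \<longleftrightarrow> sat \<phi> \<mu>))"

definition region_of :: "clock set \<Rightarrow> nat \<Rightarrow> valuation \<Rightarrow> valuation set" where
  "region_of X m \<nu> = {\<mu>. region_equiv X m \<nu> \<mu>}"

definition regions :: "clock set \<Rightarrow> nat \<Rightarrow> valuation set set" where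
  "regions X m = range (region_of X m)"

definition delay :: "valuation \<Rightarrow> real \<Rightarrow> valuation" where
  "delay v d = (\<lambda>x. v x + d)"

definition reset :: "clock set \<Rightarrow> valuation \<Rightarrow> valuation" where
  "reset Y v = (\<lambda>x. if x \<in> Y then 0 else v x)"

definition timed_word :: "(nat \<Rightarrow> 's \<times> real) \<Rightarrow> bool" where
  "timed_word w \<longleftrightarrow> 0 \<le> snd (w 0) \<and> (\<forall>i. snd (w i) \<le> snd (w (Suc i)))"

definition prev_time :: "(nat \<Rightarrow> 's \<times> real) \<Rightarrow> nat \<Rightarrow> real" where
  "prev_time w n = (if n = 0 then 0 else snd (w (n - 1)))"

text \<open>Letters: pairs (a,b) of naturals (alphabet A \<times> B); None is epsilon.
  A rule is (p, letter, guard, resets, q).\<close>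
type_synonym letter = "nat \<times> nat"
type_synonym rule = "nat \<times> letter option \<times> cc \<times> clock list \<times> nat"

record ta =
  ta_clocks :: nat            \<comment> \<open>the clock set is {0..<ta_clocks}\<close>
  ta_init   :: "nat list"
  ta_final  :: "nat list"
  ta_rules  :: "rule list"

definition accepting_run ::
  "ta \<Rightarrow> (nat \<Rightarrow> letter option \<times> real) \<Rightarrow> (nat \<Rightarrow> nat) \<Rightarrow> (nat \<Rightarrow> valuation) \<Rightarrow> bool" where
  "accepting_run T w ls vs \<longleftrightarrow>
     ls 0 \<in> set (ta_init T) \<and> vs 0 = (\<lambda>_. 0) \<and>
     (\<forall>i. \<exists>\<phi> Y. (ls i, fst (w i), \<phi>, Y, ls (Suc i)) \<in> set (ta_rules T) \<and>
                 set Y \<subseteq> {0..<ta_clocks T} \<and>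
                 sat \<phi> (delay (vs i) (snd (w i) - prev_time w i)) \<and>
                 vs (Suc i) = reset (set Y) (delay (vs i) (snd (w i) - prev_time w i))) \<and>
     infinite {i. ls i \<in> set (ta_final T)}"

definition erase :: "(nat \<Rightarrow> 's option \<times> real) \<Rightarrow> (nat \<Rightarrow> 's \<times> real) \<Rightarrow> bool" where
  "erase w w' \<longleftrightarrow> (\<exists>h. strict_mono h \<and> range h = {i. fst (w i) \<noteq> None} \<and>
                       (\<forall>j. w' j = (the (fst (w (h j))), snd (w (h j)))))"

definition timed_lang :: "ta \<Rightarrow> (nat \<Rightarrow> letter \<times> real) set" where
  "timed_lang T = {w'. \<exists>w ls vs. timed_word w \<and> accepting_run T w ls vs \<and> erase w w'}"

text \<open>Instance: (number of letters of A, number of letters of B, automaton);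
  A = {0..<na}, B = {0..<nb}.\<close>
type_synonym problem_inst = "nat \<times> nat \<times> ta"

definition is_controller ::
  "nat \<Rightarrow> nat \<Rightarrow> nat set \<Rightarrow> nat set \<Rightarrow> nat set \<Rightarrow> nat \<Rightarrow>
   (nat \<Rightarrow> nat \<Rightarrow> valuation set \<Rightarrow> nat \<times> nat \<times> clock set) \<Rightarrow> bool" where
  "is_controller k m A B L l0 \<delta> \<longleftrightarrow> finite L \<and> l0 \<in> L \<and>
     (\<forall>l\<in>L. \<forall>a\<in>A. \<forall>r\<in>regions {0..<k} m. \<delta> l a r \<in> L \<times> B \<times> Pow {0..<k})"

definition consistent_play ::
  "nat \<Rightarrow> nat \<Rightarrow> nat set \<Rightarrow> nat \<Rightarrow> (nat \<Rightarrow> nat \<Rightarrow> valuation set \<Rightarrow> nat \<times> nat \<times> clock set)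
   \<Rightarrow> (nat \<Rightarrow> letter \<times> real) \<Rightarrow> bool" where
  "consistent_play k m A l0 \<delta> w \<longleftrightarrow> timed_word w \<and> (\<forall>n. fst (fst (w n)) \<in> A) \<and>
     (\<exists>ls \<mu>s. ls 0 = l0 \<and> \<mu>s 0 = (\<lambda>_. 0) \<and>
        (\<forall>n. let \<nu> = delay (\<mu>s n) (snd (w n) - prev_time w n);
                 (l', b, Y) = \<delta> (ls n) (fst (fst (w n))) (region_of {0..<k} m \<nu>)
             in ls (Suc n) = l' \<and> snd (fst (w n)) = b \<and> \<mu>s (Suc n) = reset Y \<nu>))"

definition winning_controller ::
  "nat \<Rightarrow> nat \<Rightarrow> problem_inst \<Rightarrow> nat set \<Rightarrow> nat \<Rightarrow>
   (nat \<Rightarrow> nat \<Rightarrow> valuation set \<Rightarrow> nat \<times> nat \<times> clock set) \<Rightarrow> bool" where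
  "winning_controller k m I L l0 \<delta> \<longleftrightarrow>
     (case I of (na, nb, T) \<Rightarrow>
        is_controller k m {0..<na} {0..<nb} L l0 \<delta> \<and>
        (\<forall>w. consistent_play k m {0..<na} l0 \<delta> w \<longrightarrow> w \<notin> timed_lang T))"

definition has_winning_controller :: "nat \<Rightarrow> nat \<Rightarrow> problem_inst \<Rightarrow> bool" where
  "has_winning_controller k m I \<longleftrightarrow> (\<exists>L l0 \<delta>. winning_controller k m I L l0 \<delta>)"

fun enc_cmp :: "cmp \<Rightarrow> nat" where
  "enc_cmp CLt = 0" | "enc_cmp CLe = 1" | "enc_cmp CEq = 2" | "enc_cmp CGe = 3" | "enc_cmp CGt = 4"

fun enc_cc :: "cc \<Rightarrow> nat" where
  "enc_cc CTrue = list_encode [0]"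
| "enc_cc (CAtom x c z) = list_encode [1, x, enc_cmp c, int_encode z]"
| "enc_cc (CDiff x y c z) = list_encode [2, x, y, enc_cmp c, int_encode z]"
| "enc_cc (CNot \<phi>) = list_encode [3, enc_cc \<phi>]"
| "enc_cc (CAnd \<phi> \<psi>) = list_encode [4, enc_cc \<phi>, enc_cc \<psi>]"
| "enc_cc (COr \<phi> \<psi>) = list_encode [5, enc_cc \<phi>, enc_cc \<psi>]"

fun enc_letter :: "letter option \<Rightarrow> nat" where
  "enc_letter None = 0"
| "enc_letter (Some (a, b)) = Suc (prod_encode (a, b))"

fun enc_rule :: "rule \<Rightarrow> nat" where
  "enc_rule (p, \<sigma>, \<phi>, Y, q) = list_encode [p, enc_letter \<sigma>, enc_cc \<phi>, list_encode Y, q]"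

fun enc_instance :: "problem_inst \<Rightarrow> nat" where
  "enc_instance (na, nb, T) = list_encode [na, nb, ta_clocks T, list_encode (ta_init T),
      list_encode (ta_final T), list_encode (map enc_rule (ta_rules T))]"

end

theory Submission
  imports Defs "HOL-Library.Infinite_Set"
begin

text \<open>
  Region equivalence on the clocks of the automaton together with those of the controller is a
  time-abstract bisimulation with finitely many classes, and each class contains a point of a
  rational grid. This turns the timed game into a game on a finite graph whose vertices carry grid
  points; Player II wins a play iff no path through the vertices compatible with it meets infinitely
  many flags (final locations). A finite-memory strategy of Player II wins iff the vertices can be
  given finite budgets that never grow and shrink at each flag.

  It remains to bound the memory. A weak form of Safra's determinisation tracks lists of sets of
  vertices ordered by age, such that any path with infinitely many flags makes some eventually
  permanent position of the list flash infinitely often. If a finite-memory strategy wins, its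
  budgets assign a weight to each position; playing at each tracking state as the given strategy does
  in the memory state with lexicographically least weights is again winning, since otherwise these
  weights would decrease forever. So a winning strategy exists iff there is a family of budgets of
  computably bounded size, and this is decided by bounded search.
\<close>

section \<open>Computable functions on codes\<close>

text \<open>Player II sees neither silent moves nor the run picked by the nondeterministic
  automaton, only letters and the regions of its own clocks. The finite game is thus one of partial
  information: an answer must be right for all runs compatible with the observations at once. This
  is why sets of vertices are tracked and why a budget is a function on all vertices. Regions are
  taken over both groups of clocks jointly because one delay drives both. Flags sit on letter moves
  and record a final visit since the previous letter, so infinitely many flags express the
  acceptance condition and the infinity of the word together; a run that ends in silent moves only
  has finitely many. A family of budgets is strategy and certificate at once: its members act as
  memory states, and local inequalities replace statements on infinite plays, so it can be checked
  by bounded quantifiers. The size of the grid is not given by a formula; it is found by a search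
  that halts since there are finitely many classes.\<close>

definition computable :: "(nat \<Rightarrow> nat) \<Rightarrow> bool" where
  "computable f \<longleftrightarrow> (\<exists>r. \<forall>n. eval r [n] (f n))"

definition pf :: "nat \<Rightarrow> nat" where "pf p = fst (prod_decode p)"
definition ps :: "nat \<Rightarrow> nat" where "ps p = snd (prod_decode p)"
definition pr :: "nat \<Rightarrow> nat \<Rightarrow> nat" where "pr a b = prod_encode (a, b)"

lemma pf_pr [simp]: "pf (pr a b) = a" and ps_pr [simp]: "ps (pr a b) = b"
  and pr_pf_ps [simp]: "pr (pf p) (ps p) = p"
  by (simp_all add: pf_def ps_def pr_def)

lemma eval_Cn1: "eval g xs y \<Longrightarrow> eval f [y] z \<Longrightarrow> eval (Cn f [g]) xs z"
  by (rule eval_Cn[of "[y]"]) auto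

lemma eval_Cn2: "eval g1 xs y1 \<Longrightarrow> eval g2 xs y2 \<Longrightarrow> eval f [y1, y2] z \<Longrightarrow> eval (Cn f [g1, g2]) xs z"
  by (rule eval_Cn[of "[y1, y2]"]) (auto simp: less_Suc_eq)

lemma eval_Id': "i < length xs \<Longrightarrow> xs ! i = y \<Longrightarrow> eval (Id i) xs y"
  using eval_Id by blast

section \<open>Arithmetic and Cantor pairing as recursive functions\<close>

definition r_add where "r_add = Pr (Id 0) (Cn S [Id 1])"
definition r_pred where "r_pred = Pr Z (Id 0)"
text \<open>\<open>Pr\<close> recurses on its first argument, whereas truncated subtraction recurses
  on the second; hence the exchange of arguments.\<close>

definition r_sub where "r_sub = Cn (Pr (Id 0) (Cn r_pred [Id 1])) [Id 1, Id 0]"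
definition r_mult where "r_mult = Pr Z (Cn r_add [Id 1, Id 2])"
definition r_tri where "r_tri = Pr Z (Cn r_add [Id 1, Cn S [Id 0]])"
definition r_pair where "r_pair = Cn r_add [Cn r_tri [r_add], Id 0]"
text \<open>Inverts Cantor pairing. As \<open>pr a b = triangle (a + b) + a\<close>, the sum
  \<open>a + b\<close> is the least \<open>i\<close> with \<open>p < triangle (Suc i)\<close>,
  written as \<open>Suc p - triangle (Suc i) = 0\<close> because \<open>Mn\<close> looks for a
  zero.\<close>

definition r_psum where "r_psum = Mn (Cn r_sub [Cn S [Id 1], Cn r_tri [Cn S [Id 0]]])"
definition r_pf where "r_pf = Cn r_sub [Id 0, Cn r_tri [r_psum]]"
definition r_ps where "r_ps = Cn r_sub [r_psum, r_pf]"

lemma eval_add: "eval r_add [x, y] (x + y)"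
  unfolding r_add_def
  by (induction x) (auto intro!: eval_Pr0 eval_PrS eval_Cn1 eval_Id' eval_S)

lemma eval_pred: "eval r_pred [x] (x - 1)"
  unfolding r_pred_def by (induction x) (auto intro!: eval_Pr0 eval_PrS eval_Z eval_Id')

lemma eval_sub: "eval r_sub [x, y] (x - y)"
proof -
  have "eval (Pr (Id 0) (Cn r_pred [Id 1])) [y, x] (x - y)"
  proof (induction y)
    case (Suc y)
    have "eval (Cn r_pred [Id 1]) [y, x - y, x] (x - y - 1)"
      by (rule eval_Cn1[OF eval_Id' eval_pred]) auto
    with Suc show ?case by (auto intro!: eval_PrS)
  qed (auto intro!: eval_Pr0 eval_Id')
  then show ?thesis unfolding r_sub_def by (auto intro!: eval_Cn2 eval_Id')
qed

lemma eval_mult: "eval r_mult [x, y] (x * y)"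
proof (induction x)
  case (Suc x)
  have "eval (Cn r_add [Id 1, Id 2]) [x, x * y, y] (x * y + y)"
    by (rule eval_Cn2[OF eval_Id' eval_Id']) (auto intro: eval_add)
  with Suc show ?case unfolding r_mult_def by (auto intro!: eval_PrS simp: add.commute)
qed (auto intro!: eval_Pr0 eval_Z simp: r_mult_def)

lemma eval_tri: "eval r_tri [x] (triangle x)"
proof (induction x)
  case (Suc x)
  have "eval (Cn r_add [Id 1, Cn S [Id 0]]) [x, triangle x] (triangle x + Suc x)"
    by (rule eval_Cn2[OF eval_Id' eval_Cn1[OF eval_Id' eval_S] eval_add]) auto
  with Suc show ?case unfolding r_tri_def by (auto intro!: eval_PrS)
qed (auto intro!: eval_Pr0 eval_Z simp: r_tri_def)

lemma eval_pair: "eval r_pair [x, y] (pr x y)"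
  unfolding r_pair_def pr_def prod_encode_def
  by (auto intro!: eval_Cn2[OF eval_Cn1 eval_Id'] eval_add eval_tri)

lemma triangle_mono: "x \<le> y \<Longrightarrow> triangle x \<le> triangle y"
  by (induction y) (auto simp: le_Suc_eq)

lemma eval_psum: "eval r_psum [p] (pf p + ps p)"
proof -
  obtain a b where p: "p = pr a b" by (metis pr_pf_ps)
  have ev: "eval (Cn r_sub [Cn S [Id 1], Cn r_tri [Cn S [Id 0]]]) [i, p] (Suc p - triangle (Suc i))" for i
    by (rule eval_Cn2[OF eval_Cn1[OF eval_Id'] eval_Cn1[OF eval_Cn1[OF eval_Id']] eval_sub])
      (auto intro: eval_S eval_tri simp del: triangle_Suc)
  have pv: "p = triangle (a + b) + a" by (simp add: p pr_def prod_encode_def)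
  have "Suc p - triangle (Suc (a + b)) = 0" using pv by simp
  moreover have "Suc p - triangle (Suc i) > 0" if "i < a + b" for i
    using triangle_mono[of "Suc i" "a + b"] that pv by simp
  ultimately have "eval r_psum [p] (a + b)"
    unfolding r_psum_def
    by (intro eval_Mn allI impI) (use ev[of "a + b"] in simp, use ev in blast)
  then show ?thesis by (simp add: p)
qed

lemma eval_pf: "eval r_pf [p] (pf p)"
proof -
  have "p - triangle (pf p + ps p) = pf p"
    using pr_pf_ps[of p] unfolding pr_def prod_encode_def by simp
  moreover have "eval r_pf [p] (p - triangle (pf p + ps p))"
    unfolding r_pf_def by (rule eval_Cn2[OF eval_Id' eval_Cn1[OF eval_psum eval_tri] eval_sub]) auto
  ultimately show ?thesis by simp
qed

lemma eval_ps: "eval r_ps [p] (ps p)"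
proof -
  have "eval r_ps [p] ((pf p + ps p) - pf p)"
    unfolding r_ps_def by (rule eval_Cn2[OF eval_psum eval_pf eval_sub])
  then show ?thesis by simp
qed

section \<open>Closure properties of computable functions of one coded environment\<close>

named_theorems comp_intros

lemma comp_compose: assumes "computable g" "computable f" shows "computable (\<lambda>e. g (f e))"
  using assms unfolding computable_def by (meson eval_Cn1)

lemma comp_bin:
  assumes "\<And>x y. eval r [x, y] (h x y)" "computable f" "computable g"
  shows "computable (\<lambda>e. h (f e) (g e))"
  using assms unfolding computable_def by (meson eval_Cn2)

lemma comp_id [comp_intros]: "computable (\<lambda>e. e)"
  unfolding computable_def by (rule exI[of _ "Id 0"]) (auto intro: eval_Id')

lemma comp_Suc [comp_intros]: "computable f \<Longrightarrow> computable (\<lambda>e. Suc (f e))"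
  by (rule comp_compose[of Suc]) (auto simp: computable_def intro: eval_S)

lemma comp_const [comp_intros]: "computable (\<lambda>e. c)"
proof (induction c)
  case 0
  show ?case unfolding computable_def using eval_Z by blast
next
  case (Suc c)
  then show ?case by (rule comp_Suc)
qed

lemma comp_pf [comp_intros]: "computable f \<Longrightarrow> computable (\<lambda>e. pf (f e))"
  by (rule comp_compose[of pf]) (auto simp: computable_def intro: eval_pf)

lemma comp_ps [comp_intros]: "computable f \<Longrightarrow> computable (\<lambda>e. ps (f e))"
  by (rule comp_compose[of ps]) (auto simp: computable_def intro: eval_ps)

lemmas comp_add [comp_intros] = comp_bin[OF eval_add]
  and comp_sub [comp_intros] = comp_bin[OF eval_sub]
  and comp_mult [comp_intros] = comp_bin[OF eval_mult]
  and comp_pr [comp_intros] = comp_bin[OF eval_pair]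

text \<open>Several arguments are packed into nested pairs, so that all closure rules can speak of a
  single environment \<open>e\<close>.\<close>

lemma comp2:
  assumes "computable (\<lambda>e. g (pf e) (ps e))" "computable f1" "computable f2"
  shows "computable (\<lambda>e. g (f1 e) (f2 e))"
  using comp_compose[OF assms(1) comp_pr[OF assms(2,3)]] by simp

lemma comp3:
  assumes "computable (\<lambda>e. g (pf e) (pf (ps e)) (ps (ps e)))" "computable f1" "computable f2" "computable f3"
  shows "computable (\<lambda>e. g (f1 e) (f2 e) (f3 e))"
  using comp_compose[OF assms(1) comp_pr[OF assms(2) comp_pr[OF assms(3,4)]]] by simp

lemma comp4:
  assumes "computable (\<lambda>e. g (pf e) (pf (ps e)) (pf (ps (ps e))) (ps (ps (ps e))))"
    "computable f1" "computable f2" "computable f3" "computable f4"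
  shows "computable (\<lambda>e. g (f1 e) (f2 e) (f3 e) (f4 e))"
  using comp_compose[OF assms(1) comp_pr[OF assms(2) comp_pr[OF assms(3) comp_pr[OF assms(4,5)]]]] by simp

text \<open>The environment rides along as the passive argument of \<open>Pr\<close>, and the step
  receives everything as \<open>pr i (pr y e)\<close>; this dictates the third hypothesis.\<close>

lemma comp_rec_nat [comp_intros]:
  assumes f: "computable f" and n: "computable n" and g: "computable (\<lambda>p. g (pf p) (pf (ps p)) (ps (ps p)))"
  shows "computable (\<lambda>e. rec_nat (f e) (\<lambda>i y. g i y e) (n e))"
proof -
  obtain rf where rf: "\<And>e. eval rf [e] (f e)" using f unfolding computable_def by blast
  obtain rg where rg: "\<And>p. eval rg [p] (g (pf p) (pf (ps p)) (ps (ps p)))" using g unfolding computable_def by blast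
  let ?g = "Cn rg [Cn r_pair [Id 0, Cn r_pair [Id 1, Id 2]]]"
  have ev: "eval (Pr rf ?g) [i, e] (rec_nat (f e) (\<lambda>i y. g i y e) i)" for i e
  proof (induction i)
    case 0
    then show ?case using rf by (auto intro: eval_Pr0)
  next
    case (Suc i)
    let ?y = "rec_nat (f e) (\<lambda>i y. g i y e) i"
    have "eval ?g [i, ?y, e] (g i ?y e)"
      by (rule eval_Cn1[OF eval_Cn2[OF eval_Id' eval_Cn2[OF eval_Id' eval_Id']]])
        (auto intro: eval_pair, use rg[of "pr i (pr ?y e)"] in simp)
    with Suc show ?case by (auto intro: eval_PrS)
  qed
  have "computable (\<lambda>e. rec_nat (f (id e)) (\<lambda>i y. g i y (id e)) (n e))"
    by (rule comp_bin[OF ev n, of id]) (simp add: comp_id id_def)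
  then show ?thesis by simp
qed

section \<open>Decidable predicates, bounded quantifiers and minimisation\<close>

definition decidable :: "(nat \<Rightarrow> bool) \<Rightarrow> bool" where
  "decidable P \<longleftrightarrow> computable (\<lambda>e. if P e then 1 else 0)"

lemma comp_If [comp_intros]:
  assumes "decidable P" "computable f" "computable g"
  shows "computable (\<lambda>e. if P e then f e else g e)"
proof -
  have eq: "(\<lambda>e. if P e then f e else g e) =
    (\<lambda>e. (if P e then 1 else 0) * f e + (1 - (if P e then 1 else 0)) * g e)" by auto
  show ?thesis unfolding eq
    by (intro comp_add comp_mult comp_sub comp_const assms(2,3) assms(1)[unfolded decidable_def])
qed

lemma dec_comp_pos: assumes "computable f" shows "decidable (\<lambda>e. 0 < f e)"
proof -
  have eq: "(\<lambda>e. if 0 < f e then 1 else 0::nat) = (\<lambda>e. 1 - (1 - f e))" by auto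
  show ?thesis unfolding decidable_def eq by (intro comp_intros assms)
qed

lemma dec_not [comp_intros]: assumes "decidable P" shows "decidable (\<lambda>e. \<not> P e)"
proof -
  have eq: "(\<lambda>e. if \<not> P e then 1 else 0::nat) = (\<lambda>e. if P e then 0 else 1)" by auto
  show ?thesis unfolding decidable_def eq by (intro comp_If assms comp_const)
qed

lemma dec_and [comp_intros]: assumes "decidable P" "decidable Q" shows "decidable (\<lambda>e. P e \<and> Q e)"
proof -
  have eq: "(\<lambda>e. if P e \<and> Q e then 1 else 0::nat) = (\<lambda>e. if P e then (if Q e then 1 else 0) else 0)" by auto
  show ?thesis unfolding decidable_def eq by (intro comp_intros assms)
qed

lemma dec_or [comp_intros]: assumes "decidable P" "decidable Q" shows "decidable (\<lambda>e. P e \<or> Q e)"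
  using dec_not[OF dec_and[OF dec_not[OF assms(1)] dec_not[OF assms(2)]]] by simp

lemma dec_imp [comp_intros]: assumes "decidable P" "decidable Q" shows "decidable (\<lambda>e. P e \<longrightarrow> Q e)"
  unfolding imp_conv_disj by (intro dec_or dec_not assms)

lemma dec_less [comp_intros]: assumes "computable f" "computable g" shows "decidable (\<lambda>e. f e < g e)"
  using dec_comp_pos[OF comp_sub[OF assms(2,1)]] by simp

lemma dec_le [comp_intros]: assumes "computable f" "computable g" shows "decidable (\<lambda>e. f e \<le> g e)"
  using dec_not[OF dec_less[OF assms(2,1)]] by (simp add: not_less)

lemma dec_eq [comp_intros]: assumes "computable f" "computable g" shows "decidable (\<lambda>e. f e = g e)"
  using dec_and[OF dec_le[OF assms] dec_le[OF assms(2,1)]] by (simp add: order_eq_iff)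

lemma dec_iff [comp_intros]: assumes "decidable P" "decidable Q" shows "decidable (\<lambda>e. P e \<longleftrightarrow> Q e)"
  unfolding iff_conv_conj_imp by (intro dec_and dec_imp assms)

lemma dec_const [comp_intros]: "decidable (\<lambda>e. c)"
  unfolding decidable_def by (rule comp_const)

text \<open>Translates between the environment \<open>pr e i\<close> of a predicate under a bound
  variable and the tuple \<open>pr i (pr y e)\<close> handed to the step of a recursion.\<close>

lemma dec_swap:
  assumes "decidable (\<lambda>p. P (pf p) (ps p))"
  shows "computable (\<lambda>q. if P (ps (ps q)) (pf q) then 1 else 0)"
proof -
  have "computable (\<lambda>q. pr (ps (ps q)) (pf q))" by (intro comp_intros)
  from comp_compose[OF assms[unfolded decidable_def] this] show ?thesis by simp
qed

lemma dec_ball [comp_intros]: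
  assumes P: "decidable (\<lambda>p. P (pf p) (ps p))" and b: "computable b"
  shows "decidable (\<lambda>e. \<forall>i<b e. P e i)"
proof -
  have eq: "(if \<forall>i<n. P e i then 1 else 0) = rec_nat (1::nat) (\<lambda>i y. (if P e i then 1 else 0) * y) n" for e n
  proof (induction n)
    case (Suc n)
    show ?case unfolding nat.rec Suc[symmetric] by (auto simp: less_Suc_eq)
  qed simp
  show ?thesis unfolding decidable_def eq
    by (rule comp_rec_nat[OF comp_const b]) (intro comp_mult dec_swap[OF P] comp_intros)
qed

lemma dec_bex [comp_intros]:
  assumes P: "decidable (\<lambda>p. P (pf p) (ps p))" and b: "computable b"
  shows "decidable (\<lambda>e. \<exists>i<b e. P e i)"
  using dec_not[OF dec_ball[OF dec_not[OF P] b]] by simp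

lemma dec_ball_le [comp_intros]:
  assumes "decidable (\<lambda>p. P (pf p) (ps p))" "computable b" shows "decidable (\<lambda>e. \<forall>i\<le>b e. P e i)"
  using dec_ball[OF assms(1) comp_Suc[OF assms(2)]] by (simp add: less_Suc_eq_le)

lemma dec_bex_le [comp_intros]:
  assumes "decidable (\<lambda>p. P (pf p) (ps p))" "computable b" shows "decidable (\<lambda>e. \<exists>i\<le>b e. P e i)"
  using dec_bex[OF assms(1) comp_Suc[OF assms(2)]] by (simp add: less_Suc_eq_le)

text \<open>Unbounded search, total by \<open>ex\<close>. It serves division, the length of coded
  lists and finally the size of the grid.\<close>

lemma comp_Least [comp_intros]:
  assumes P: "decidable (\<lambda>p. P (pf p) (ps p))" and ex: "\<And>e. \<exists>i. P e i"
  shows "computable (\<lambda>e. LEAST i. P e i)"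
proof -
  obtain r where r: "\<And>p. eval r [p] (if P (pf p) (ps p) then 0 else 1)"
    using comp_If[OF P comp_const[of 0] comp_const[of 1]] unfolding computable_def by blast
  let ?r = "Cn r [Cn r_pair [Id 1, Id 0]]"
  have ev: "eval ?r [i, e] (if P e i then 0 else 1)" for i e
    by (rule eval_Cn1[OF eval_Cn2[OF eval_Id' eval_Id' eval_pair]]) (use r[of "pr e i"] in auto)
  have "eval (Mn ?r) [e] (LEAST i. P e i)" for e
  proof (rule eval_Mn)
    show "eval ?r [LEAST i. P e i, e] 0" using ev[of "LEAST i. P e i" e] LeastI_ex[OF ex[of e]] by simp
    show "\<forall>i<LEAST i. P e i. \<exists>y. eval ?r [i, e] y \<and> 0 < y"
    proof (intro allI impI)
      fix i assume "i < (LEAST i. P e i)"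
      then have "\<not> P e i" by (rule not_less_Least)
      then show "\<exists>y. eval ?r [i, e] y \<and> 0 < y" using ev[of i e] by auto
    qed
  qed
  then show ?thesis unfolding computable_def by blast
qed

lemma dec_compose: "decidable P \<Longrightarrow> computable f \<Longrightarrow> decidable (\<lambda>e. P (f e))"
  unfolding decidable_def by (rule comp_compose)

lemma dec2:
  assumes "decidable (\<lambda>e. g (pf e) (ps e))" "computable f1" "computable f2"
  shows "decidable (\<lambda>e. g (f1 e) (f2 e))"
  using dec_compose[OF assms(1) comp_pr[OF assms(2,3)]] by simp

lemma dec3:
  assumes "decidable (\<lambda>e. g (pf e) (pf (ps e)) (ps (ps e)))" "computable f1" "computable f2" "computable f3"
  shows "decidable (\<lambda>e. g (f1 e) (f2 e) (f3 e))"
  using dec_compose[OF assms(1) comp_pr[OF assms(2) comp_pr[OF assms(3,4)]]] by simp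

lemma comp_power [comp_intros]: assumes "computable f" "computable g" shows "computable (\<lambda>e. f e ^ g e)"
proof -
  have eq: "a ^ n = rec_nat 1 (\<lambda>i y. a * y) n" for a n :: nat by (induction n) auto
  show ?thesis unfolding eq by (rule comp2[OF _ assms]) (intro comp_intros)
qed

lemma comp_div [comp_intros]: assumes "computable f" "computable g" shows "computable (\<lambda>e. f e div g e)"
proof -
  \<comment> \<open>The disjunct \<open>b = 0\<close> keeps the search total and yields the
    conventional value \<open>a div 0 = 0\<close>.\<close>
  have eq: "a div b = (LEAST q. b = 0 \<or> a < Suc q * b)" for a b :: nat
  proof (cases "b = 0")
    case False
    show ?thesis
    proof (rule Least_equality[symmetric])
      show "b = 0 \<or> a < Suc (a div b) * b" using False dividend_less_div_times[of b a] by simp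
      fix q assume "b = 0 \<or> a < Suc q * b"
      then have "a div b < Suc q" using False by (simp add: less_mult_imp_div_less)
      then show "a div b \<le> q" by simp
    qed
  qed (auto intro: Least_equality[symmetric])
  have ex: "\<exists>q. b = 0 \<or> a < Suc q * b" for a b :: nat
    using dividend_less_div_times[of b a] by (intro exI[of _ "a div b"]) auto
  show ?thesis unfolding eq by (rule comp2[OF _ assms]) (intro comp_intros ex)
qed

lemma comp_mod [comp_intros]: assumes "computable f" "computable g" shows "computable (\<lambda>e. f e mod g e)"
proof -
  have eq: "a mod b = a - (a div b) * b" for a b :: nat by (simp add: minus_div_mult_eq_mod)
  show ?thesis unfolding eq by (intro comp_intros assms)
qed

lemma dec_odd [comp_intros]: assumes "computable f" shows "decidable (\<lambda>e. odd (f e))"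
proof -
  have eq: "odd a \<longleftrightarrow> a mod 2 = 1" for a :: nat by presburger
  show ?thesis unfolding eq by (intro comp_intros assms)
qed

lemma dec_even [comp_intros]: assumes "computable f" shows "decidable (\<lambda>e. even (f e))"
  using dec_not[OF dec_odd[OF assms]] by simp

lemma dec_set_decode [comp_intros]:
  assumes "computable f" "computable g" shows "decidable (\<lambda>e. f e \<in> set_decode (g e))"
  unfolding set_decode_def mem_Collect_eq by (intro comp_intros assms)

subsection \<open>Coded lists\<close>

text \<open>The number 0 codes the empty list and is also the default of both destructors, so
  \<open>nthc\<close> reads 0 beyond the end of a list. In a budget table this default means a
  vertex that need not be considered.\<close>

definition hdc :: "nat \<Rightarrow> nat" where "hdc c = (if c = 0 then 0 else pf (c - 1))"
definition tlc :: "nat \<Rightarrow> nat" where "tlc c = (if c = 0 then 0 else ps (c - 1))"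
definition dropc :: "nat \<Rightarrow> nat \<Rightarrow> nat" where "dropc i c = rec_nat c (\<lambda>_ y. tlc y) i"
definition nthc :: "nat \<Rightarrow> nat \<Rightarrow> nat" where "nthc c i = hdc (dropc i c)"
definition lenc :: "nat \<Rightarrow> nat" where "lenc c = length (list_decode c)"

lemma list_encode_Cons: "list_encode (x # xs) = Suc (pr x (list_encode xs))"
  by (simp add: pr_def)

lemma tlc_encode: "tlc (list_encode xs) = list_encode (tl xs)"
  by (cases xs) (auto simp: tlc_def list_encode_Cons simp del: list_encode.simps(2))

lemma dropc_encode: "dropc i (list_encode xs) = list_encode (drop i xs)"
  by (induction i) (auto simp: dropc_def tlc_encode drop_Suc tl_drop)

lemma nthc_encode: "nthc (list_encode xs) i = (if i < length xs then xs ! i else 0)"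
proof (cases "i < length xs")
  case True
  then have "drop i xs = xs ! i # drop (Suc i) xs" by (simp add: Cons_nth_drop_Suc)
  then show ?thesis using True by (simp add: nthc_def dropc_encode hdc_def list_encode_Cons del: list_encode.simps(2))
qed (simp add: nthc_def dropc_encode hdc_def)

lemma nthc_dropc: "nthc (dropc n c) x = nthc c (n + x)"
  using dropc_encode[of x "drop n (list_decode c)"] dropc_encode[of n "list_decode c"]
    dropc_encode[of "n + x" "list_decode c"] by (simp add: nthc_def add.commute)

lemma nthc_0 [simp]: "nthc 0 i = 0"
  using nthc_encode[of "[]" i] by simp

lemma lenc_encode [simp]: "lenc (list_encode xs) = length xs" by (simp add: lenc_def)

lemma lenc_Least: "lenc c = (LEAST i. dropc i c = 0)"
proof -
  obtain xs where c: "c = list_encode xs" by (metis list_decode_inverse)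
  have "list_encode ys = 0 \<longleftrightarrow> ys = []" for ys by (cases ys) auto
  then have "(dropc i c = 0) = (length xs \<le> i)" for i by (simp add: c dropc_encode)
  then show ?thesis by (auto simp: c intro!: Least_equality[symmetric])
qed

lemma comp_hdc [comp_intros]: "computable f \<Longrightarrow> computable (\<lambda>e. hdc (f e))"
  unfolding hdc_def by (intro comp_intros)

lemma comp_tlc [comp_intros]: "computable f \<Longrightarrow> computable (\<lambda>e. tlc (f e))"
  unfolding tlc_def by (intro comp_intros)

lemma comp_dropc [comp_intros]: assumes "computable f" "computable g" shows "computable (\<lambda>e. dropc (f e) (g e))"
  unfolding dropc_def by (rule comp2[OF _ assms]) (intro comp_intros)

lemma comp_nthc [comp_intros]: "computable f \<Longrightarrow> computable g \<Longrightarrow> computable (\<lambda>e. nthc (f e) (g e))"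
  unfolding nthc_def by (intro comp_intros)

lemma comp_lenc [comp_intros]: assumes "computable f" shows "computable (\<lambda>e. lenc (f e))"
proof -
  have "\<exists>i. dropc i e = 0" for e
    using dropc_encode[of "length (list_decode e)" "list_decode e"] by auto
  then show ?thesis unfolding lenc_Least
    by (intro comp_compose[OF _ assms, of "\<lambda>c. LEAST i. dropc i c = 0"]) (intro comp_intros)
qed

lemma less_pr: "a \<le> pr a b" "b \<le> pr a b"
  by (auto simp: pr_def le_prod_encode_1 le_prod_encode_2)

lemma pr_mono: "a \<le> a' \<Longrightarrow> b \<le> b' \<Longrightarrow> pr a b \<le> pr a' b'"
  unfolding pr_def prod_encode_def by (simp add: add_mono triangle_mono)

lemma list_encode_nth_less: "x \<in> set xs \<Longrightarrow> x < list_encode xs"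
proof (induction xs)
  case (Cons y xs)
  then show ?case using less_pr(1)[of y "list_encode xs"] less_pr(2)[of "list_encode xs" y]
    unfolding list_encode_Cons by auto
qed simp

text \<open>Pairing is monotone in both arguments. Hence all tables of bounded shape have codes
  below one computable number, which makes the search for budgets a bounded one.\<close>

lemma list_encode_mono:
  "length xs \<le> l \<Longrightarrow> \<forall>x\<in>set xs. x \<le> b \<Longrightarrow> list_encode xs \<le> list_encode (replicate l b)"
proof (induction xs arbitrary: l)
  case (Cons x xs)
  then obtain l' where l: "l = Suc l'" by (cases l) auto
  with Cons show ?case unfolding l replicate_Suc list_encode_Cons by (auto intro: pr_mono)
qed simp

lemma comp_list_encode_replicate [comp_intros]:
  assumes "computable f" "computable g" shows "computable (\<lambda>e. list_encode (replicate (f e) (g e)))"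
proof -
  have eq: "list_encode (replicate n b) = rec_nat 0 (\<lambda>i y. Suc (pr b y)) n" for n b
    by (induction n) (auto simp: pr_def)
  show ?thesis unfolding eq by (rule comp2[OF _ assms]) (intro comp_intros)
qed

text \<open>This is what lets course-of-values recursion on the code of a guard reach its
  subformulas.\<close>

lemma nthc_less: "0 < c \<Longrightarrow> nthc c i < c"
  using list_encode_nth_less[of "list_decode c ! i" "list_decode c"] nthc_encode[of "list_decode c" i]
  by (cases "i < length (list_decode c)") auto

text \<open>Course-of-values recursion: \<open>h\<close> codes the list of earlier values, latest first.\<close>

definition hist :: "(nat \<Rightarrow> nat \<Rightarrow> nat \<Rightarrow> nat) \<Rightarrow> nat \<Rightarrow> nat \<Rightarrow> nat" where
  "hist G e n = rec_nat 0 (\<lambda>i y. Suc (pr (G e i y) y)) n"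

definition cov :: "(nat \<Rightarrow> nat \<Rightarrow> nat \<Rightarrow> nat) \<Rightarrow> nat \<Rightarrow> nat \<Rightarrow> nat" where
  "cov G e n = G e n (hist G e n)"

lemma hist_encode: "hist G e n = list_encode (rev (map (cov G e) [0..<n]))"
  by (induction n) (auto simp: hist_def cov_def pr_def)

lemma nthc_hist: "i < n \<Longrightarrow> nthc (hist G e n) (n - Suc i) = cov G e i"
  unfolding hist_encode nthc_encode by (simp add: rev_nth)

lemma comp_cov:
  assumes "computable (\<lambda>p. G (pf p) (pf (ps p)) (ps (ps p)))" "computable f" "computable g"
  shows "computable (\<lambda>e. cov G (f e) (g e))"
proof (rule comp2[OF _ assms(2,3)])
  note G = comp3[OF assms(1)]
  show "computable (\<lambda>e. cov G (pf e) (ps e))"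
    unfolding cov_def hist_def by (intro G comp_intros)
qed

lemma decidable_set_dec: "decidable (\<lambda>n. n \<in> P) \<Longrightarrow> decidable_set P"
  unfolding decidable_def computable_def decidable_set_def by simp

section \<open>Bounding the memory of a controller\<close>

subsection \<open>Ranks from the absence of paths with infinitely many flags\<close>

definition edges :: "('v \<times> bool \<times> 'v) set \<Rightarrow> ('v \<times> 'v) set" where
  "edges E = {(v, v'). \<exists>c. (v, c, v') \<in> E}"

definition flagged_path :: "('v \<times> bool \<times> 'v) set \<Rightarrow> 'v set \<Rightarrow> (nat \<Rightarrow> 'v) \<Rightarrow> (nat \<Rightarrow> bool) \<Rightarrow> bool" where
  "flagged_path E I f c \<longleftrightarrow> f 0 \<in> I \<and> (\<forall>i. (f i, c i, f (Suc i)) \<in> E) \<and> infinite {i. c i}"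

text \<open>Unrolls a lasso: a stem from \<open>s\<close> to \<open>w'\<close>, then forever the
  return path from \<open>w'\<close> to \<open>w\<close> closed by the flagged edge.\<close>

lemma flagged_path_of_cycle:
  assumes s: "s \<in> I" and sw: "(s, w') \<in> (edges E)\<^sup>*" and flag: "(w, True, w') \<in> E"
    and return: "(w', w) \<in> (edges E)\<^sup>*"
  shows "\<exists>f c. flagged_path E I f c"
proof -
  obtain m where "(s, w') \<in> edges E ^^ m" using sw rtrancl_power by blast
  then obtain p where p: "p 0 = s" "p m = w'" "\<And>i. i < m \<Longrightarrow> (p i, p (Suc i)) \<in> edges E"
    by (auto simp: relpow_fun_conv)
  obtain k where "(w', w) \<in> edges E ^^ k" using return rtrancl_power by blast
  then obtain g where g: "g 0 = w'" "g k = w" "\<And>i. i < k \<Longrightarrow> (g i, g (Suc i)) \<in> edges E"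
    by (auto simp: relpow_fun_conv)
  \<comment> \<open>The period is \<open>Suc k\<close>: the return path has \<open>k\<close> edges,
    and the flagged edge leads from its last vertex, at residue \<open>k\<close>, back to residue
    0.\<close>
  define f where "f i = (if i < m then p i else g ((i - m) mod Suc k))" for i
  define c where "c i = ((f i, True, f (Suc i)) \<in> E)" for i
  have f0: "f 0 = s" using p g by (cases "m = 0") (auto simp: f_def)
  have step: "(f i, f (Suc i)) \<in> edges E \<and> (m \<le> i \<and> (i - m) mod Suc k = k \<longrightarrow> c i)" for i
  proof (cases "i < m")
    case True
    then have "f (Suc i) = p (Suc i)" using p(2) g(1) by (cases "Suc i = m") (auto simp: f_def)
    then show ?thesis using True p(3) by (simp add: f_def)
  next
    case False
    then have d: "Suc i - m = Suc (i - m)" by simp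
    show ?thesis
    proof (cases "(i - m) mod Suc k = k")
      case True
      then have "f i = w" "f (Suc i) = w'" using False g d by (auto simp: f_def mod_Suc)
      then show ?thesis using flag by (auto simp: edges_def c_def)
    next
      case neq: False
      have "(i - m) mod Suc k < Suc k" by simp
      then have lt: "(i - m) mod Suc k < k" using neq by linarith
      have "f i = g ((i - m) mod Suc k)" "f (Suc i) = g (Suc ((i - m) mod Suc k))"
        using False neq d by (auto simp: f_def mod_Suc)
      then show ?thesis using g(3)[OF lt] neq by simp
    qed
  qed
  have "\<forall>i. (f i, c i, f (Suc i)) \<in> E"
  proof
    fix i
    obtain c' where "(f i, c', f (Suc i)) \<in> E" using step[of i] by (auto simp: edges_def)
    then show "(f i, c i, f (Suc i)) \<in> E" by (cases c'; cases "c i") (auto simp: c_def)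
  qed
  moreover have "infinite {i. c i}"
  proof -
    have "c (m + k + q * Suc k)" for q
    proof -
      have e: "m + k + q * Suc k - m = k + q * Suc k" by simp
      have "(k + q * Suc k) mod Suc k = k" by (subst mod_mult_self1) simp
      then show ?thesis using step[of "m + k + q * Suc k"] e by simp
    qed
    then have "range (\<lambda>q. m + k + q * Suc k) \<subseteq> {i. c i}" by auto
    moreover have "infinite (range (\<lambda>q. m + k + q * Suc k))"
    proof -
      have "inj (\<lambda>q. m + k + q * Suc k)" by (rule injI) (simp only: add_left_cancel mult_cancel2 nat.simps simp_thms)
      then show ?thesis using finite_imageD infinite_UNIV_nat by blast
    qed
    ultimately show ?thesis by (rule infinite_super)
  qed
  ultimately show ?thesis using f0 s unfolding flagged_path_def by blast
qed

text \<open>The rank of a vertex counts the targets of flagged edges reachable from it; without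
  flagged cycles, taking a flagged edge loses its target.\<close>

lemma rank_exists:
  assumes fin: "finite V" and EV: "E \<subseteq> UNIV \<times> UNIV \<times> V"
    and no: "\<not> (\<exists>f c. flagged_path E I f c)"
  obtains b :: "'v \<Rightarrow> nat" where "\<And>v. b v \<le> card V"
    "\<And>s v c v'. s \<in> I \<Longrightarrow> (s, v) \<in> (edges E)\<^sup>* \<Longrightarrow> (v, c, v') \<in> E \<Longrightarrow> b v' + of_bool c \<le> b v"
proof
  define R where "R v = {w'. \<exists>w. (v, w) \<in> (edges E)\<^sup>* \<and> (w, True, w') \<in> E}" for v
  have RV: "R v \<subseteq> V" for v using EV by (auto simp: R_def)
  then have finR: "finite (R v)" for v using fin finite_subset by blast
  show "card (R v) \<le> card V" for v using RV fin card_mono by blast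
  fix s v c v'
  assume s: "s \<in> I" "(s, v) \<in> (edges E)\<^sup>*" and e: "(v, c, v') \<in> E"
  from e have vv': "(v, v') \<in> edges E" by (auto simp: edges_def)
  then have sub: "R v' \<subseteq> R v" by (auto simp: R_def intro: converse_rtrancl_into_rtrancl)
  show "card (R v') + of_bool c \<le> card (R v)"
  proof (cases c)
    case True
    then have "v' \<in> R v" using e by (auto simp: R_def)
    moreover have "v' \<notin> R v'"
      using flagged_path_of_cycle[OF s(1), of v' E] s(2) vv' no
      unfolding R_def by (auto dest: rtrancl_into_rtrancl)
    ultimately have "R v' \<subset> R v" using sub by auto
    then show ?thesis using True by (simp add: psubset_card_mono[OF finR] Suc_leI)
  next
    case False
    then show ?thesis using card_mono[OF finR sub] by simp
  qed
qed

subsection \<open>A deterministic tracking structure\<close>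

text \<open>A tracking state is a list of pairs \<open>(S, U)\<close> in order of age: \<open>S\<close> is propagated along the
  transitions, \<open>U \<subseteq> S\<close> collects the states reached through a flag since the last flash, and a flash
  (\<open>U = S\<close>) empties \<open>U\<close>. Each \<open>U\<close> is also spawned as a new first component at every step, and only
  the oldest of equal first components is kept. This weak form of Safra's determinisation
  detects every path with infinitely many flags.\<close>

definition img :: "('q \<times> bool \<times> 'q) set \<Rightarrow> 'q set \<Rightarrow> 'q set" where
  "img T A = {s'. \<exists>s c. s \<in> A \<and> (s, c, s') \<in> T}"

definition fimg :: "('q \<times> bool \<times> 'q) set \<Rightarrow> 'q set \<Rightarrow> 'q set" where
  "fimg T A = {s'. \<exists>s\<in>A. (s, True, s') \<in> T}"

definition marked :: "('q \<times> bool \<times> 'q) set \<Rightarrow> 'q set \<times> 'q set \<Rightarrow> 'q set" where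
  "marked T n = img T (snd n) \<union> fimg T (fst n)"

definition flash :: "('q \<times> bool \<times> 'q) set \<Rightarrow> 'q set \<times> 'q set \<Rightarrow> bool" where
  "flash T n \<longleftrightarrow> marked T n = img T (fst n)"

definition upd :: "('q \<times> bool \<times> 'q) set \<Rightarrow> 'q set \<times> 'q set \<Rightarrow> 'q set \<times> 'q set" where
  "upd T n = (img T (fst n), if flash T n then {} else marked T n)"

fun dedup :: "'a set \<Rightarrow> ('a \<times> 'b) list \<Rightarrow> ('a \<times> 'b) list" where
  "dedup A [] = []"
| "dedup A (n # ns) = (if fst n \<in> A then dedup A ns else n # dedup (insert (fst n) A) ns)"

text \<open>Starting \<open>dedup\<close> with \<open>{{}}\<close> discards components that have
  died out; the spawned sets are appended last and so count as the youngest.\<close>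

definition dstep :: "('q \<times> bool \<times> 'q) set \<Rightarrow> ('q set \<times> 'q set) list \<Rightarrow> ('q set \<times> 'q set) list" where
  "dstep T d = dedup {{}} (map (upd T) d @ map (\<lambda>n. (marked T n, {})) d)"

lemma dedup_set: "set (dedup A ns) \<subseteq> {n \<in> set ns. fst n \<notin> A}"
proof (induction ns arbitrary: A)
  case (Cons n ns)
  show ?case using Cons.IH[of A] Cons.IH[of "insert (fst n) A"] by auto
qed simp

lemma dedup_distinct: "distinct (map fst (dedup A ns))"
proof (induction ns arbitrary: A)
  case (Cons n ns)
  then show ?case using dedup_set[of "insert (fst n) A" ns] by auto
qed simp

text \<open>Deletions only shift entries to the left, and a deleted entry leaves an older copy of
  its first component behind. A position is kept only if nothing up to it was deleted, in which case
  the whole prefix is intact.\<close>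

lemma dedup_position:
  "p < length ns \<Longrightarrow> fst (ns ! p) \<notin> A \<Longrightarrow> \<exists>p'\<le>p. p' < length (dedup A ns) \<and>
    fst (dedup A ns ! p') = fst (ns ! p) \<and> (p' = p \<longrightarrow> take (Suc p) (dedup A ns) = take (Suc p) ns)"
proof (induction ns arbitrary: A p)
  case (Cons n ns)
  show ?case
  proof (cases "fst n \<in> A")
    case True
    with Cons.prems obtain p1 where p: "p = Suc p1" by (cases p) auto
    then obtain p' where p': "p' \<le> p1" "p' < length (dedup A ns)"
      "fst (dedup A ns ! p') = fst (ns ! p1)" using Cons.IH[of p1 A] Cons.prems by auto
    then show ?thesis using True by (intro exI[of _ p']) (auto simp: p)
  next
    case False
    show ?thesis
    proof (cases p)
      case 0
      then show ?thesis using False by (intro exI[of _ 0]) auto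
    next
      case (Suc p1)
      show ?thesis
      proof (cases "fst (ns ! p1) = fst n")
        case True
        then show ?thesis using Suc False by (intro exI[of _ 0]) auto
      next
        case neq: False
        with Cons.prems Suc obtain p' where p': "p' \<le> p1" "p' < length (dedup (insert (fst n) A) ns)"
          "fst (dedup (insert (fst n) A) ns ! p') = fst (ns ! p1)"
          "p' = p1 \<longrightarrow> take (Suc p1) (dedup (insert (fst n) A) ns) = take (Suc p1) ns"
          using Cons.IH[of p1 "insert (fst n) A"] by auto
        then show ?thesis using Suc False by (intro exI[of _ "Suc p'"]) auto
      qed
    qed
  qed
qed simp

lemma dstep_position:
  assumes "p < length d" "img T (fst (d ! p)) \<noteq> {}"
  shows "\<exists>p'\<le>p. p' < length (dstep T d) \<and> fst (dstep T d ! p') = img T (fst (d ! p)) \<and>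
    (p' = p \<longrightarrow> take (Suc p) (dstep T d) = map (upd T) (take (Suc p) d))"
proof -
  let ?ns = "map (upd T) d @ map (\<lambda>n. (marked T n, {})) d"
  have "?ns ! p = upd T (d ! p)" "take (Suc p) ?ns = map (upd T) (take (Suc p) d)"
    using assms(1) by (auto simp: nth_append take_map)
  then show ?thesis using dedup_position[of p ?ns "{{}}"] assms by (auto simp: dstep_def upd_def)
qed

lemma dstep_spawn:
  assumes "n \<in> set d" "marked T n \<noteq> {}"
  shows "marked T n \<in> fst ` set (dstep T d)"
proof -
  let ?ns = "map (upd T) d @ map (\<lambda>n. (marked T n, {})) d"
  have "(marked T n, {}) \<in> set ?ns" using assms by auto
  then obtain p where p: "p < length ?ns" "?ns ! p = (marked T n, {})" by (metis in_set_conv_nth)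
  then obtain p' where "p' < length (dstep T d)" "fst (dstep T d ! p') = marked T n"
    using dedup_position[of p ?ns "{{}}"] assms(2) by (auto simp: dstep_def)
  then show ?thesis by (metis image_eqI nth_mem)
qed

lemma marked_subset: "snd n \<subseteq> fst n \<Longrightarrow> marked T n \<subseteq> img T (fst n)"
  by (auto simp: marked_def img_def fimg_def)

lemma dstep_nodes:
  assumes "n \<in> set (dstep T d)" and "\<forall>n\<in>set d. snd n \<subseteq> fst n"
  shows "fst n \<noteq> {}" "snd n \<subseteq> fst n" "\<exists>n'\<in>set d. fst n \<subseteq> img T (fst n')"
proof -
  have n: "n \<in> {n \<in> set (map (upd T) d @ map (\<lambda>n. (marked T n, {})) d). fst n \<notin> {{}}}"
    using assms(1) unfolding dstep_def by (rule subsetD[OF dedup_set])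
  then show "fst n \<noteq> {}" by simp
  from n obtain n' where n': "n' \<in> set d" "n = upd T n' \<or> n = (marked T n', {})" by auto
  have "marked T n' \<subseteq> img T (fst n')" by (rule marked_subset) (use n'(1) assms(2) in blast)
  then show "snd n \<subseteq> fst n" "\<exists>n'\<in>set d. fst n \<subseteq> img T (fst n')"
    using n' by (elim disjE; simp add: upd_def, blast?)+
qed

text \<open>The whole prefix up to \<open>j\<close> must survive without merging, not just position
  \<open>j\<close>: the lexicographic comparison of weights also looks at the older
  positions.\<close>

definition stable :: "(nat \<Rightarrow> ('q \<times> bool \<times> 'q) set) \<Rightarrow> (nat \<Rightarrow> ('q set \<times> 'q set) list) \<Rightarrow> nat \<Rightarrow> nat \<Rightarrow> bool" where
  "stable T d t j \<longleftrightarrow> j < length (d t) \<and> take (Suc j) (d (Suc t)) = map (upd (T t)) (take (Suc j) (d t))"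

lemma stable_nth:
  assumes "stable T d t j" "i \<le> j"
  shows "d (Suc t) ! i = upd (T t) (d t ! i)"
proof -
  have "take (Suc j) (d (Suc t)) ! i = map (upd (T t)) (take (Suc j) (d t)) ! i"
    using assms by (simp add: stable_def)
  then show ?thesis using assms by (simp add: stable_def)
qed

lemma nat_seq_stabilizes:
  fixes f :: "nat \<Rightarrow> nat"
  assumes "\<And>t. t0 \<le> t \<Longrightarrow> f (Suc t) \<le> f t"
  shows "\<exists>t1\<ge>t0. \<forall>t\<ge>t1. f t = f t1"
proof -
  define q where "q = (LEAST q. \<exists>t\<ge>t0. f t = q)"
  have "\<exists>t\<ge>t0. f t = q" unfolding q_def by (rule LeastI_ex) blast
  then obtain t1 where t1: "t1 \<ge> t0" "f t1 = q" by blast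
  have "f t = q" if "t \<ge> t1" for t
    using that
  proof (induction t rule: dec_induct)
    case (step t)
    have "q \<le> f (Suc t)" unfolding q_def by (rule Least_le) (use step(1) t1 in \<open>auto intro!: exI[of _ "Suc t"]\<close>)
    moreover have "f (Suc t) \<le> f t" using assms step t1 by auto
    ultimately show ?case using step by simp
  qed (use t1 in simp)
  then show ?thesis using t1 by auto
qed

text \<open>The least position holding \<open>X t\<close> can only move towards the older end, hence
  is eventually constant; from then on nothing in front of it is merged.\<close>

lemma thread_stabilizes:
  assumes dS: "\<And>t. d (Suc t) = dstep (T t) (d t)"
    and X0: "X t0 \<in> fst ` set (d t0)" and XS: "\<And>t. t0 \<le> t \<Longrightarrow> X (Suc t) = img (T t) (X t)"
    and ne: "\<And>t. t0 \<le> t \<Longrightarrow> X t \<noteq> {}"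
  shows "\<exists>q t1. t0 \<le> t1 \<and> (\<forall>t\<ge>t1. stable T d t q \<and> fst (d t ! q) = X t)"
proof -
  define P where "P t p \<longleftrightarrow> p < length (d t) \<and> fst (d t ! p) = X t" for t p
  have step: "\<exists>p'\<le>p. P (Suc t) p' \<and> (p' = p \<longrightarrow> stable T d t p)" if "t0 \<le> t" "P t p" for t p
    using dstep_position[of p "d t" "T t"] that ne[of "Suc t"] XS[of t]
    unfolding P_def stable_def dS by auto
  have ex: "\<exists>p. P t p" if "t0 \<le> t" for t
    using that
  proof (induction t rule: dec_induct)
    case base
    obtain n where "n \<in> set (d t0)" "fst n = X t0" using X0 by auto
    then show ?case unfolding P_def by (metis in_set_conv_nth)
  qed (use step in blast)
  define f where "f t = (LEAST p. P t p)" for t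
  have Pf: "P t (f t)" if "t0 \<le> t" for t unfolding f_def using ex[OF that] by (rule LeastI_ex)
  have dec: "f (Suc t) \<le> f t" if "t0 \<le> t" for t
    using step[OF that Pf[OF that]] unfolding f_def[of "Suc t"] by (meson Least_le order_trans)
  obtain t1 where t1: "t1 \<ge> t0" "\<And>t. t \<ge> t1 \<Longrightarrow> f t = f t1" using nat_seq_stabilizes[of t0 f] dec by blast
  have "stable T d t (f t1) \<and> fst (d t ! f t1) = X t" if t: "t \<ge> t1" for t
  proof -
    have t0: "t0 \<le> t" using t t1 by simp
    obtain p' where p': "p' \<le> f t" "P (Suc t) p'" "p' = f t \<longrightarrow> stable T d t (f t)"
      using step[OF t0 Pf[OF t0]] by blast
    have "f (Suc t) \<le> p'" unfolding f_def[of "Suc t"] using p'(2) by (rule Least_le)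
    then have "p' = f t" using p'(1) t1(2)[of t] t1(2)[of "Suc t"] t by simp
    then show ?thesis using p' Pf[OF t0] t1(2)[OF t] unfolding P_def by simp
  qed
  then show ?thesis using t1(1) by blast
qed

text \<open>By contradiction. If a permanent position carrying the path flashes only finitely often,
  then after a later flag the path stays in its \<open>U\<close> forever. A copy of \<open>U\<close>
  spawned then settles at a permanent position with a strictly smaller first component, because
  without flashes \<open>U \<noteq> S\<close>. Finitely many positions cannot support this
  descent.\<close>

lemma flags_imp_flashes:
  assumes dS: "\<And>t. d (Suc t) = dstep (T t) (d t)"
    and len: "\<And>t. length (d t) \<le> N"
    and sub: "\<And>t. \<forall>n\<in>set (d t). snd n \<subseteq> fst n \<and> finite (fst n)"
    and path: "\<And>t. (s t, c t, s (Suc t)) \<in> T t" and inf: "infinite {t. c t}"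
    and start: "n0 \<in> set (d 0)" "s 0 \<in> fst n0"
  shows "\<exists>j t1. (\<forall>t\<ge>t1. stable T d t j) \<and> infinite {t. flash (T t) (d t ! j)}"
proof (rule ccontr)
  assume contra: "\<not> ?thesis"
  have img_path: "s (Suc t) \<in> img (T t) A" if "s t \<in> A" for t A using path that by (auto simp: img_def)
  \<comment> \<open>The positions that are eventually permanent and contain the current state of the
    path. There are at most \<open>N\<close>, the bound on the length of the lists.\<close>
  define G where "G = {q. \<forall>\<^sub>F t in sequentially. stable T d t q \<and> s t \<in> fst (d t ! q)}"
  have thread: "\<exists>q\<in>G. \<forall>\<^sub>F t in sequentially. fst (d t ! q) = X t"
    if X: "X t0 \<in> fst ` set (d t0)" "\<And>t. t0 \<le> t \<Longrightarrow> X (Suc t) = img (T t) (X t)" "s t0 \<in> X t0" for X t0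
  proof -
    have sX: "s t \<in> X t" if "t0 \<le> t" for t
      using that by (induction t rule: dec_induct) (use X img_path in auto)
    then obtain q t1 where "t0 \<le> t1" "\<forall>t\<ge>t1. stable T d t q \<and> fst (d t ! q) = X t"
      using thread_stabilizes[of d T X t0, OF dS X(1,2)] by blast
    then show ?thesis using sX
      by (intro bexI[of _ q]) (auto simp: G_def eventually_sequentially intro!: exI[of _ t1])
  qed
  have "\<exists>q. q \<in> G"
  proof -
    define X where "X t = rec_nat (fst n0) (\<lambda>t A. img (T t) A) t" for t
    show ?thesis using thread[of X 0] start by (auto simp: X_def)
  qed
  have finG: "finite G"
  proof (rule finite_subset)
    show "G \<subseteq> {..<N}"
    proof
      fix q assume "q \<in> G"
      then obtain t where "stable T d t q" unfolding G_def eventually_sequentially by blast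
      then show "q \<in> {..<N}" using len[of t] by (auto simp: stable_def)
    qed
  qed simp
  have down: "\<exists>q'\<in>G. \<forall>\<^sub>F t in sequentially. fst (d t ! q') \<subset> fst (d t ! q)" if q: "q \<in> G" for q
  proof -
    obtain t1 where t1: "\<And>t. t \<ge> t1 \<Longrightarrow> stable T d t q \<and> s t \<in> fst (d t ! q)"
      using q unfolding G_def eventually_sequentially by auto
    then have "finite {t. flash (T t) (d t ! q)}" using contra by blast
    then obtain t2 where t2: "\<And>t. flash (T t) (d t ! q) \<Longrightarrow> t < t2"
      using finite_nat_set_iff_bounded by auto
    define t3 where "t3 = max t1 t2"
    have nf: "\<not> flash (T t) (d t ! q)" "stable T d t q" "s t \<in> fst (d t ! q)" if "t \<ge> t3" for t
      using t1[of t] t2[of t] that by (auto simp: t3_def)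
    have nx: "d (Suc t) ! q = (img (T t) (fst (d t ! q)), marked (T t) (d t ! q))" if "t \<ge> t3" for t
      using stable_nth[OF nf(2)[OF that]] nf(1)[OF that] by (simp add: upd_def)
    obtain t4 where t4: "t4 \<ge> t3" "c t4" using inf unfolding infinite_nat_iff_unbounded_le by auto
    have inU: "s t \<in> snd (d t ! q)" if "t \<ge> Suc t4" for t
      using that
    proof (induction t rule: dec_induct)
      case base
      have "s (Suc t4) \<in> fimg (T t4) (fst (d t4 ! q))" using path[of t4] t4 nf(3)[of t4] by (auto simp: fimg_def)
      then show ?case using nx[OF t4(1)] by (simp add: marked_def)
    next
      case (step t)
      then show ?case using nx[of t] t4 img_path[of t "snd (d t ! q)"] by (simp add: marked_def)
    qed
    define t5 where "t5 = Suc t4"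
    have t5: "t5 \<ge> t3" using t4 by (simp add: t5_def)
    define X where "X t = rec_nat (snd (d (Suc t5) ! q)) (\<lambda>i A. img (T (Suc t5 + i)) A) (t - Suc t5)" for t
    have XS: "X (Suc t) = img (T t) (X t)" if "Suc t5 \<le> t" for t
    proof -
      have "Suc t - Suc t5 = Suc (t - Suc t5)" "Suc t5 + (t - Suc t5) = t" using that by auto
      then show ?thesis unfolding X_def by (simp only: nat.rec)
    qed
    have X0: "X (Suc t5) = marked (T t5) (d t5 ! q)" using nx[OF t5] by (simp add: X_def)
    have sX: "s (Suc t5) \<in> X (Suc t5)" using inU[of "Suc t5"] by (simp add: X_def t5_def)
    have "d t5 ! q \<in> set (d t5)" using nf(2)[OF t5] by (simp add: stable_def)
    then have "X (Suc t5) \<in> fst ` set (d (Suc t5))"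
      using dstep_spawn[of "d t5 ! q" "d t5" "T t5"] sX X0 dS by auto
    from thread[OF this XS sX] obtain q' where q': "q' \<in> G" "\<forall>\<^sub>F t in sequentially. fst (d t ! q') = X t"
      by blast
    have XU: "X t \<subseteq> snd (d t ! q)" if "t \<ge> Suc t5" for t
      using that
    proof (induction t rule: dec_induct)
      case base
      show ?case using nx[OF t5] X0 by simp
    next
      case (step t)
      then show ?case using nx[of t] t5 XS[of t] by (auto simp: marked_def img_def)
    qed
    have US: "snd (d t ! q) \<subset> fst (d t ! q)" if "t \<ge> Suc t5" for t
    proof -
      obtain t' where t': "t = Suc t'" "t' \<ge> t3" using \<open>t \<ge> Suc t5\<close> t5 by (cases t) auto
      have "d t' ! q \<in> set (d t')" using nf(2)[OF t'(2)] by (simp add: stable_def)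
      from bspec[OF sub this] have "marked (T t') (d t' ! q) \<subseteq> img (T t') (fst (d t' ! q))"
        by (intro marked_subset) simp
      then show ?thesis using nx[OF t'(2)] nf(1)[OF t'(2)] t'(1) by (simp add: flash_def psubset_eq)
    qed
    have "\<forall>\<^sub>F t in sequentially. t \<ge> Suc t5" by (rule eventually_ge_at_top)
    with q'(2) have "\<forall>\<^sub>F t in sequentially. fst (d t ! q') \<subset> fst (d t ! q)"
    proof eventually_elim
      case (elim t)
      then show ?case using XU[of t] US[of t] by auto
    qed
    with q'(1) show ?thesis by blast
  qed
  then have "\<forall>q\<in>G. \<exists>q'. q' \<in> G \<and> (\<forall>\<^sub>F t in sequentially. fst (d t ! q') \<subset> fst (d t ! q))" by blast
  from bchoice[OF this] obtain h where h: "\<And>q. q \<in> G \<Longrightarrow> h q \<in> G"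
    "\<And>q. q \<in> G \<Longrightarrow> \<forall>\<^sub>F t in sequentially. fst (d t ! h q) \<subset> fst (d t ! q)" by blast
  have "\<forall>\<^sub>F t in sequentially. \<forall>q\<in>G. fst (d t ! h q) \<subset> fst (d t ! q) \<and> stable T d t q"
    using finG h(2) by (intro eventually_ball_finite) (auto simp: G_def eventually_conj_iff)
  then obtain t where t: "\<And>q. q \<in> G \<Longrightarrow> fst (d t ! h q) \<subset> fst (d t ! q) \<and> stable T d t q"
    unfolding eventually_sequentially by blast
  \<comment> \<open>The time \<open>t\<close> is one at which all strict inclusions hold
    simultaneously, available because \<open>G\<close> is finite; a component of least cardinality
    then contradicts its own successor \<open>h q\<close>.\<close>
  obtain q where q: "q \<in> G" "\<And>q'. q' \<in> G \<Longrightarrow> card (fst (d t ! q)) \<le> card (fst (d t ! q'))"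
    using ex_has_least_nat[of "\<lambda>q. q \<in> G" _ "\<lambda>q. card (fst (d t ! q))"] \<open>\<exists>q. q \<in> G\<close> by blast
  have "finite (fst (d t ! q))" using t[OF q(1)] bspec[OF sub, of "d t ! q" t] by (simp add: stable_def)
  then have "card (fst (d t ! h q)) < card (fst (d t ! q))" using t[OF q(1)] psubset_card_mono by blast
  then show False using q(2)[OF h(1)[OF q(1)]] by simp
qed

subsection \<open>Shrinking a finite-memory strategy\<close>

definition strategy_edges :: "('x \<Rightarrow> 'y \<Rightarrow> ('q \<times> bool \<times> 'q) set) \<Rightarrow> 'x set \<Rightarrow> 'l set \<Rightarrow>
    ('l \<Rightarrow> 'x \<Rightarrow> 'l \<times> 'y) \<Rightarrow> (('l \<times> 'q) \<times> bool \<times> ('l \<times> 'q)) set" where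
  "strategy_edges Tr Xs L \<delta> =
    {((l, s), c, (l', s')). l \<in> L \<and> (\<exists>x\<in>Xs. \<exists>y. \<delta> l x = (l', y) \<and> (s, c, s') \<in> Tr x y)}"

text \<open>Pairs produced by a common sequence of moves of Player I; they determine which memory
  states of the given strategy may stand in for a tracking state.\<close>

inductive_set joint ::
  "('x \<Rightarrow> 'y \<Rightarrow> ('q \<times> bool \<times> 'q) set) \<Rightarrow> ('l \<Rightarrow> 'x \<Rightarrow> 'l \<times> 'y) \<Rightarrow> 'x set \<Rightarrow>
   ('q set \<times> 'q set) list \<Rightarrow> 'l \<Rightarrow> (('q set \<times> 'q set) list \<times> 'l) set"
  for Tr \<delta> Xs d0 l0 where
  joint_start: "(d0, l0) \<in> joint Tr \<delta> Xs d0 l0"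
| joint_step: "(d, l) \<in> joint Tr \<delta> Xs d0 l0 \<Longrightarrow> x \<in> Xs \<Longrightarrow>
    (dstep (Tr x (snd (\<delta> l x))) d, fst (\<delta> l x)) \<in> joint Tr \<delta> Xs d0 l0"

text \<open>A state in \<open>U\<close> has met a flag since the last flash. The extra unit records
  the budget spent on it, to be cashed in at the next flash.\<close>

definition weight :: "('l \<Rightarrow> 'q \<Rightarrow> nat) \<Rightarrow> 'l \<Rightarrow> 'q set \<times> 'q set \<Rightarrow> nat" where
  "weight b l n = Max ((\<lambda>s. b l s + of_bool (s \<in> snd n)) ` fst n)"

text \<open>A state enters \<open>U\<close> through a flag, which costs a unit of budget, or
  inherits the unit from a predecessor in \<open>U\<close>; so the maximum cannot grow. At a flash
  every state of the image carries the unit, and emptying \<open>U\<close> removes it from the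
  maximum.\<close>

lemma weight_upd:
  assumes fin: "finite (fst n)" "finite (img T (fst n))" and ne: "img T (fst n) \<noteq> {}"
    and mono: "\<And>s c s'. s \<in> fst n \<Longrightarrow> (s, c, s') \<in> T \<Longrightarrow> b l' s' + of_bool c \<le> b l s"
    and sub: "snd n \<subseteq> fst n"
  shows "weight b l' (upd T n) + of_bool (flash T n) \<le> weight b l n"
proof -
  have le: "b l' s' + of_bool (s' \<in> marked T n) \<le> weight b l n" if s': "s' \<in> img T (fst n)" for s'
  proof -
    have up: "b l s + of_bool (s \<in> snd n) \<le> weight b l n" if "s \<in> fst n" for s
      unfolding weight_def using that fin by (intro Max_ge) auto
    obtain s c where s: "s \<in> fst n" "(s, c, s') \<in> T" using s' by (auto simp: img_def)
    consider "s' \<in> img T (snd n)" | "s' \<in> fimg T (fst n)" | "s' \<notin> marked T n" by (auto simp: marked_def)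
    then show ?thesis
    proof cases
      case 1
      then obtain u c where u: "u \<in> snd n" "(u, c, s') \<in> T" by (auto simp: img_def)
      then have "b l' s' \<le> b l u" using mono[of u c s'] sub by auto
      then show ?thesis using up[of u] u sub by (auto split: if_splits)
    next
      case 2
      then obtain u where u: "u \<in> fst n" "(u, True, s') \<in> T" by (auto simp: fimg_def)
      then have "b l' s' + 1 \<le> b l u" using mono[of u True s'] by auto
      then show ?thesis using up[of u] u by (auto split: if_splits)
    next
      case 3
      then show ?thesis using mono[OF s] up[OF s(1)] by auto
    qed
  qed
  have "weight b l' (upd T n) \<in> (\<lambda>s. b l' s + of_bool (s \<in> snd (upd T n))) ` img T (fst n)"
  proof -
    have e: "fst (upd T n) = img T (fst n)" by (simp add: upd_def)
    show ?thesis unfolding weight_def e by (rule Max_in) (use fin(2) ne in simp_all)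
  qed
  then obtain s' where s': "s' \<in> img T (fst n)"
    "weight b l' (upd T n) = b l' s' + of_bool (s' \<in> snd (upd T n))" by auto
  have "of_bool (s' \<in> snd (upd T n)) + of_bool (flash T n) \<le> (of_bool (s' \<in> marked T n) :: nat)"
    using s'(1) by (auto simp: upd_def flash_def)
  then show ?thesis using le[OF s'(1)] s'(2) by linarith
qed

lemma lenlex_of_all2:
  assumes "list_all2 (\<le>) xs (ys :: nat list)"
  shows "(xs, ys) \<in> lenlex less_than \<or> xs = ys"
  using assms
proof (induction rule: list_all2_induct)
  case (Cons x xs y ys)
  moreover have "length xs = length ys" using Cons by (auto dest: list_all2_lengthD)
  ultimately show ?case by (auto simp: Cons_lenlex_iff)
qed simp

text \<open>Representatives are minimal with respect to all positions, but weights are monotone only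
  on a stable prefix. Truncation may turn a drop into equality, never into a rise.\<close>

lemma lenlex_take:
  assumes "(xs, ys) \<in> lenlex less_than" "length xs = length (ys :: nat list)"
  shows "(take p xs, take p ys) \<in> lenlex less_than \<or> take p xs = take p ys"
  using assms(2,1)
proof (induction xs ys arbitrary: p rule: list_induct2)
  case (Cons x xs y ys)
  show ?case
  proof (cases p)
    case (Suc p')
    then show ?thesis using Cons Cons.IH[of p'] by (auto simp: Cons_lenlex_iff)
  qed simp
qed simp

lemma lenlex_nat_total: "(xs, ys) \<in> lenlex less_than \<or> xs = ys \<or> (ys, xs) \<in> lenlex (less_than :: nat rel)"
proof -
  have "total (lenlex (less_than :: nat rel))" by (rule total_lenlex) (auto simp: total_on_def)
  then show ?thesis by (auto simp: total_on_def)
qed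

lemma wf_sequence_finite_drops:
  assumes "wf r" and step: "\<And>t. t0 \<le> t \<Longrightarrow> (A (Suc t), A t) \<in> r \<or> A (Suc t) = A t"
  shows "finite {t. (A (Suc t), A t) \<in> r}"
proof -
  obtain z where z: "z \<in> A ` {t0..}" "\<And>y. (y, z) \<in> r \<Longrightarrow> y \<notin> A ` {t0..}"
    using wfE_min[OF assms(1), of "A t0" "A ` {t0..}"] by auto
  then obtain t1 where t1: "t1 \<ge> t0" "A t1 = z" by auto
  have "A t = z" if "t \<ge> t1" for t
    using that
  proof (induction t rule: dec_induct)
    case (step t)
    have "A (Suc t) \<in> A ` {t0..}" using step(1) t1 by auto
    then show ?case using assms(2)[of t] step(1,3) t1 z(2)[of "A (Suc t)"] by auto
  qed (use t1 in simp)
  then have "(A (Suc t), A t) \<notin> r" if "t \<ge> t1" for t using that assms(1) by (simp add: wf_not_refl)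
  then have "{t. (A (Suc t), A t) \<in> r} \<subseteq> {..<t1}" by (auto simp: not_le[symmetric])
  then show ?thesis using finite_subset by blast
qed

lemma card_lists_le:
  assumes "finite A"
  shows "card {xs. set xs \<subseteq> A \<and> length xs \<le> N} \<le> (card A + 1) ^ N"
proof -
  have "(\<Sum>i\<le>N. card A ^ i) \<le> (\<Sum>i\<le>N. (N choose i) * card A ^ i)"
    by (intro sum_mono) (auto simp: Suc_leI zero_less_binomial_iff)
  also have "\<dots> = (card A + 1) ^ N" using binomial[of "card A" 1 N] by simp
  finally show ?thesis using card_lists_length_le[OF assms] by simp
qed

text \<open>Bounds the number of lists of length at most \<open>2 ^ n\<close> over the
  \<open>4 ^ n\<close> pairs of subsets of an \<open>n\<close>-element set; the length bound comes
  from distinct first components.\<close>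

definition memory_bound :: "nat \<Rightarrow> nat" where
  "memory_bound n = (4 ^ n + 1) ^ (2 ^ n)"

text \<open>The memory of the new strategy is the tracking state \<open>d\<close> itself. It moves like the given
  strategy in the memory state \<open>l\<close>, among those that can occur together with \<open>d\<close>, whose list of
  weights is lexicographically minimal. On a stable position and all older ones the weights never
  increase, and they drop whenever that position flashes.\<close>

lemma small_strategy:
  fixes Q :: "'q set" and b :: "'l \<Rightarrow> 'q \<Rightarrow> nat"
  assumes finQ: "finite Q" and TrQ: "\<And>x y. Tr x y \<subseteq> UNIV \<times> UNIV \<times> Q"
    and Init: "Init \<subseteq> Q"
    and R0: "\<And>s. s \<in> Init \<Longrightarrow> (l0, s) \<in> R"
    and RS: "\<And>l s x c s'. (l, s) \<in> R \<Longrightarrow> x \<in> Xs \<Longrightarrow> (s, c, s') \<in> Tr x (snd (\<delta> l x)) \<Longrightarrow>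
      (fst (\<delta> l x), s') \<in> R \<and> b (fst (\<delta> l x)) s' + of_bool c \<le> b l s"
    and l0: "l0 \<in> L" and \<delta>: "\<And>l x. l \<in> L \<Longrightarrow> x \<in> Xs \<Longrightarrow> \<delta> l x \<in> L \<times> Ys"
  obtains D d0 \<delta>' where "finite D" "card D \<le> memory_bound (card Q)"
    "d0 \<in> (D :: ('q set \<times> 'q set) list set)"
    "\<And>d x. d \<in> D \<Longrightarrow> x \<in> Xs \<Longrightarrow> \<delta>' d x \<in> D \<times> Ys"
    "\<not> (\<exists>f c. flagged_path (strategy_edges Tr Xs D \<delta>')
      ({d0} \<times> Init) f c)"
proof -
  \<comment> \<open>With \<open>dedup\<close>, an empty \<open>Init\<close> gives the empty list, so
    that the invariant of nonempty components holds from the start.\<close>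
  define d0 where "d0 = dedup {{}} [(Init, {} :: 'q set)]"
  define J where "J = joint Tr \<delta> Xs d0 l0"
  have J0: "(d0, l0) \<in> J" and JS: "\<And>d l x. (d, l) \<in> J \<Longrightarrow> x \<in> Xs \<Longrightarrow> (dstep (Tr x (snd (\<delta> l x))) d, fst (\<delta> l x)) \<in> J"
    unfolding J_def by (auto intro: joint_start joint_step)
  have inv: "l \<in> L \<and> distinct (map fst d) \<and>
      (\<forall>n\<in>set d. fst n \<noteq> {} \<and> snd n \<subseteq> fst n \<and> fst n \<subseteq> Q \<and> (\<forall>s\<in>fst n. (l, s) \<in> R))"
    if "(d, l) \<in> J" for d l
    using that unfolding J_def
  proof (induction rule: joint.induct)
    case joint_start
    then show ?case using l0 R0 Init by (auto simp: d0_def)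
  next
    case (joint_step d l x)
    let ?T = "Tr x (snd (\<delta> l x))"
    have "fst n \<noteq> {} \<and> snd n \<subseteq> fst n \<and> fst n \<subseteq> Q \<and> (\<forall>s\<in>fst n. (fst (\<delta> l x), s) \<in> R)" if n: "n \<in> set (dstep ?T d)" for n
    proof -
      have s: "\<forall>n\<in>set d. snd n \<subseteq> fst n" using joint_step.IH by blast
      obtain n' where n': "n' \<in> set d" "fst n \<subseteq> img ?T (fst n')" using dstep_nodes(3)[OF n s] by blast
      have "s' \<in> Q \<and> (fst (\<delta> l x), s') \<in> R" if s': "s' \<in> fst n" for s'
      proof -
        obtain s c where sc: "s \<in> fst n'" "(s, c, s') \<in> ?T" using n'(2) s' unfolding img_def by blast
        moreover have "(l, s) \<in> R" using sc(1) n'(1) joint_step.IH by blast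
        ultimately show ?thesis using RS[OF _ joint_step.hyps(2)] TrQ by blast
      qed
      then show ?thesis using dstep_nodes(1,2)[OF n s] by blast
    qed
    moreover have "distinct (map fst (dstep ?T d))" unfolding dstep_def by (rule dedup_distinct)
    moreover have "fst (\<delta> l x) \<in> L" using \<delta>[of l x] joint_step by auto
    ultimately show ?case by blast
  qed
  define D where "D = fst ` J"
  have Dsub: "D \<subseteq> {d. set d \<subseteq> Pow Q \<times> Pow Q \<and> length d \<le> 2 ^ card Q}"
  proof
    fix d assume "d \<in> D"
    then obtain l where "(d, l) \<in> J" by (auto simp: D_def)
    note i = inv[OF this]
    have "set (map fst d) \<subseteq> Pow Q" using i by auto
    then have "card (set (map fst d)) \<le> card (Pow Q)" by (intro card_mono) (use finQ in auto)
    moreover have "card (set (map fst d)) = length (map fst d)" using i distinct_card by blast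
    ultimately have "length d \<le> 2 ^ card Q" by (simp add: card_Pow[OF finQ])
    moreover have "n \<in> Pow Q \<times> Pow Q" if "n \<in> set d" for n
    proof -
      have "fst n \<subseteq> Q" "snd n \<subseteq> fst n" using i that by blast+
      then show ?thesis by (auto simp: mem_Times_iff)
    qed
    ultimately show "d \<in> {d. set d \<subseteq> Pow Q \<times> Pow Q \<and> length d \<le> 2 ^ card Q}" by blast
  qed
  have finP: "finite (Pow Q \<times> Pow Q)" using finQ by simp
  have finD: "finite D" using Dsub finite_lists_length_le[OF finP] finite_subset by blast
  have "card D \<le> (card (Pow Q \<times> Pow Q) + 1) ^ (2 ^ card Q)"
    using card_mono[OF finite_lists_length_le[OF finP] Dsub] card_lists_le[OF finP] by (rule order_trans)
  also have "card (Pow Q \<times> Pow Q) = 4 ^ card Q"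
    by (simp add: card_cartesian_product card_Pow[OF finQ] power_mult_distrib[symmetric])
  finally have cardD: "card D \<le> memory_bound (card Q)" by (simp add: memory_bound_def)
  define sig where "sig d l = map (weight b l) d" for d l
  have min: "\<exists>l. (d, l) \<in> J \<and> (\<forall>l'. (d, l') \<in> J \<longrightarrow> (sig d l', sig d l) \<notin> lenlex less_than)" if dD: "d \<in> D" for d
  proof -
    obtain l where "(d, l) \<in> J" using dD by (auto simp: D_def)
    then have "sig d l \<in> sig d ` {l. (d, l) \<in> J}" by blast
    from wfE_min[OF wf_lenlex[OF wf_less_than] this] obtain z where z: "z \<in> sig d ` {l. (d, l) \<in> J}"
      "\<And>y. (y, z) \<in> lenlex less_than \<Longrightarrow> y \<notin> sig d ` {l. (d, l) \<in> J}" by (metis (no_types))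
    from z(1) obtain l1 where l1: "(d, l1) \<in> J" "z = sig d l1" by auto
    have "(sig d l', sig d l1) \<notin> lenlex less_than" if "(d, l') \<in> J" for l'
      using z(2)[of "sig d l'"] that l1(2) by auto
    with l1(1) show ?thesis by auto
  qed
  define rep where "rep d = (SOME l. (d, l) \<in> J \<and>
    (\<forall>l'. (d, l') \<in> J \<longrightarrow> (sig d l', sig d l) \<notin> lenlex less_than))" for d
  have rep: "(d, rep d) \<in> J" "\<And>l'. (d, l') \<in> J \<Longrightarrow> (sig d l', sig d (rep d)) \<notin> lenlex less_than"
    if "d \<in> D" for d
    using someI_ex[OF min[OF that]] unfolding rep_def by simp_all
  \<comment> \<open>The answer is that of \<open>rep d\<close>, but the representative of the next
    tracking state is chosen afresh and need not be the successor of \<open>rep d\<close>.\<close>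
  define \<delta>' where "\<delta>' d x = (dstep (Tr x (snd (\<delta> (rep d) x))) d, snd (\<delta> (rep d) x))" for d x
  have \<delta>'D: "\<delta>' d x \<in> D \<times> Ys" if "d \<in> D" "x \<in> Xs" for d x
  proof -
    have "rep d \<in> L" using inv[OF rep(1)[OF that(1)]] by simp
    then have "\<delta> (rep d) x \<in> L \<times> Ys" using \<delta> that(2) by simp
    moreover have "fst (\<delta>' d x) \<in> D"
      unfolding D_def \<delta>'_def using image_eqI[OF _ JS[OF rep(1)[OF that(1)] that(2)], of _ fst] by simp
    ultimately show ?thesis by (simp add: \<delta>'_def mem_Times_iff)
  qed
  have d0: "d0 \<in> D" using imageI[OF J0, of fst] by (simp add: D_def)
  have "\<not> flagged_path (strategy_edges Tr Xs D \<delta>')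
      ({d0} \<times> Init) f c" for f c
  proof
    assume "flagged_path (strategy_edges Tr Xs D \<delta>')
      ({d0} \<times> Init) f c"
    then have f0: "f 0 \<in> {d0} \<times> Init" and inf: "infinite {i. c i}"
      and fS: "\<And>i. (f i, c i, f (Suc i)) \<in> strategy_edges Tr Xs D \<delta>'"
      unfolding flagged_path_def by auto
    define d where "d i = fst (f i)" for i
    define s where "s i = snd (f i)" for i
    have "\<forall>i. \<exists>x. x \<in> Xs \<and> d (Suc i) = dstep (Tr x (snd (\<delta> (rep (d i)) x))) (d i) \<and>
        (s i, c i, s (Suc i)) \<in> Tr x (snd (\<delta> (rep (d i)) x)) \<and> d i \<in> D"
    proof
      fix i
      show "\<exists>x. x \<in> Xs \<and> d (Suc i) = dstep (Tr x (snd (\<delta> (rep (d i)) x))) (d i) \<and>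
        (s i, c i, s (Suc i)) \<in> Tr x (snd (\<delta> (rep (d i)) x)) \<and> d i \<in> D"
        using fS[of i] unfolding d_def s_def \<delta>'_def strategy_edges_def by (cases "f i"; cases "f (Suc i)") auto
    qed
    from choice[OF this] obtain x where x: "\<And>i. x i \<in> Xs" "\<And>i. d (Suc i) = dstep (Tr (x i) (snd (\<delta> (rep (d i)) (x i)))) (d i)"
      "\<And>i. (s i, c i, s (Suc i)) \<in> Tr (x i) (snd (\<delta> (rep (d i)) (x i)))" "\<And>i. d i \<in> D"
      by blast
    define l where "l i = rep (d i)" for i
    define T where "T i = Tr (x i) (snd (\<delta> (l i) (x i)))" for i
    define l' where "l' i = fst (\<delta> (l i) (x i))" for i
    have J: "(d i, l i) \<in> J" for i unfolding l_def using rep(1) x(4) by blast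
    have J': "(d (Suc i), l' i) \<in> J" for i using JS[OF J x(1), of i i] x(2)[of i] by (simp add: l'_def l_def)
    have dS: "d (Suc t) = dstep (T t) (d t)" for t using x(2) by (simp add: T_def l_def)
    have path: "(s t, c t, s (Suc t)) \<in> T t" for t using x(3) by (simp add: T_def l_def)
    have len: "length (d t) \<le> 2 ^ card Q" for t using x(4)[of t] Dsub by auto
    have sub: "\<forall>n\<in>set (d t). snd n \<subseteq> fst n \<and> finite (fst n)" for t
      using inv[OF J[of t]] finite_subset[OF _ finQ] by blast
    have "(Init, {}) \<in> set (d 0)" "s 0 \<in> fst (Init, {})"
      using f0 by (auto simp: d_def s_def d0_def)
    from flags_imp_flashes[of d T "2 ^ card Q" s c, OF dS len sub path inf this]
    obtain j t1 where st: "\<And>t. t \<ge> t1 \<Longrightarrow> stable T d t j" and fl: "infinite {t. flash (T t) (d t ! j)}" by blast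
    \<comment> \<open>\<open>B t\<close> lies between \<open>A t\<close> and
      \<open>A (Suc t)\<close>: it weighs the new tracking state in \<open>l' t\<close>, the true
      successor of the old representative. From \<open>A t\<close> to \<open>B t\<close> the weights
      obey \<open>weight_upd\<close>; from \<open>B t\<close> to \<open>A (Suc t)\<close> minimality
      of the new representative applies.\<close>
    define A where "A t = take (Suc j) (sig (d t) (l t))" for t
    define B where "B t = take (Suc j) (sig (d (Suc t)) (l' t))" for t
    let ?r = "lenlex less_than :: nat list rel"
    have w: "weight b (l' t) (d (Suc t) ! i) + of_bool (flash (T t) (d t ! i)) \<le> weight b (l t) (d t ! i)"
      if t: "t \<ge> t1" and i: "i \<le> j" for t i
    proof -
      have e: "d (Suc t) ! i = upd (T t) (d t ! i)" using stable_nth[OF st[OF t] i] .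
      have "j < length (d t)" "j < length (d (Suc t))" using st[of t] st[of "Suc t"] t by (auto simp: stable_def)
      then have m: "d t ! i \<in> set (d t)" "d (Suc t) ! i \<in> set (d (Suc t))" using i by auto
      note i1 = bspec[OF conjunct2[OF conjunct2[OF inv[OF J[of t]]]] m(1)]
      note i2 = bspec[OF conjunct2[OF conjunct2[OF inv[OF J'[of t]]]] m(2)]
      show ?thesis unfolding e
      proof (rule weight_upd)
        show "finite (fst (d t ! i))" using i1 finQ finite_subset by blast
        show "finite (img (T t) (fst (d t ! i)))" using i2 finQ finite_subset unfolding e upd_def by auto
        show "img (T t) (fst (d t ! i)) \<noteq> {}" using i2 unfolding e upd_def by auto
        show "snd (d t ! i) \<subseteq> fst (d t ! i)" using i1 by blast
        fix s c s' assume "s \<in> fst (d t ! i)" "(s, c, s') \<in> T t"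
        then show "b (l' t) s' + of_bool c \<le> b (l t) s"
          using RS[OF _ x(1)[of t], of "l t" s c s'] i1 unfolding T_def l'_def by blast
      qed
    qed
    have lenA: "length (A t) = Suc j" "length (B t) = Suc j" if "t \<ge> t1" for t
      using st[of t] st[of "Suc t"] that by (auto simp: A_def B_def sig_def stable_def)
    have nthA: "A t ! i = weight b (l t) (d t ! i)" "B t ! i = weight b (l' t) (d (Suc t) ! i)" if "t \<ge> t1" "i \<le> j" for t i
      using st[of t] st[of "Suc t"] that by (auto simp: A_def B_def sig_def stable_def)
    have BA: "(B t, A t) \<in> ?r \<or> B t = A t" if t: "t \<ge> t1" for t
    proof (rule lenlex_of_all2)
      show "list_all2 (\<le>) (B t) (A t)"
        unfolding list_all2_conv_all_nth using lenA[OF t] nthA[OF t] w[OF t] by (auto simp: less_Suc_eq_le intro: add_leD1)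
    qed
    have BA': "(B t, A t) \<in> ?r" if t: "t \<ge> t1" and "flash (T t) (d t ! j)" for t
    proof -
      have "B t ! j \<noteq> A t ! j" using w[OF t, of j] nthA[OF t, of j] that by auto
      then show ?thesis using BA[OF t] by auto
    qed
    have AB: "(A (Suc t), B t) \<in> ?r \<or> A (Suc t) = B t" for t
    proof -
      have "(sig (d (Suc t)) (l' t), sig (d (Suc t)) (l (Suc t))) \<notin> ?r"
        unfolding l_def using rep(2)[OF x(4) J'] by (simp add: l_def)
      then have "(sig (d (Suc t)) (l (Suc t)), sig (d (Suc t)) (l' t)) \<in> ?r \<or>
          sig (d (Suc t)) (l (Suc t)) = sig (d (Suc t)) (l' t)" using lenlex_nat_total by blast
      then show ?thesis
      proof
        assume "(sig (d (Suc t)) (l (Suc t)), sig (d (Suc t)) (l' t)) \<in> ?r"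
        from lenlex_take[OF this] show ?thesis unfolding A_def B_def by (simp add: sig_def)
      qed (simp add: A_def B_def)
    qed
    have tr: "trans ?r" by (simp add: lenlex_transI)
    have "(A (Suc t), A t) \<in> ?r \<or> A (Suc t) = A t" if "t \<ge> t1" for t
      using AB[of t] BA[OF that] by (auto intro: transD[OF tr])
    from wf_sequence_finite_drops[where A = A, OF wf_lenlex[OF wf_less_than] this]
    have "finite {t. (A (Suc t), A t) \<in> ?r}" by blast
    moreover have "{t. flash (T t) (d t ! j)} \<subseteq> {..<t1} \<union> {t. (A (Suc t), A t) \<in> ?r}"
    proof
      fix t assume "t \<in> {t. flash (T t) (d t ! j)}"
      then show "t \<in> {..<t1} \<union> {t. (A (Suc t), A t) \<in> ?r}"
        using AB[of t] BA'[of t] by (cases "t \<ge> t1") (auto intro: transD[OF tr])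
    qed
    ultimately show False using fl finite_subset by blast
  qed
  then show thesis using that[where \<delta>' = \<delta>', OF finD cardD d0 \<delta>'D] by simp
qed

subsection \<open>Budgets\<close>

text \<open>A budget is a function \<open>\<beta>\<close> on states; \<open>\<beta> s = 0\<close> means that \<open>s\<close> need not be considered, and
  \<open>\<beta> s = Suc n\<close> that at most \<open>n\<close> more flags can be met from \<open>s\<close>.\<close>

definition budget_family :: "('q \<times> 'q) set \<Rightarrow> ('x \<Rightarrow> 'y \<Rightarrow> ('q \<times> bool \<times> 'q) set) \<Rightarrow> 'q set \<Rightarrow> 'x set \<Rightarrow> 'y set \<Rightarrow>
    ('q \<Rightarrow> nat) set \<Rightarrow> bool" where
  "budget_family E0 E1 Init Xs Ys W \<longleftrightarrow>
    (\<exists>\<beta>\<in>W. \<forall>s\<in>Init. 0 < \<beta> s) \<and>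
    (\<forall>\<beta>\<in>W. \<forall>(s, s')\<in>E0. 0 < \<beta> s \<longrightarrow> 0 < \<beta> s' \<and> \<beta> s' \<le> \<beta> s) \<and>
    (\<forall>\<beta>\<in>W. \<forall>x\<in>Xs. \<exists>y\<in>Ys. \<exists>\<beta>'\<in>W. \<forall>(s, c, s')\<in>E1 x y. 0 < \<beta> s \<longrightarrow> 0 < \<beta>' s' \<and> \<beta>' s' + of_bool c \<le> \<beta> s)"

definition product_edges :: "('q \<times> 'q) set \<Rightarrow> ('x \<Rightarrow> 'y \<Rightarrow> ('q \<times> bool \<times> 'q) set) \<Rightarrow> 'x set \<Rightarrow> 'l set \<Rightarrow>
    ('l \<Rightarrow> 'x \<Rightarrow> 'l \<times> 'y) \<Rightarrow> (('l \<times> 'q) \<times> bool \<times> ('l \<times> 'q)) set" where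
  "product_edges E0 E1 Xs L \<delta> =
    {((l, s), False, (l, s')) | l s s'. l \<in> L \<and> (s, s') \<in> E0} \<union> strategy_edges E1 Xs L \<delta>"

text \<open>Tracking advances only with observations, so silent moves are first contracted into the
  letter move that follows them. Ranks of the given strategy feed \<open>small_strategy\<close>, and
  the ranks of the small strategy, one function per memory state, become the budgets.\<close>

lemma bounded_budget_family:
  fixes Q :: "'q set"
  assumes finQ: "finite Q" and finL: "finite L" and E0Q: "E0 \<subseteq> Q \<times> Q" and E1Q: "\<And>x y. E1 x y \<subseteq> Q \<times> UNIV \<times> Q"
    and Init: "Init \<subseteq> Q" and l0: "l0 \<in> L" and \<delta>: "\<And>l x. l \<in> L \<Longrightarrow> x \<in> Xs \<Longrightarrow> \<delta> l x \<in> L \<times> Ys"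
    and no: "\<not> (\<exists>f c. flagged_path (product_edges E0 E1 Xs L \<delta>) ({l0} \<times> Init) f c)"
  obtains W where "finite W" "card W \<le> memory_bound (card Q)"
    "\<And>\<beta> s. \<beta> \<in> W \<Longrightarrow> \<beta> s \<le> Suc (memory_bound (card Q) * card Q)" "budget_family E0 E1 Init Xs Ys W"
proof -
  let ?E = "product_edges E0 E1 Xs L \<delta>"
  have EV: "?E \<subseteq> UNIV \<times> UNIV \<times> (L \<times> Q)"
  proof
    fix e assume "e \<in> ?E"
    then consider l s s' where "e = ((l, s), False, (l, s'))" "l \<in> L" "(s, s') \<in> E0"
      | l s c l' s' x y where "e = ((l, s), c, (l', s'))" "l \<in> L" "x \<in> Xs" "\<delta> l x = (l', y)" "(s, c, s') \<in> E1 x y"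
      unfolding product_edges_def strategy_edges_def by blast
    then show "e \<in> UNIV \<times> UNIV \<times> (L \<times> Q)"
    proof cases
      case 1
      then show ?thesis using E0Q by auto
    next
      case (2 l s c l' s' x y)
      then show ?thesis using \<delta>[of l x] subsetD[OF E1Q 2(5)] by auto
    qed
  qed
  obtain b where "\<And>v. b v \<le> card (L \<times> Q)" and b: "\<And>s v c v'. s \<in> {l0} \<times> Init \<Longrightarrow> (s, v) \<in> (edges ?E)\<^sup>* \<Longrightarrow> (v, c, v') \<in> ?E \<Longrightarrow> b v' + of_bool c \<le> b v"
    by (rule rank_exists[OF finite_cartesian_product[OF finL finQ] EV no], rule that)
  define R where "R = {v \<in> L \<times> Q. \<exists>s\<in>{l0} \<times> Init. (s, v) \<in> (edges ?E)\<^sup>*}"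
  have RS: "v' \<in> R \<and> b v' + of_bool c \<le> b v" if "v \<in> R" "(v, c, v') \<in> ?E" for v c v'
    using that b[of _ v c v'] subsetD[OF EV that(2)] unfolding R_def
    by (auto simp: edges_def intro: rtrancl_into_rtrancl)
  define Tr where "Tr x y = {(s, c, s'). \<exists>s1. (s, s1) \<in> E0\<^sup>* \<and> (s1, c, s') \<in> E1 x y}" for x y
  have Reps: "(l, s1) \<in> R \<and> b (l, s1) \<le> b (l, s)" if "(s, s1) \<in> E0\<^sup>*" "(l, s) \<in> R" for l s s1
    using that
  proof (induction rule: rtrancl_induct)
    case (step s1 s2)
    then have "((l, s1), False, (l, s2)) \<in> ?E" by (auto simp: product_edges_def strategy_edges_def R_def)
    then show ?case using RS[of "(l, s1)" False "(l, s2)"] step by auto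
  qed simp
  have RT: "(fst (\<delta> l x), s') \<in> R \<and> b (fst (\<delta> l x), s') + of_bool c \<le> b (l, s)"
    if "(l, s) \<in> R" "x \<in> Xs" "(s, c, s') \<in> Tr x (snd (\<delta> l x))" for l s x c s'
  proof -
    have "\<exists>s1. (s, s1) \<in> E0\<^sup>* \<and> (s1, c, s') \<in> E1 x (snd (\<delta> l x))" using that(3) by (simp add: Tr_def)
    then obtain s1 where s1: "(s, s1) \<in> E0\<^sup>*" "(s1, c, s') \<in> E1 x (snd (\<delta> l x))" by blast
    have r: "(l, s1) \<in> R" "b (l, s1) \<le> b (l, s)" using Reps[OF s1(1) that(1)] by auto
    have "((l, s1), c, (fst (\<delta> l x), s')) \<in> ?E"
      using s1(2) that(2) r(1) unfolding product_edges_def strategy_edges_def R_def by (auto intro!: bexI[of _ x] exI[of _ "snd (\<delta> l x)"])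
    from RS[OF r(1) this] show ?thesis using r(2) by auto
  qed
  have TrQ: "Tr x y \<subseteq> UNIV \<times> UNIV \<times> Q" for x y using E1Q by (auto simp: Tr_def)
  have R0: "(l0, s) \<in> R" if "s \<in> Init" for s using that Init l0 by (auto simp: R_def)
  obtain D d0 \<delta>' where D: "finite D" "card D \<le> memory_bound (card Q)" "d0 \<in> (D :: ('q set \<times> 'q set) list set)"
    "\<And>d x. d \<in> D \<Longrightarrow> x \<in> Xs \<Longrightarrow> \<delta>' d x \<in> D \<times> Ys"
    "\<not> (\<exists>f c. flagged_path (strategy_edges Tr Xs D \<delta>')
      ({d0} \<times> Init) f c)"
    by (rule small_strategy[of Q Tr Init l0 R Xs \<delta> "\<lambda>l s. b (l, s)" L Ys];
        (rule finQ TrQ Init R0 RT l0 \<delta> that; assumption)?)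
  define E where "E = strategy_edges Tr Xs D \<delta>'"
  have EV': "E \<subseteq> UNIV \<times> UNIV \<times> (D \<times> Q)"
  proof
    fix e assume "e \<in> E"
    then obtain d s c d' s' x y where e: "e = ((d, s), c, (d', s'))" "d \<in> D" "x \<in> Xs" "\<delta>' d x = (d', y)"
      "(s, c, s') \<in> Tr x y" unfolding E_def strategy_edges_def by blast
    then show "e \<in> UNIV \<times> UNIV \<times> (D \<times> Q)" using D(4)[of d x] subsetD[OF TrQ e(5)] by auto
  qed
  obtain b' where b': "\<And>v. b' v \<le> card (D \<times> Q)"
    "\<And>s v c v'. s \<in> {d0} \<times> Init \<Longrightarrow> (s, v) \<in> (edges E)\<^sup>* \<Longrightarrow> (v, c, v') \<in> E \<Longrightarrow> b' v' + of_bool c \<le> b' v"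
    by (rule rank_exists[OF finite_cartesian_product[OF D(1) finQ] EV' D(5)[folded E_def]], rule that)
  define R' where "R' = {v \<in> D \<times> Q. \<exists>s\<in>{d0} \<times> Init. (s, v) \<in> (edges E)\<^sup>*}"
  have RS': "v' \<in> R' \<and> b' v' + of_bool c \<le> b' v" if "v \<in> R'" "(v, c, v') \<in> E" for v c v'
    using that b'(2)[of _ v c v'] subsetD[OF EV' that(2)] unfolding R'_def
    by (auto simp: edges_def intro: rtrancl_into_rtrancl)
  \<comment> \<open>\<open>z\<close> is a vertex possible at the start or right after a letter, and
    its rank is passed on to the vertices it reaches silently. Taking the least such rank makes the
    budgets non-increasing along silent moves.\<close>
  define P where "P d s m \<longleftrightarrow> (\<exists>z. (d, z) \<in> R' \<and> (z, s) \<in> E0\<^sup>* \<and> m = b' (d, z))" for d s m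
  define \<beta> where "\<beta> d s = (if \<exists>m. P d s m then Suc (LEAST m. P d s m) else 0)" for d s
  have \<beta>_le: "0 < \<beta> d s \<and> \<beta> d s \<le> Suc m" if "P d s m" for d s m
    using that by (auto simp: \<beta>_def intro: Least_le)
  have \<beta>_pos: "\<exists>m. P d s m \<and> \<beta> d s = Suc m" if "0 < \<beta> d s" for d s
    using that unfolding \<beta>_def by (auto split: if_splits intro: LeastI)
  have "budget_family E0 E1 Init Xs Ys (\<beta> ` D)"
    unfolding budget_family_def
  proof (intro conjI)
    have "P d0 s (b' (d0, s))" if "s \<in> Init" for s
      using that D(3) Init by (auto simp: P_def R'_def intro!: exI[of _ s])
    then show "\<exists>\<beta>\<in>\<beta> ` D. \<forall>s\<in>Init. 0 < \<beta> s" using D(3) \<beta>_le by blast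
    have "0 < \<beta> d s' \<and> \<beta> d s' \<le> \<beta> d s" if "(s, s') \<in> E0" "0 < \<beta> d s" for d s s'
    proof -
      obtain m where m: "P d s m" "\<beta> d s = Suc m" using \<beta>_pos[OF \<open>0 < \<beta> d s\<close>] by blast
      then obtain z where z: "(d, z) \<in> R'" "(z, s) \<in> E0\<^sup>*" "m = b' (d, z)" by (auto simp: P_def)
      from rtrancl_into_rtrancl[OF z(2) \<open>(s, s') \<in> E0\<close>] z have "P d s' m" unfolding P_def by blast
      then show ?thesis using \<beta>_le[of d s' m] m by simp
    qed
    then show "\<forall>\<beta>\<in>\<beta> ` D. \<forall>(s, s')\<in>E0. 0 < \<beta> s \<longrightarrow> 0 < \<beta> s' \<and> \<beta> s' \<le> \<beta> s" by auto
    have "\<exists>y\<in>Ys. \<exists>\<beta>'\<in>\<beta> ` D. \<forall>(s, c, s')\<in>E1 x y. 0 < \<beta> d s \<longrightarrow> 0 < \<beta>' s' \<and> \<beta>' s' + of_bool c \<le> \<beta> d s"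
      if d: "d \<in> D" and x: "x \<in> Xs" for d x
    proof -
      obtain d' y where dy: "\<delta>' d x = (d', y)" by fastforce
      then have dy': "d' \<in> D" "y \<in> Ys" using D(4)[OF d x] by auto
      have "0 < \<beta> d' s' \<and> \<beta> d' s' + of_bool c \<le> \<beta> d s" if e: "(s, c, s') \<in> E1 x y" and pos: "0 < \<beta> d s" for s c s'
      proof -
        obtain m where m: "P d s m" "\<beta> d s = Suc m" using \<beta>_pos[OF pos] by blast
        then obtain z where z: "(d, z) \<in> R'" "(z, s) \<in> E0\<^sup>*" "m = b' (d, z)" by (auto simp: P_def)
        have "(z, c, s') \<in> Tr x y" using z(2) e by (auto simp: Tr_def)
        then have "((d, z), c, (d', s')) \<in> E" using d x dy by (auto simp: E_def strategy_edges_def)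
        then have n: "(d', s') \<in> R'" "b' (d', s') + of_bool c \<le> m" using RS'[OF z(1)] z(3) by auto
        then have "P d' s' (b' (d', s'))" by (auto simp: P_def)
        from \<beta>_le[OF this] show ?thesis using n(2) m(2) by simp
      qed
      then show ?thesis using dy' by (intro bexI[of _ y] bexI[of _ "\<beta> d'"]) auto
    qed
    then show "\<forall>\<gamma>\<in>\<beta> ` D. \<forall>x\<in>Xs. \<exists>y\<in>Ys. \<exists>\<beta>'\<in>\<beta> ` D. \<forall>(s, c, s')\<in>E1 x y. 0 < \<gamma> s \<longrightarrow> 0 < \<beta>' s' \<and> \<beta>' s' + of_bool c \<le> \<gamma> s"
      by blast
  qed
  moreover have "finite (\<beta> ` D)" "card (\<beta> ` D) \<le> memory_bound (card Q)"
    using D(1,2) card_image_le[OF D(1), of \<beta>] by auto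
  moreover have "\<beta> d s \<le> Suc (memory_bound (card Q) * card Q)" for d s
  proof (cases "0 < \<beta> d s")
    case True
    then obtain m where m: "P d s m" "\<beta> d s = Suc m" using \<beta>_pos by blast
    then have "m \<le> card D * card Q" using b'(1) by (auto simp: P_def card_cartesian_product)
    also have "\<dots> \<le> memory_bound (card Q) * card Q" using D(2) by (rule mult_le_mono1)
    finally show ?thesis using m(2) by simp
  qed simp
  ultimately show thesis using that[of "\<beta> ` D"] by blast
qed

section \<open>Regions and grid points\<close>

text \<open>Index \<open>C\<close> plays the role of a clock that is constantly \<open>0\<close>, which makes all constraints
  diagonal; swapping \<open>x\<close> and \<open>y\<close> accounts for the negative constants.\<close>

definition zc :: "nat \<Rightarrow> valuation \<Rightarrow> nat \<Rightarrow> real" where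
  "zc C v x = (if x < C then v x else 0)"

definition eqv :: "nat \<Rightarrow> nat \<Rightarrow> valuation \<Rightarrow> valuation \<Rightarrow> bool" where
  "eqv C M v v' \<longleftrightarrow> (\<forall>x\<le>C. \<forall>y\<le>C. \<forall>z\<le>M.
    (zc C v x < zc C v y + real z \<longleftrightarrow> zc C v' x < zc C v' y + real z) \<and>
    (zc C v x \<le> zc C v y + real z \<longleftrightarrow> zc C v' x \<le> zc C v' y + real z))"

lemma eqv_refl [simp]: "eqv C M v v" and eqv_sym: "eqv C M v v' \<Longrightarrow> eqv C M v' v"
  and eqv_trans: "eqv C M v v' \<Longrightarrow> eqv C M v' v'' \<Longrightarrow> eqv C M v v''"
  unfolding eqv_def by auto

lemma eqvD:
  assumes "eqv C M v v'" "x \<le> C" "y \<le> C" "z \<le> M"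
  shows "zc C v x < zc C v y + real z \<longleftrightarrow> zc C v' x < zc C v' y + real z"
    "zc C v x \<le> zc C v y + real z \<longleftrightarrow> zc C v' x \<le> zc C v' y + real z"
  using assms unfolding eqv_def by auto

lemma eqvI:
  assumes "\<And>x y z. x < C \<Longrightarrow> y < C \<Longrightarrow> z \<le> M \<Longrightarrow>
      (v x < v y + real z \<longleftrightarrow> v' x < v' y + real z) \<and> (v x \<le> v y + real z \<longleftrightarrow> v' x \<le> v' y + real z)"
    "\<And>x z. x < C \<Longrightarrow> z \<le> M \<Longrightarrow> (v x < real z \<longleftrightarrow> v' x < real z) \<and> (v x \<le> real z \<longleftrightarrow> v' x \<le> real z)"
    "\<And>y z. y < C \<Longrightarrow> z \<le> M \<Longrightarrow> (0 < v y + real z \<longleftrightarrow> 0 < v' y + real z) \<and> (0 \<le> v y + real z \<longleftrightarrow> 0 \<le> v' y + real z)"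
  shows "eqv C M v v'"
  unfolding eqv_def using assms by (simp add: zc_def)

text \<open>Resetting clocks, forgetting clocks and renaming them all amount to a substitution of indices.\<close>

lemma eqv_reindex:
  assumes "eqv C M v v'" "M' \<le> M" "\<And>x. x \<le> C' \<Longrightarrow> h x \<le> C"
    "\<And>x. x \<le> C' \<Longrightarrow> zc C' w x = zc C v (h x)" "\<And>x. x \<le> C' \<Longrightarrow> zc C' w' x = zc C v' (h x)"
  shows "eqv C' M' w w'"
  using assms unfolding eqv_def by auto

lemma eqv_reset: assumes "eqv C M v v'" shows "eqv C M (reset Y v) (reset Y v')"
  by (rule eqv_reindex[OF assms, of M C "\<lambda>x. if x \<in> Y then C else x"]) (auto simp: zc_def reset_def)

lemma eqv_shift: assumes "eqv (n + k) M v v'" "m \<le> M"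
  shows "eqv k m (\<lambda>x. v (n + x)) (\<lambda>x. v' (n + x))"
  by (rule eqv_reindex[OF assms, of k "\<lambda>x. n + x"]) (auto simp: zc_def)

lemma eqv_diff:
  assumes "eqv C M v v'" "x \<le> C" "y \<le> C" "\<bar>z\<bar> \<le> int M"
  shows "zc C v x - zc C v y < of_int z \<longleftrightarrow> zc C v' x - zc C v' y < of_int z"
    "zc C v x - zc C v y \<le> of_int z \<longleftrightarrow> zc C v' x - zc C v' y \<le> of_int z"
proof -
  have "(zc C v x - zc C v y < of_int z \<longleftrightarrow> zc C v' x - zc C v' y < of_int z) \<and>
    (zc C v x - zc C v y \<le> of_int z \<longleftrightarrow> zc C v' x - zc C v' y \<le> of_int z)"
  proof (cases "z \<ge> 0")
    case True
    then have z: "real_of_int z = real (nat z)" "nat z \<le> M" using assms(4) by auto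
    have h: "a - b < c \<longleftrightarrow> a < b + c" "a - b \<le> c \<longleftrightarrow> a \<le> b + c" for a b c :: real by linarith+
    show ?thesis unfolding z(1) h using eqvD[OF assms(1,2,3) z(2)] by blast
  next
    case False
    then have z: "real_of_int z = - real (nat (- z))" "nat (- z) \<le> M" using assms(4) by auto
    have h: "a - b < - c \<longleftrightarrow> \<not> b \<le> a + c" "a - b \<le> - c \<longleftrightarrow> \<not> b < a + c" for a b c :: real by linarith+
    show ?thesis unfolding z(1) h using eqvD[OF assms(1,3,2) z(2)] by blast
  qed
  then show "zc C v x - zc C v y < of_int z \<longleftrightarrow> zc C v' x - zc C v' y < of_int z"
    "zc C v x - zc C v y \<le> of_int z \<longleftrightarrow> zc C v' x - zc C v' y \<le> of_int z" by auto
qed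

lemma cmp_sem_cong:
  assumes "a < b \<longleftrightarrow> a' < b" "a \<le> b \<longleftrightarrow> a' \<le> b"
  shows "cmp_sem c a b \<longleftrightarrow> cmp_sem c a' b"
  using assms by (cases c) auto

lemma eqv_sat:
  assumes "eqv C M v v'" "cc_over {0..<C} M \<phi>"
  shows "sat \<phi> v \<longleftrightarrow> sat \<phi> v'"
  using assms(2)
proof (induction \<phi>)
  case (CAtom x c z)
  then show ?case using eqv_diff[OF assms(1), of x C z] by (auto simp: zc_def intro!: cmp_sem_cong)
next
  case (CDiff x y c z)
  then show ?case using eqv_diff[OF assms(1), of x y z] by (auto simp: zc_def intro!: cmp_sem_cong)
qed auto

lemma region_equiv_eqv: "region_equiv {0..<C} M v v' \<longleftrightarrow> eqv C M v v'"
proof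
  assume "eqv C M v v'"
  then show "region_equiv {0..<C} M v v'" unfolding region_equiv_def using eqv_sat by blast
next
  assume "region_equiv {0..<C} M v v'"
  then have r: "\<And>\<phi>. cc_over {0..<C} M \<phi> \<Longrightarrow> sat \<phi> v \<longleftrightarrow> sat \<phi> v'" by (simp add: region_equiv_def)
  show "eqv C M v v'"
  proof (rule eqvI)
    fix x y z assume "x < C" "y < C" "z \<le> M"
    then show "(v x < v y + real z \<longleftrightarrow> v' x < v' y + real z) \<and> (v x \<le> v y + real z \<longleftrightarrow> v' x \<le> v' y + real z)"
      using r[of "CDiff x y CLt (int z)"] r[of "CDiff x y CLe (int z)"] by (auto simp: algebra_simps)
  next
    fix x z assume "x < C" "z \<le> M"
    then show "(v x < real z \<longleftrightarrow> v' x < real z) \<and> (v x \<le> real z \<longleftrightarrow> v' x \<le> real z)"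
      using r[of "CAtom x CLt (int z)"] r[of "CAtom x CLe (int z)"] by auto
  next
    fix y z assume yz: "y < C" "z \<le> M"
    have "0 < a + real z \<longleftrightarrow> - real z < a" "0 \<le> a + real z \<longleftrightarrow> - real z \<le> a" for a by auto
    then show "(0 < v y + real z \<longleftrightarrow> 0 < v' y + real z) \<and> (0 \<le> v y + real z \<longleftrightarrow> 0 \<le> v' y + real z)"
      using yz r[of "CAtom y CGt (- int z)"] r[of "CAtom y CGe (- int z)"] by simp
  qed
qed

lemma region_of_eq_iff: "region_of {0..<k} m v = region_of {0..<k} m v' \<longleftrightarrow> eqv k m v v'"
  unfolding region_of_def region_equiv_eqv using eqv_refl eqv_sym eqv_trans by blast

subsection \<open>Time elapse\<close>

text \<open>The place of a real among finitely many points depends only on their order: if it hits a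
  point, the corresponding point is taken, otherwise density supplies one in the matching
  gap.\<close>

lemma dense_transfer:
  fixes p p' :: "'i \<Rightarrow> real"
  assumes fin: "finite I" and iso: "\<And>i j. i \<in> I \<Longrightarrow> j \<in> I \<Longrightarrow> p i < p j \<longleftrightarrow> p' i < p' j"
  shows "\<exists>d'. \<forall>i\<in>I. (p i < d \<longleftrightarrow> p' i < d') \<and> (d < p i \<longleftrightarrow> d' < p' i)"
proof (cases "\<exists>i\<in>I. p i = d")
  case True
  then show ?thesis using iso by blast
next
  case False
  define A where "A = {i \<in> I. p i < d}"
  define B where "B = {i \<in> I. d < p i}"
  have fin': "finite (p' ` A)" "finite (p' ` B)" using fin by (auto simp: A_def B_def)
  have AB: "p' i < p' j" if "i \<in> A" "j \<in> B" for i j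
    using that iso[of i j] by (auto simp: A_def B_def)
  have le: "p' i \<le> Max (p' ` A)" if "i \<in> A" for i using fin'(1) that by simp
  have ge: "Min (p' ` B) \<le> p' i" if "i \<in> B" for i using fin'(2) that by simp
  have "\<exists>d'. (\<forall>i\<in>A. p' i < d') \<and> (\<forall>i\<in>B. d' < p' i)"
  proof (cases "A = {} \<or> B = {}")
    case True
    have "p' i < Max (p' ` A) + 1" if "i \<in> A" for i using le[OF that] by simp
    moreover have "Min (p' ` B) - 1 < p' i" if "i \<in> B" for i using ge[OF that] by simp
    ultimately show ?thesis using True by auto
  next
    case False
    then have "p' ` A \<noteq> {}" "p' ` B \<noteq> {}" by auto
    then have "Max (p' ` A) \<in> p' ` A" "Min (p' ` B) \<in> p' ` B" using fin' Max_in Min_in by blast+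
    then have "Max (p' ` A) < Min (p' ` B)" using AB by (elim imageE) simp
    then obtain d' where d': "Max (p' ` A) < d'" "d' < Min (p' ` B)" using dense by blast
    have "p' i < d'" if "i \<in> A" for i using le[OF that] d'(1) by linarith
    moreover have "d' < p' i" if "i \<in> B" for i using ge[OF that] d'(2) by linarith
    ultimately show ?thesis by blast
  qed
  then obtain d' where d': "\<And>i. i \<in> A \<Longrightarrow> p' i < d'" "\<And>i. i \<in> B \<Longrightarrow> d' < p' i" by blast
  have "(p i < d \<longleftrightarrow> p' i < d') \<and> (d < p i \<longleftrightarrow> d' < p' i)" if "i \<in> I" for i
  proof (cases "p i < d")
    case True
    then show ?thesis using d'(1)[of i] that by (auto simp: A_def)
  next
    case F: False
    moreover have "p i \<noteq> d" using False that by blast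
    ultimately have "d < p i" by linarith
    then show ?thesis using d'(2)[of i] that by (auto simp: B_def)
  qed
  then show ?thesis by blast
qed

text \<open>\<open>z - v x\<close> is the delay after which clock \<open>x\<close> reaches
  \<open>z\<close>. Two such critical times compare as a diagonal constraint with a constant of
  absolute value at most \<open>M\<close>, so both valuations order them alike and
  \<open>dense_transfer\<close> yields \<open>d'\<close>. Differences of clocks do not change with
  time.\<close>

lemma eqv_delay:
  assumes e: "eqv C M v v'" and nn: "\<And>x. x < C \<Longrightarrow> 0 \<le> v x" "\<And>x. x < C \<Longrightarrow> 0 \<le> v' x" and d: "0 \<le> d"
  shows "\<exists>d'\<ge>0. eqv C M (delay v d) (delay v' d')"
proof -
  define p where "p i = real (snd i) - zc C v (fst i)" for i :: "nat \<times> nat"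
  define p' where "p' i = real (snd i) - zc C v' (fst i)" for i :: "nat \<times> nat"
  have iso: "p i < p j \<longleftrightarrow> p' i < p' j" if "i \<in> {..C} \<times> {..M}" "j \<in> {..C} \<times> {..M}" for i j
  proof -
    have "\<bar>int (snd j) - int (snd i)\<bar> \<le> int M" using that by (auto simp: mem_Times_iff)
    moreover have "fst i \<le> C" "fst j \<le> C" using that by (auto simp: mem_Times_iff)
    moreover have "p i < p j \<longleftrightarrow> zc C v (fst j) - zc C v (fst i) < of_int (int (snd j) - int (snd i))"
      "p' i < p' j \<longleftrightarrow> zc C v' (fst j) - zc C v' (fst i) < of_int (int (snd j) - int (snd i))"
      by (simp_all add: p_def p'_def) linarith+
    ultimately show ?thesis using eqv_diff(1)[OF e] by blast
  qed
  obtain d' where d': "\<And>i. i \<in> {..C} \<times> {..M} \<Longrightarrow> (p i < d \<longleftrightarrow> p' i < d') \<and> (d < p i \<longleftrightarrow> d' < p' i)"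
    using dense_transfer[of "{..C} \<times> {..M}" p p' d] iso by blast
  \<comment> \<open>The index \<open>(C, 0)\<close> has critical time 0 in both valuations, which
    transfers the sign of the delay.\<close>
  have d'0: "0 \<le> d'" using d'[of "(C, 0)"] d by (auto simp: p_def p'_def zc_def)
  have at: "(v x + d < real z \<longleftrightarrow> v' x + d' < real z) \<and> (v x + d \<le> real z \<longleftrightarrow> v' x + d' \<le> real z)"
    if "x < C" "z \<le> M" for x z
    using d'[of "(x, z)"] that by (auto simp: p_def p'_def zc_def)
  have "eqv C M (delay v d) (delay v' d')"
  proof (rule eqvI)
    fix x y z assume "x < C" "y < C" "z \<le> M"
    then show "(delay v d x < delay v d y + real z \<longleftrightarrow> delay v' d' x < delay v' d' y + real z) \<and>
      (delay v d x \<le> delay v d y + real z \<longleftrightarrow> delay v' d' x \<le> delay v' d' y + real z)"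
      using eqvD[OF e, of x y z] by (auto simp: zc_def delay_def)
  next
    fix y z assume "y < C" "z \<le> M"
    then show "(0 < delay v d y + real z \<longleftrightarrow> 0 < delay v' d' y + real z) \<and>
      (0 \<le> delay v d y + real z \<longleftrightarrow> 0 \<le> delay v' d' y + real z)"
      using at[of y 0] nn[of y] d d'0 by (cases "z = 0") (auto simp: delay_def)
  qed (use at in \<open>simp add: delay_def\<close>)
  with d'0 show ?thesis by blast
qed

subsection \<open>Grid points\<close>

text \<open>Every natural number is read as the code of a list of multiples of \<open>1 / D\<close>;
  the number 0 names the origin.\<close>

definition gv :: "nat \<Rightarrow> nat \<Rightarrow> valuation" where
  "gv D u = (\<lambda>x. real (nthc u x) / real D)"

lemma gv_nonneg: "0 \<le> gv D u x" by (simp add: gv_def)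

text \<open>Keep the integer parts and replace each fractional part by its rank divided by \<open>C + 1\<close>.\<close>

lemma grid_point_exists:
  assumes nn: "\<And>x. x < C \<Longrightarrow> 0 \<le> v x"
  shows "\<exists>u. eqv C M v (gv (Suc C) u)"
proof -
  define f where "f x = frac (zc C v x)" for x
  define F where "F = f ` {..C}"
  define rk where "rk x = card {t \<in> F. t < f x}" for x
  have finF: "finite F" by (simp add: F_def)
  have rk_less: "rk x < Suc C" if "x \<le> C" for x
  proof -
    have "{t \<in> F. t < f x} \<subset> F" using that by (auto simp: F_def)
    then have "rk x < card F" unfolding rk_def using finF by (rule psubset_card_mono[rotated])
    also have "card F \<le> Suc C" unfolding F_def using card_image_le[of "{..C}" f] by simp
    finally show ?thesis .
  qed
  have rk_mono: "rk x < rk y" if "f x < f y" "x \<le> C" for x y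
    unfolding rk_def by (rule psubset_card_mono) (use that finF in \<open>auto simp: F_def\<close>)
  have rk_iff: "rk x < rk y \<longleftrightarrow> f x < f y" if "x \<le> C" "y \<le> C" for x y
    using rk_mono[of x y] rk_mono[of y x] that by (cases "f x" "f y" rule: linorder_cases) (auto simp: rk_def)
  \<comment> \<open>The constant clock has the least possible fractional part, so it gets rank 0 and
    stays at 0 on the grid.\<close>
  have rk_C: "rk C = 0"
  proof -
    have "{t \<in> F. t < f C} = {}" by (auto simp: F_def f_def zc_def[of C v C] not_less)
    then show ?thesis unfolding rk_def by (simp only: card.empty)
  qed
  define g where "g x = nat \<lfloor>zc C v x\<rfloor> * Suc C + rk x" for x
  define u where "u = list_encode (map g [0..<C])"
  have znn: "0 \<le> zc C v x" for x using nn by (simp add: zc_def)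
  have zg: "zc C (gv (Suc C) u) x = real (g x) / real (Suc C)" if "x \<le> C" for x
    using that rk_C by (auto simp: zc_def gv_def u_def nthc_encode g_def)
  have zg': "zc C (gv (Suc C) u) x = of_int \<lfloor>zc C v x\<rfloor> + real (rk x) / real (Suc C)" if "x \<le> C" for x
  proof -
    have "real (g x) = of_int \<lfloor>zc C v x\<rfloor> * real (Suc C) + real (rk x)"
      unfolding g_def of_nat_add of_nat_mult using znn[of x] by simp
    then show ?thesis unfolding zg[OF that] by (simp add: add_divide_distrib del: of_nat_Suc)
  qed
  define r where "r x = real (rk x) / real (Suc C)" for x
  have r: "0 \<le> r x" "r x < 1" if "x \<le> C" for x using rk_less[OF that] by (auto simp: r_def)
  have r_iff: "r x < r y \<longleftrightarrow> f x < f y" if "x \<le> C" "y \<le> C" for x y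
    using rk_iff[OF that] unfolding r_def by (simp add: divide_less_cancel del: of_nat_Suc)
  have "eqv C M v (gv (Suc C) u)"
    unfolding eqv_def
  proof (intro allI impI)
    fix x y z assume xyz: "x \<le> C" "y \<le> C" "z \<le> M"
    define i where "i = \<lfloor>zc C v x\<rfloor>"
    define j where "j = \<lfloor>zc C v y\<rfloor> + int z"
    have 1: "zc C v x = of_int i + f x" "zc C v y + real z = of_int j + f y"
      by (auto simp: i_def j_def f_def frac_def)
    have 2: "zc C (gv (Suc C) u) x = of_int i + r x" "zc C (gv (Suc C) u) y + real z = of_int j + r y"
      using zg' xyz by (auto simp: i_def j_def r_def)
    have f: "0 \<le> f x" "f x < 1" "0 \<le> f y" "f y < 1" by (auto simp: f_def frac_lt_1)
    \<comment> \<open>Integers plus numbers in the half-open unit interval compare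
      lexicographically, so fractional parts may be replaced by anything in that interval with the
      same order.\<close>
    have key: "(of_int i + a < of_int j + b) = (i < j \<or> i = j \<and> a < b)"
      if "0 \<le> a" "a < 1" "0 \<le> b" "b < 1" for a b :: real and i j
    proof (cases i j rule: linorder_cases)
      case less
      then have "real_of_int i + 1 \<le> of_int j" by linarith
      then show ?thesis using that less by linarith
    next
      case greater
      then have "real_of_int j + 1 \<le> of_int i" by linarith
      then show ?thesis using that greater by linarith
    qed simp
    show "(zc C v x < zc C v y + real z \<longleftrightarrow> zc C (gv (Suc C) u) x < zc C (gv (Suc C) u) y + real z) \<and>
      (zc C v x \<le> zc C v y + real z \<longleftrightarrow> zc C (gv (Suc C) u) x \<le> zc C (gv (Suc C) u) y + real z)"
      unfolding 1 2 using key[of "f x" "f y" i j] key[of "r x" "r y" i j] key[of "f y" "f x" j i] key[of "r y" "r x" j i]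
        f r xyz r_iff[of x y] r_iff[of y x] by (auto simp: not_less[symmetric])
  qed
  then show ?thesis by blast
qed

text \<open>From a grid point all critical times are multiples of \<open>1 / D\<close>. A delay up
  to \<open>M\<close> is such a multiple (even \<open>j\<close>) or can be moved to the midpoint
  between two neighbours (odd \<open>j\<close>). Beyond \<open>M\<close> every clock exceeds all
  constants, and \<open>j = 2 * M * D + 1\<close> is just past \<open>M\<close>.\<close>

lemma discretize_delay:
  assumes D: "0 < D" and d: "0 \<le> d"
  shows "\<exists>j\<le>2 * M * D + 1. eqv C M (delay (gv D u) d) (delay (gv D u) (real j / real (2 * D)))"
proof -
  have main: "eqv C M (delay (gv D u) d) (delay (gv D u) d')"
    if d': "0 \<le> d'" and cmp: "\<And>i z. z \<le> M \<Longrightarrow> (real i / D + d < real z \<longleftrightarrow> real i / D + d' < real z) \<and>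
      (real i / D + d \<le> real z \<longleftrightarrow> real i / D + d' \<le> real z)" for d'
  proof (rule eqvI)
    fix y z assume "y < C" "z \<le> M"
    define q where "q = real (nthc u y) / D"
    have "0 \<le> q" by (simp add: q_def)
    then show "(0 < delay (gv D u) d y + real z \<longleftrightarrow> 0 < delay (gv D u) d' y + real z) \<and>
      (0 \<le> delay (gv D u) d y + real z \<longleftrightarrow> 0 \<le> delay (gv D u) d' y + real z)"
      using cmp[of 0 "nthc u y"] d d' unfolding q_def[symmetric]
      by (cases "z = 0") (auto simp: delay_def gv_def q_def[symmetric])
  qed (use cmp in \<open>auto simp: delay_def gv_def\<close>)
  show ?thesis
  proof (cases "d > real M")
    case True
    let ?j = "2 * M * D + 1"
    have j: "real ?j / real (2 * D) > real M" using D by (simp add: field_simps)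
    have "eqv C M (delay (gv D u) d) (delay (gv D u) (real ?j / real (2 * D)))"
    proof (rule main)
      fix i z :: nat assume "z \<le> M"
      then have "real z < real i / D + d" "real z < real i / D + real ?j / real (2 * D)"
        using True j by (smt (verit) divide_nonneg_nonneg of_nat_0_le_iff of_nat_mono)+
      then show "(real i / D + d < real z \<longleftrightarrow> real i / D + real ?j / real (2 * D) < real z) \<and>
        (real i / D + d \<le> real z \<longleftrightarrow> real i / D + real ?j / real (2 * D) \<le> real z)" by linarith
    qed simp
    then show ?thesis by blast
  next
    case False
    define a where "a = nat \<lfloor>d * D\<rfloor>"
    have a: "real a \<le> d * D" "d * D < real a + 1" using d by (simp_all add: a_def)
    define j where "j = (if d * D = real a then 2 * a else 2 * a + 1)"
    have cmpz: "(d * D < real_of_int t \<longleftrightarrow> real j / 2 < real_of_int t) \<and>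
        (d * D \<le> real_of_int t \<longleftrightarrow> real j / 2 \<le> real_of_int t)" for t
    proof (cases "d * D = real a")
      case True
      then show ?thesis by (simp add: j_def)
    next
      case False
      then have j: "real j / 2 = real a + 1 / 2" by (simp add: j_def)
      have "real a < d * D" using a False by simp
      moreover have "t \<le> int a \<or> int a + 1 \<le> t" by linarith
      then have "real_of_int t \<le> real a \<or> real a + 1 \<le> real_of_int t" by (auto simp: of_int_le_iff[symmetric] simp del: of_int_le_iff)
      ultimately show ?thesis using a j by auto
    qed
    have "d * D \<le> real (M * D)" using False D by (simp add: mult_right_mono)
    then have "real j / 2 \<le> real (M * D)" using cmpz[of "int (M * D)"] by simp
    then have jle: "j \<le> 2 * M * D + 1" by linarith
    have "eqv C M (delay (gv D u) d) (delay (gv D u) (real j / real (2 * D)))"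
    proof (rule main)
      fix i z :: nat
      have "real i / D + d < real z \<longleftrightarrow> d * D < real_of_int (int z * int D - int i)"
        "real i / D + d \<le> real z \<longleftrightarrow> d * D \<le> real_of_int (int z * int D - int i)"
        "real i / D + real j / real (2 * D) < real z \<longleftrightarrow> real j / 2 < real_of_int (int z * int D - int i)"
        "real i / D + real j / real (2 * D) \<le> real z \<longleftrightarrow> real j / 2 \<le> real_of_int (int z * int D - int i)"
        using D by (simp_all add: field_simps)
      then show "(real i / D + d < real z \<longleftrightarrow> real i / D + real j / real (2 * D) < real z) \<and>
        (real i / D + d \<le> real z \<longleftrightarrow> real i / D + real j / real (2 * D) \<le> real z)"
        using cmpz[of "int z * int D - int i"] by blast
    qed simp
    with jle show ?thesis by blast
  qed
qed

section \<open>Steps between grid points in natural arithmetic\<close>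

text \<open>The clock value scaled by \<open>2 * D\<close>, after the delay
  \<open>j / (2 * D)\<close> and the resets coded by \<open>Y\<close>; index \<open>C\<close> again
  yields 0.\<close>

definition gval :: "nat \<Rightarrow> nat \<Rightarrow> nat \<Rightarrow> nat \<Rightarrow> nat \<Rightarrow> nat" where
  "gval C u j Y x = (if x < C \<and> x \<notin> set_decode Y then 2 * nthc u x + j else 0)"

text \<open>Half steps and resets may leave the grid of width \<open>1 / D\<close>;
  \<open>u'\<close> is a grid point in the same class as the result, and so puts the game back on
  it.\<close>

definition geq :: "nat \<Rightarrow> nat \<Rightarrow> nat \<Rightarrow> nat \<Rightarrow> nat \<Rightarrow> nat \<Rightarrow> nat \<Rightarrow> bool" where
  "geq C M D u j Y u' \<longleftrightarrow> (\<forall>x\<le>C. \<forall>y\<le>C. \<forall>z\<le>M.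
    (gval C u j Y x < gval C u j Y y + 2 * D * z \<longleftrightarrow> gval C u' 0 0 x < gval C u' 0 0 y + 2 * D * z) \<and>
    (gval C u j Y x \<le> gval C u j Y y + 2 * D * z \<longleftrightarrow> gval C u' 0 0 x \<le> gval C u' 0 0 y + 2 * D * z))"

definition rgeq :: "nat \<Rightarrow> nat \<Rightarrow> nat \<Rightarrow> nat \<Rightarrow> nat \<Rightarrow> nat \<Rightarrow> nat \<Rightarrow> bool" where
  "rgeq n k m D u j r \<longleftrightarrow> geq k m D (dropc n u) j 0 (dropc n r)"

lemma scaled_cmp:
  assumes "0 < D"
  shows "real a / real (2 * D) < real b / real (2 * D) + real z \<longleftrightarrow> a < b + 2 * D * z"
    "real a / real (2 * D) \<le> real b / real (2 * D) + real z \<longleftrightarrow> a \<le> b + 2 * D * z"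
proof -
  have e: "real b / real (2 * D) + real z = real (b + 2 * D * z) / real (2 * D)" using assms by (simp add: field_simps)
  have p: "0 < real (2 * D)" using assms by simp
  show "real a / real (2 * D) < real b / real (2 * D) + real z \<longleftrightarrow> a < b + 2 * D * z"
    "real a / real (2 * D) \<le> real b / real (2 * D) + real z \<longleftrightarrow> a \<le> b + 2 * D * z"
    unfolding e using p by (simp_all only: divide_less_cancel divide_le_cancel of_nat_less_iff of_nat_le_iff) auto
qed

lemma geq_eqv:
  assumes "0 < D"
  shows "geq C M D u j Y u' \<longleftrightarrow>
    eqv C M (reset (set_decode Y) (delay (gv D u) (real j / real (2 * D)))) (gv D u')"
proof -
  have 1: "zc C (reset (set_decode Y) (delay (gv D u) (real j / real (2 * D)))) x = real (gval C u j Y x) / real (2 * D)" for x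
    using assms by (simp add: zc_def reset_def delay_def gv_def gval_def add_divide_distrib)
  have 2: "zc C (gv D u') x = real (gval C u' 0 0 x) / real (2 * D)" for x
    using assms by (simp add: zc_def gv_def gval_def)
  show ?thesis unfolding eqv_def geq_def 1 2 scaled_cmp[OF assms] ..
qed

lemma rgeq_eqv:
  assumes "0 < D"
  shows "rgeq n k m D u j r \<longleftrightarrow>
    eqv k m (\<lambda>x. delay (gv D u) (real j / real (2 * D)) (n + x)) (\<lambda>x. gv D r (n + x))"
  unfolding rgeq_def geq_eqv[OF assms] by (simp add: reset_def delay_def gv_def nthc_dropc)

text \<open>The codes below \<open>U\<close> represent every successor class. All quantifiers are
  bounded, so the property can be tested and a suitable \<open>U\<close> searched for;
  \<open>0 < U\<close> keeps the origin among the codes.\<close>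

definition grid_closed :: "nat \<Rightarrow> nat \<Rightarrow> nat \<Rightarrow> nat \<Rightarrow> bool" where
  "grid_closed C M D U \<longleftrightarrow> 0 < U \<and>
    (\<forall>u<U. \<forall>j\<le>2 * M * D + 1. \<forall>Y<2 ^ C. \<exists>u'<U. geq C M D u j Y u')"

text \<open>The class of a valuation is determined by the finite table \<open>tab\<close> of its
  comparisons. Finitely many codes therefore represent all classes of grid points, and any
  \<open>U\<close> above them works.\<close>

lemma grid_closed_exists: "\<exists>U. grid_closed C M (Suc C) U"
proof -
  define tab where "tab v = {(x, y, z, b). x \<le> C \<and> y \<le> C \<and> z \<le> M \<and>
    (if b then zc C v x < zc C v y + real z else zc C v x \<le> zc C v y + real z)}" for v
  have tab: "tab v = tab v' \<Longrightarrow> eqv C M v v'" and tab': "eqv C M v v' \<Longrightarrow> tab v = tab v'" for v v'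
  proof -
    assume t: "tab v = tab v'"
    show "eqv C M v v'"
      unfolding eqv_def
    proof (intro allI impI)
      fix x y z assume "x \<le> C" "y \<le> C" "z \<le> M"
      then show "(zc C v x < zc C v y + real z \<longleftrightarrow> zc C v' x < zc C v' y + real z) \<and>
        (zc C v x \<le> zc C v y + real z \<longleftrightarrow> zc C v' x \<le> zc C v' y + real z)"
        using arg_cong[OF t, of "\<lambda>A. (x, y, z, True) \<in> A"] arg_cong[OF t, of "\<lambda>A. (x, y, z, False) \<in> A"]
        by (simp add: tab_def)
    qed
  next
    assume "eqv C M v v'"
    then show "tab v = tab v'" unfolding tab_def eqv_def by (auto split: if_splits)
  qed
  let ?T = "range (\<lambda>u. tab (gv (Suc C) u))"
  have "?T \<subseteq> Pow ({..C} \<times> {..C} \<times> {..M} \<times> UNIV)" by (auto simp: tab_def)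
  then have "finite ?T" by (rule finite_subset) simp
  then obtain R where R: "finite R" "?T = (\<lambda>u. tab (gv (Suc C) u)) ` R"
    using finite_subset_image[of ?T "\<lambda>u. tab (gv (Suc C) u)" UNIV] by auto
  obtain U where U: "0 < U" "\<forall>u\<in>R. u < U"
    using R(1) finite_nat_set_iff_bounded[of R] by (metis gr_zeroI less_SucI zero_less_Suc)
  have "\<exists>u'<U. geq C M (Suc C) u j Y u'" for u j Y
  proof -
    let ?v = "reset (set_decode Y) (delay (gv (Suc C) u) (real j / real (2 * Suc C)))"
    have "0 \<le> ?v x" for x by (simp add: reset_def delay_def gv_def)
    then obtain u0 where u0: "eqv C M ?v (gv (Suc C) u0)" using grid_point_exists[of C ?v M] by blast
    have "tab (gv (Suc C) u0) \<in> (\<lambda>u. tab (gv (Suc C) u)) ` R" using R(2) by blast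
    then obtain u' where u': "u' \<in> R" "tab (gv (Suc C) u0) = tab (gv (Suc C) u')" by auto
    then have "eqv C M ?v (gv (Suc C) u')" using u0 tab[OF u'(2)] eqv_trans by blast
    then show ?thesis using U(2) u'(1) by (auto simp: geq_eqv)
  qed
  then show ?thesis using U(1) unfolding grid_closed_def by blast
qed

section \<open>Plays that follow a controller and runs of the automaton\<close>

fun cstep :: "nat \<Rightarrow> nat \<Rightarrow> nat \<Rightarrow> (nat \<Rightarrow> nat \<Rightarrow> valuation set \<Rightarrow> nat \<times> nat \<times> clock set) \<Rightarrow> letter option \<Rightarrow>
    nat \<Rightarrow> valuation \<Rightarrow> nat \<Rightarrow> valuation \<Rightarrow> bool" where
  "cstep k m na \<delta> None l \<nu> l' \<mu>' \<longleftrightarrow> l' = l \<and> \<mu>' = \<nu>"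
| "cstep k m na \<delta> (Some (a, b)) l \<nu> l' \<mu>' \<longleftrightarrow>
    a < na \<and> (\<exists>Y. \<delta> l a (region_of {0..<k} m \<nu>) = (l', b, Y) \<and> \<mu>' = reset Y \<nu>)"

text \<open>A run of the product of the automaton and a controller, given by its delays instead of its
  time stamps; the controller idles on silent transitions.\<close>

definition combined_run ::
  "nat \<Rightarrow> nat \<Rightarrow> nat \<Rightarrow> ta \<Rightarrow> nat \<Rightarrow> (nat \<Rightarrow> nat \<Rightarrow> valuation set \<Rightarrow> nat \<times> nat \<times> clock set) \<Rightarrow>
   (nat \<Rightarrow> nat) \<Rightarrow> (nat \<Rightarrow> valuation) \<Rightarrow> (nat \<Rightarrow> valuation) \<Rightarrow> (nat \<Rightarrow> nat) \<Rightarrow> (nat \<Rightarrow> real) \<Rightarrow> (nat \<Rightarrow> letter option) \<Rightarrow> bool" where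
  "combined_run k m na T l0 \<delta> p v \<mu> l d a \<longleftrightarrow>
    p 0 \<in> set (ta_init T) \<and> v 0 = (\<lambda>_. 0) \<and> \<mu> 0 = (\<lambda>_. 0) \<and> l 0 = l0 \<and>
    (\<forall>i. 0 \<le> d i \<and>
      (\<exists>\<phi> Y. (p i, a i, \<phi>, Y, p (Suc i)) \<in> set (ta_rules T) \<and> set Y \<subseteq> {0..<ta_clocks T} \<and>
        sat \<phi> (delay (v i) (d i)) \<and> v (Suc i) = reset (set Y) (delay (v i) (d i))) \<and>
      cstep k m na \<delta> (a i) (l i) (delay (\<mu> i) (d i)) (l (Suc i)) (\<mu> (Suc i))) \<and>
    infinite {i. p i \<in> set (ta_final T)} \<and> infinite {i. a i \<noteq> None}"

lemma delay_delay: "delay (delay v d) d' = delay v (d + d')"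
  by (auto simp: delay_def)

lemma delay_0 [simp]: "delay v 0 = v"
  by (simp add: delay_def)

text \<open>The controller moves once per letter, the automaton also in between.
  \<open>cnt i\<close> letters precede position \<open>i\<close> of the run, and the controller's
  valuation there is the one after these letters, delayed by the time elapsed since.\<close>

lemma combined_of_play:
  assumes play: "consistent_play k m {0..<na} l0 \<delta> w'" and lang: "w' \<in> timed_lang T"
  shows "\<exists>p v \<mu> l d a. combined_run k m na T l0 \<delta> p v \<mu> l d a"
proof -
  obtain w ls vs where tw: "timed_word w" and run: "accepting_run T w ls vs" and er: "erase w w'"
    using lang by (auto simp: timed_lang_def)
  obtain h where h: "strict_mono h" "range h = {i. fst (w i) \<noteq> None}"
    "\<And>j. w' j = (the (fst (w (h j))), snd (w (h j)))" using er by (auto simp: erase_def)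
  have hw: "fst (w (h j)) \<noteq> None" for j using h(2) by blast
  obtain lc \<mu>s where lc0: "lc 0 = l0" "\<mu>s 0 = (\<lambda>_. 0)"
    and lcS: "\<And>n. let \<nu> = delay (\<mu>s n) (snd (w' n) - prev_time w' n);
                 (l', b, Y) = \<delta> (lc n) (fst (fst (w' n))) (region_of {0..<k} m \<nu>)
             in lc (Suc n) = l' \<and> snd (fst (w' n)) = b \<and> \<mu>s (Suc n) = reset Y \<nu>"
    and A: "\<And>n. fst (fst (w' n)) < na"
    using play unfolding consistent_play_def by auto
  have lcS': "\<exists>Y. \<delta> (lc n) (fst (fst (w' n))) (region_of {0..<k} m (delay (\<mu>s n) (snd (w' n) - prev_time w' n)))
      = (lc (Suc n), snd (fst (w' n)), Y) \<and> \<mu>s (Suc n) = reset Y (delay (\<mu>s n) (snd (w' n) - prev_time w' n))" for n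
    using lcS[of n] by (auto simp: Let_def split: prod.splits)
  define cnt where "cnt i = card {j. j < i \<and> fst (w j) \<noteq> None}" for i
  have cnt0: "cnt 0 = 0" by (simp add: cnt_def)
  have cntS: "cnt (Suc i) = cnt i + (if fst (w i) = None then 0 else 1)" for i
  proof -
    have "{j. j < Suc i \<and> fst (w j) \<noteq> None} =
        (if fst (w i) = None then {j. j < i \<and> fst (w j) \<noteq> None} else insert i {j. j < i \<and> fst (w j) \<noteq> None})"
      by (auto simp: less_Suc_eq)
    then show ?thesis by (simp add: cnt_def)
  qed
  have hcnt: "h (cnt i) = i" if i: "fst (w i) \<noteq> None" for i
  proof -
    obtain c where c: "i = h c" using i h(2) by blast
    have "{j. j < i \<and> fst (w j) \<noteq> None} = h ` {..<c}"
    proof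
      show "{j. j < i \<and> fst (w j) \<noteq> None} \<subseteq> h ` {..<c}"
      proof
        fix j assume j: "j \<in> {j. j < i \<and> fst (w j) \<noteq> None}"
        then have "j \<in> range h" using h(2) by blast
        then obtain c' where "j = h c'" by blast
        then show "j \<in> h ` {..<c}" using j c strict_mono_less[OF h(1)] by auto
      qed
      show "h ` {..<c} \<subseteq> {j. j < i \<and> fst (w j) \<noteq> None}"
        using hw c strict_mono_less[OF h(1)] by auto
    qed
    then have "cnt i = card (h ` {..<c})" by (simp add: cnt_def)
    also have "\<dots> = c" using strict_mono_imp_inj_on[OF h(1)] by (simp add: card_image inj_on_subset[OF _ subset_UNIV])
    finally show ?thesis using c by simp
  qed
  define \<mu> where "\<mu> i = delay (\<mu>s (cnt i)) (prev_time w i - prev_time w' (cnt i))" for i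
  define d where "d i = snd (w i) - prev_time w i" for i
  have pS: "prev_time w (Suc i) = snd (w i)" "prev_time w' (Suc i) = snd (w' i)" for i by (simp_all add: prev_time_def)
  have d: "0 \<le> d i" for i using tw by (cases i) (auto simp: d_def prev_time_def timed_word_def)
  have \<mu>d: "delay (\<mu> i) (d i) = delay (\<mu>s (cnt i)) (snd (w i) - prev_time w' (cnt i))" for i
    by (simp add: \<mu>_def d_def delay_delay)
  have cs: "cstep k m na \<delta> (fst (w i)) (lc (cnt i)) (delay (\<mu> i) (d i)) (lc (cnt (Suc i))) (\<mu> (Suc i))" for i
  proof (cases "fst (w i)")
    case None
    then have "cnt (Suc i) = cnt i" by (simp add: cntS)
    then show ?thesis using None unfolding \<mu>d by (simp add: \<mu>_def pS)
  next
    case (Some ab)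
    obtain a b where ab: "ab = (a, b)" by fastforce
    have c: "h (cnt i) = i" "cnt (Suc i) = Suc (cnt i)" using Some hcnt[of i] by (simp_all add: cntS)
    then have w': "w' (cnt i) = ((a, b), snd (w i))" using h(3)[of "cnt i"] Some ab by simp
    have "\<mu> (Suc i) = \<mu>s (Suc (cnt i))" unfolding \<mu>_def c(2) pS w' by simp
    then show ?thesis using lcS'[of "cnt i"] A[of "cnt i"] unfolding w' \<mu>d by (simp add: Some ab c(2))
  qed
  have "combined_run k m na T l0 \<delta> ls vs \<mu> (\<lambda>i. lc (cnt i)) d (\<lambda>i. fst (w i))"
    unfolding combined_run_def
  proof (intro conjI allI)
    show "\<mu> 0 = (\<lambda>_. 0)" by (simp add: \<mu>_def cnt0 lc0 prev_time_def)
    show "lc (cnt 0) = l0" by (simp add: cnt0 lc0)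
    have "infinite (range h)" using h(1) by (simp add: finite_image_iff strict_mono_imp_inj_on)
    then show "infinite {i. fst (w i) \<noteq> None}" using h(2) by simp
  qed (use run d cs in \<open>auto simp: accepting_run_def d_def\<close>)
  then show ?thesis by blast
qed

text \<open>Time stamps are partial sums of the delays. \<open>h j\<close> is the position of letter
  \<open>j\<close>, and \<open>g j\<close> the position from which the controller waits for it; the
  moves between them are silent, so their delays merge into one.\<close>

lemma play_of_combined:
  assumes run: "combined_run k m na T l0 \<delta> p v \<mu> l d a"
  shows "\<exists>w'. consistent_play k m {0..<na} l0 \<delta> w' \<and> w' \<in> timed_lang T"
proof -
  have d: "\<And>i. 0 \<le> d i"
    and cs: "\<And>i. cstep k m na \<delta> (a i) (l i) (delay (\<mu> i) (d i)) (l (Suc i)) (\<mu> (Suc i))"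
    and inf: "infinite {i. a i \<noteq> None}"
    using run unfolding combined_run_def by auto
  define t where "t i = (\<Sum>j<i. d j)" for i
  have tS: "t (Suc i) = t i + d i" for i by (simp add: t_def)
  have tmono: "t i \<le> t j" if "i \<le> j" for i j
    unfolding t_def using that d by (intro sum_mono2) auto
  have t0: "0 \<le> t i" for i unfolding t_def using d by (simp add: sum_nonneg)
  define w where "w i = (a i, t (Suc i))" for i
  define h where "h = enumerate {i. a i \<noteq> None}"
  have h: "strict_mono h" "range h = {i. a i \<noteq> None}"
    unfolding h_def using inf by (simp_all add: strict_mono_enumerate range_enumerate)
  have ha: "a (h j) \<noteq> None" for j using h(2) by blast
  define w' where "w' j = (the (a (h j)), t (Suc (h j)))" for j
  define g where "g j = (case j of 0 \<Rightarrow> 0 | Suc j' \<Rightarrow> Suc (h j'))" for j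
  have gh: "g j \<le> h j" for j
    using strict_mono_less[OF h(1)] by (cases j) (auto simp: g_def Suc_le_eq)
  have pw: "prev_time w i = t i" for i by (cases i) (auto simp: prev_time_def w_def t_def)
  have pw': "prev_time w' j = t (g j)" for j by (cases j) (auto simp: prev_time_def w'_def g_def t_def)
  have none: "a i = None" if "g j \<le> i" "i < h j" for i j
  proof (rule ccontr)
    assume "a i \<noteq> None"
    then have "i \<in> range h" using h(2) by simp
    then obtain c where c: "i = h c" by blast
    have "c < j" using that(2) c strict_mono_less[OF h(1)] by simp
    then obtain j' where j: "j = Suc j'" by (cases j) auto
    have "h j' < h c" using that(1) c by (simp add: g_def j)
    then show False using \<open>c < j\<close> j strict_mono_less[OF h(1)] by simp
  qed
  have idle: "l i = l (g j) \<and> \<mu> i = delay (\<mu> (g j)) (t i - t (g j))" if "g j \<le> i" "i \<le> h j" for i j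
    using that
  proof (induction i rule: dec_induct)
    case (step i)
    then show ?case using cs[of i] none[of j i] by (simp add: delay_delay tS algebra_simps)
  qed simp
  have step: "\<exists>Y. \<delta> (l (g j)) (fst (fst (w' j))) (region_of {0..<k} m (delay (\<mu> (g j)) (snd (w' j) - prev_time w' j)))
      = (l (g (Suc j)), snd (fst (w' j)), Y) \<and> \<mu> (g (Suc j)) = reset Y (delay (\<mu> (g j)) (snd (w' j) - prev_time w' j))
      \<and> fst (fst (w' j)) < na" for j
  proof -
    obtain x y where xy: "a (h j) = Some (x, y)" using ha[of j] by auto
    have "delay (\<mu> (g j)) (snd (w' j) - prev_time w' j) = delay (\<mu> (h j)) (d (h j))"
      using idle[OF gh order_refl, of j] by (simp add: pw' w'_def tS delay_delay algebra_simps)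
    moreover have "fst (w' j) = (x, y)" by (simp add: w'_def xy)
    ultimately show ?thesis using cs[of "h j"] idle[OF gh order_refl, of j] by (auto simp: xy g_def)
  qed
  have "consistent_play k m {0..<na} l0 \<delta> w'"
    unfolding consistent_play_def
  proof (intro conjI allI exI[of _ "\<lambda>j. l (g j)"] exI[of _ "\<lambda>j. \<mu> (g j)"])
    show "timed_word w'"
      unfolding timed_word_def w'_def using t0 strict_mono_less_eq[OF h(1)] by (auto intro!: tmono)
    show "fst (fst (w' n)) \<in> {0..<na}" for n using step[of n] by auto
    show "l (g 0) = l0" "\<mu> (g 0) = (\<lambda>_. 0)" using run by (simp_all add: g_def combined_run_def)
    show "let \<nu> = delay (\<mu> (g n)) (snd (w' n) - prev_time w' n);
                 (l', b, Y) = \<delta> (l (g n)) (fst (fst (w' n))) (region_of {0..<k} m \<nu>)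
             in l (g (Suc n)) = l' \<and> snd (fst (w' n)) = b \<and> \<mu> (g (Suc n)) = reset Y \<nu>" for n
      using step[of n] by (auto simp: Let_def)
  qed
  moreover have "w' \<in> timed_lang T"
    unfolding timed_lang_def
  proof (intro CollectI exI conjI)
    show "timed_word w" unfolding timed_word_def w_def using t0 by (auto intro!: tmono)
    have "snd (w i) - prev_time w i = d i" for i unfolding pw by (simp add: w_def tS)
    then show "accepting_run T w p v" using run unfolding accepting_run_def combined_run_def by (simp add: w_def)
    show "erase w w'" unfolding erase_def
      by (rule exI[of _ h]) (use h in \<open>simp add: w_def w'_def\<close>)
  qed
  ultimately show ?thesis by blast
qed

section \<open>The finite game of an instance\<close>

lemma set_encode_less:
  assumes "A \<subseteq> {..<C}" shows "set_encode A < 2 ^ C"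
proof -
  have "set_encode A \<le> (\<Sum>i<C. 2 ^ i)"
    unfolding set_encode_def using assms by (intro sum_mono2) auto
  also have "\<dots> < 2 ^ C" by (induction C) auto
  finally show ?thesis .
qed

lemma set_decode_less: "Y < 2 ^ C \<Longrightarrow> set_decode Y \<subseteq> {..<C}"
proof
  fix x assume Y: "Y < 2 ^ C" and x: "x \<in> set_decode Y"
  show "x \<in> {..<C}"
  proof (rule ccontr)
    assume "x \<notin> {..<C}"
    then have "(2::nat) ^ C \<le> 2 ^ x" by (simp add: power_increasing)
    with Y have "Y < 2 ^ x" by (rule less_le_trans)
    then have "Y div 2 ^ x = 0" by (rule div_less)
    then show False using x by (simp add: set_decode_def)
  qed
qed

lemma eqv_cong: "eqv C M v v' \<Longrightarrow> (\<And>x. x < C \<Longrightarrow> w x = v x) \<Longrightarrow> eqv C M w v'"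
  by (rule eqv_reindex[of C M v v' M C "\<lambda>x. x"]) (auto simp: zc_def)

lemma sat_cong: "cc_over X M \<phi> \<Longrightarrow> (\<And>x. x \<in> X \<Longrightarrow> v x = w x) \<Longrightarrow> sat \<phi> v \<longleftrightarrow> sat \<phi> w"
  by (induction \<phi>) auto

lemma cc_over_mono: "cc_over X M \<phi> \<Longrightarrow> X \<subseteq> X' \<Longrightarrow> M \<le> M' \<Longrightarrow> cc_over X' M' \<phi>"
  by (induction \<phi>) auto

text \<open>The bit \<open>fl\<close> remembers whether a final location has been visited since the last letter.\<close>

lemma infinite_final_of_flags:
  assumes fl: "\<And>i. fl (Suc i) = (if F (Suc i) then 1 else if N i then fl i else (0::nat))"
    and inf: "infinite {i. \<not> N i \<and> fl i = 1}"
  shows "infinite {i. F i}"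
proof
  assume "finite {i. F i}"
  then obtain t where t: "\<And>i. F i \<Longrightarrow> i < t" using finite_nat_set_iff_bounded by auto
  obtain i1 where i1: "i1 \<ge> t" "\<not> N i1" using inf unfolding infinite_nat_iff_unbounded_le by auto
  have "fl i = 0" if "i \<ge> Suc i1" for i
    using that
  proof (induction i rule: dec_induct)
    case base
    then show ?case using fl[of i1] t[of "Suc i1"] i1 by auto
  next
    case (step i)
    then show ?case using fl[of i] t[of "Suc i"] i1 by auto
  qed
  moreover obtain i2 where "i2 \<ge> Suc i1" "fl i2 = 1" using inf unfolding infinite_nat_iff_unbounded_le by blast
  ultimately show False by simp
qed

text \<open>After a final visit the bit survives until the next letter, and there always is a next
  letter.\<close>

lemma infinite_flags_of_final:
  assumes fl: "\<And>i. fl (Suc i) = (if F (Suc i) then 1 else if N i then fl i else (0::nat))"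
    and inf: "infinite {i. F i}" "infinite {i. \<not> N i}"
  shows "infinite {i. \<not> N i \<and> fl i = 1}"
  unfolding infinite_nat_iff_unbounded_le
proof
  fix m
  obtain i where i: "i \<ge> Suc m" "F i" using inf(1) unfolding infinite_nat_iff_unbounded_le by auto
  then have fi: "fl i = 1" using fl[of "i - 1"] by simp
  have ex: "\<exists>j. j \<ge> i \<and> \<not> N j" using inf(2) unfolding infinite_nat_iff_unbounded_le by auto
  define j where "j = (LEAST j. j \<ge> i \<and> \<not> N j)"
  have j: "j \<ge> i" "\<not> N j" using LeastI_ex[OF ex] by (auto simp: j_def)
  have nj: "N i'" if "i \<le> i'" "i' < j" for i' using that not_less_Least[of i' "\<lambda>j. j \<ge> i \<and> \<not> N j"] by (auto simp: j_def)
  have "i' \<le> j \<longrightarrow> fl i' = 1" if "i \<le> i'" for i'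
    using that
  proof (induction i' rule: dec_induct)
    case (step i')
    then show ?case using fl[of i'] nj[of i'] by auto
  qed (use fi in simp)
  then show "\<exists>n\<ge>m. n \<in> {i. \<not> N i \<and> fl i = 1}" using j i by (intro exI[of _ j]) auto
qed

definition stc :: "nat \<Rightarrow> nat \<Rightarrow> nat \<Rightarrow> nat" where "stc p f u = pr p (pr f u)"

lemma stc_inject [simp]: "stc p f u = stc p' f' u' \<longleftrightarrow> p = p' \<and> f = f' \<and> u = u'"
  unfolding stc_def by (metis pf_pr ps_pr)

lemma stc_le: "p \<le> p' \<Longrightarrow> f \<le> f' \<Longrightarrow> u \<le> u' \<Longrightarrow> stc p f u \<le> stc p' f' u'"
  unfolding stc_def by (intro pr_mono)

text \<open>\<open>n\<close> bounds all locations, clocks and constants of the automaton (later it is the code of the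
  instance), so that it also serves as the number of clocks of the automaton. The clocks of the
  controller are placed after these.\<close>

locale instance_game =
  fixes k m :: nat and T :: ta and n U :: nat
  assumes rules: "\<And>p \<sigma> \<phi> Y q. (p, \<sigma>, \<phi>, Y, q) \<in> set (ta_rules T) \<Longrightarrow> p < n \<and> q < n \<and> cc_over {0..<n} n \<phi>"
    and clocks: "ta_clocks T \<le> n" and init: "\<And>p. p \<in> set (ta_init T) \<Longrightarrow> p < n"
    and closed: "grid_closed (n + k) (n + m) (Suc (n + k)) U"
begin

definition C where "C = n + k"
definition M where "M = n + m"
definition D where "D = Suc (n + k)"
definition J where "J = 2 * M * D + 1"

lemma D_pos [simp]: "0 < D" by (simp add: D_def)
lemma U_pos [simp]: "0 < U" using closed by (simp add: grid_closed_def)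

definition cv :: "valuation \<Rightarrow> valuation \<Rightarrow> valuation" where
  "cv v \<mu> x = (if x < n then v x else \<mu> (x - n))"

definition gdelay :: "nat \<Rightarrow> nat \<Rightarrow> valuation" where
  "gdelay u j = delay (gv D u) (real j / real (2 * D))"

text \<open>Regions of the controller's clocks are named by grid codes; several codes may name the
  same region.\<close>

definition reg :: "nat \<Rightarrow> valuation set" where
  "reg r = region_of {0..<k} m (\<lambda>x. gv D r (n + x))"

text \<open>One code \<open>Y\<close> describes the resets of both components: the rule fixes the
  bits below \<open>n\<close>, the higher ones are left to the controller.\<close>

definition gstep :: "letter option \<Rightarrow> nat \<Rightarrow> nat \<Rightarrow> nat \<Rightarrow> nat \<Rightarrow> nat \<Rightarrow> nat \<Rightarrow> bool" where
  "gstep \<sigma> p u j Y p' u' \<longleftrightarrow> (\<exists>\<phi> Yl. (p, \<sigma>, \<phi>, Yl, p') \<in> set (ta_rules T) \<and> set Yl \<subseteq> {0..<ta_clocks T} \<and>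
    (\<forall>x<n. x \<in> set_decode Y \<longleftrightarrow> x \<in> set Yl) \<and> sat \<phi> (gdelay u j) \<and> geq C M D u j Y u')"

definition eps :: "nat \<Rightarrow> nat \<Rightarrow> nat \<Rightarrow> nat \<Rightarrow> nat \<Rightarrow> nat \<Rightarrow> bool" where
  "eps p f u p' f' u' \<longleftrightarrow> f' = (if p' \<in> set (ta_final T) then 1 else f) \<and>
    (\<exists>j\<le>J. \<exists>Y<2 ^ C. gstep None p u j Y p' u' \<and> (\<forall>x<k. n + x \<notin> set_decode Y))"

definition let_edge :: "nat \<Rightarrow> nat \<Rightarrow> nat \<Rightarrow> nat \<Rightarrow> nat \<Rightarrow> nat \<Rightarrow> nat \<Rightarrow> nat \<Rightarrow> nat \<Rightarrow> bool" where
  "let_edge a r b Y' p u p' f' u' \<longleftrightarrow> f' = (if p' \<in> set (ta_final T) then 1 else 0) \<and>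
    (\<exists>j\<le>J. \<exists>Y<2 ^ C. gstep (Some (a, b)) p u j Y p' u' \<and> (\<forall>x<k. n + x \<in> set_decode Y \<longleftrightarrow> x \<in> set_decode Y') \<and>
      rgeq n k m D u j r)"

definition E0 :: "(nat \<times> nat) set" where
  "E0 = {(stc p f u, stc p' f' u') | p f u p' f' u'. p < n \<and> f < 2 \<and> u < U \<and> p' < n \<and> f' < 2 \<and> u' < U \<and> eps p f u p' f' u'}"

definition E1 :: "nat \<times> nat \<Rightarrow> nat \<times> nat \<Rightarrow> (nat \<times> bool \<times> nat) set" where
  "E1 x y = {(stc p f u, f = 1, stc p' f' u') | p f u p' f' u'. p < n \<and> f < 2 \<and> u < U \<and> p' < n \<and> f' < 2 \<and> u' < U \<and>
    let_edge (fst x) (snd x) (fst y) (snd y) p u p' f' u'}"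

definition Init :: "nat set" where "Init = {stc p 0 0 | p. p < n \<and> p \<in> set (ta_init T)}"
definition Q :: "nat set" where "Q = {..stc n 2 U}"
text \<open>An observation of Player II is a letter with a code of the region of its own clocks; an
  answer in \<open>Ys\<close> is a letter with a code of a reset set.\<close>

definition Xs :: "nat \<Rightarrow> (nat \<times> nat) set" where "Xs na = {..<na} \<times> {..<U}"
definition Ys :: "nat \<Rightarrow> (nat \<times> nat) set" where "Ys nb = {..<nb} \<times> {..<2 ^ k}"

lemma E0_Q: "E0 \<subseteq> Q \<times> Q" and E1_Q: "E1 x y \<subseteq> Q \<times> UNIV \<times> Q" and Init_Q: "Init \<subseteq> Q"
  by (auto simp: E0_def E1_def Init_def Q_def intro!: stc_le)

lemma delay_cv: "delay (cv v \<mu>) d = cv (delay v d) (delay \<mu> d)"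
  by (auto simp: delay_def cv_def)

lemma cv_nonneg: "(\<And>x. 0 \<le> v x) \<Longrightarrow> (\<And>x. 0 \<le> \<mu> x) \<Longrightarrow> 0 \<le> cv v \<mu> x"
  by (simp add: cv_def)

lemma guard_transfer:
  assumes "(p, \<sigma>, \<phi>, Y, q) \<in> set (ta_rules T)" and e: "eqv C M (cv v \<mu>) w"
  shows "sat \<phi> v \<longleftrightarrow> sat \<phi> w"
proof -
  have \<phi>: "cc_over {0..<n} n \<phi>" using rules[OF assms(1)] by simp
  have "sat \<phi> v \<longleftrightarrow> sat \<phi> (cv v \<mu>)" by (rule sat_cong[OF \<phi>]) (simp add: cv_def)
  also have "\<dots> \<longleftrightarrow> sat \<phi> w" by (rule eqv_sat[OF e]) (rule cc_over_mono[OF \<phi>], auto simp: C_def M_def)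
  finally show ?thesis .
qed

lemma reset_transfer:
  assumes e: "eqv C M (cv v \<mu>) w" and A: "A \<subseteq> {0..<n}" "\<And>x. x < n \<Longrightarrow> x \<in> A' \<longleftrightarrow> x \<in> A"
    and B: "\<And>x. x < k \<Longrightarrow> n + x \<in> A' \<longleftrightarrow> x \<in> B" and w: "eqv C M (reset A' w) w'"
  shows "eqv C M (cv (reset A v) (reset B \<mu>)) w'"
proof -
  have "eqv C M (reset A' (cv v \<mu>)) w'" using eqv_reset[OF e] w by (rule eqv_trans)
  then show ?thesis
  proof (rule eqv_cong)
    fix x assume x: "x < C"
    show "cv (reset A v) (reset B \<mu>) x = reset A' (cv v \<mu>) x"
    proof (cases "x < n")
      case True
      then show ?thesis using A(2) by (simp add: cv_def reset_def)
    next
      case False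
      then have "x = n + (x - n)" "x - n < k" using x by (auto simp: C_def)
      then show ?thesis using B[of "x - n"] False by (simp add: cv_def reset_def)
    qed
  qed
qed

lemma region_transfer:
  assumes "eqv C M (cv v \<mu>) w"
  shows "eqv k m \<mu> (\<lambda>x. w (n + x))"
  using eqv_shift[of n k M "cv v \<mu>" w m] assms by (simp add: C_def M_def cv_def)

lemma rgeq_reg:
  assumes "eqv C M (cv v \<mu>) (gdelay u j)"
  shows "rgeq n k m D u j r \<longleftrightarrow> region_of {0..<k} m \<mu> = reg r"
  unfolding rgeq_eqv[OF D_pos] reg_def region_of_eq_iff
  using region_transfer[OF assms] unfolding gdelay_def by (blast intro: eqv_sym eqv_trans)

lemma delay_to_grid:
  assumes e: "eqv C M (cv v \<mu>) (gv D u)" and nn: "\<And>x. 0 \<le> v x" "\<And>x. 0 \<le> \<mu> x" and d: "0 \<le> d"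
  shows "\<exists>j\<le>J. eqv C M (cv (delay v d) (delay \<mu> d)) (gdelay u j)"
proof -
  obtain d' where d': "d' \<ge> 0" "eqv C M (delay (cv v \<mu>) d) (delay (gv D u) d')"
    using eqv_delay[OF e cv_nonneg[OF nn] gv_nonneg d] by blast
  obtain j where "j \<le> J" "eqv C M (delay (gv D u) d') (gdelay u j)"
    using discretize_delay[OF D_pos d'(1), of M C u] by (auto simp: gdelay_def J_def)
  then show ?thesis using d'(2) eqv_trans unfolding delay_cv by blast
qed

lemma delay_of_grid:
  assumes e: "eqv C M (cv v \<mu>) (gv D u)" and nn: "\<And>x. 0 \<le> v x" "\<And>x. 0 \<le> \<mu> x"
  shows "\<exists>d\<ge>0. eqv C M (cv (delay v d) (delay \<mu> d)) (gdelay u j)"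
proof -
  have "0 \<le> real j / real (2 * D)" by simp
  from eqv_delay[OF eqv_sym[OF e] gv_nonneg cv_nonneg[OF nn] this]
  obtain d where "d \<ge> 0" "eqv C M (gdelay u j) (delay (cv v \<mu>) d)" unfolding gdelay_def by blast
  then show ?thesis unfolding delay_cv using eqv_sym by blast
qed

text \<open>One half of the bisimulation: discretise the delay, code the joint resets, and take the
  representative provided by closure. \<open>B\<close> holds the controller's resets, empty for a
  silent move.\<close>

lemma concrete_step_to_grid:
  assumes e: "eqv C M (cv v \<mu>) (gv D u)" and nn: "\<And>x. 0 \<le> v x" "\<And>x. 0 \<le> \<mu> x" and d: "0 \<le> d" and u: "u < U"
    and r: "(p, \<sigma>, \<phi>, Yl, p') \<in> set (ta_rules T)" "set Yl \<subseteq> {0..<ta_clocks T}" "sat \<phi> (delay v d)"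
    and B: "B \<subseteq> {0..<k}"
  shows "\<exists>j\<le>J. \<exists>Y<2 ^ C. \<exists>u'<U. gstep \<sigma> p u j Y p' u' \<and> (\<forall>x<k. n + x \<in> set_decode Y \<longleftrightarrow> x \<in> B) \<and>
    eqv C M (cv (delay v d) (delay \<mu> d)) (gdelay u j) \<and>
    eqv C M (cv (reset (set Yl) (delay v d)) (reset B (delay \<mu> d))) (gv D u')"
proof -
  obtain j where j: "j \<le> J" "eqv C M (cv (delay v d) (delay \<mu> d)) (gdelay u j)"
    using delay_to_grid[OF e nn d] by blast
  have Yl: "set Yl \<subseteq> {0..<n}" using r(2) clocks by auto
  define Y where "Y = set_encode (set Yl \<union> (\<lambda>x. n + x) ` B)"
  have finB: "finite B" using B finite_subset by blast
  have dY: "set_decode Y = set Yl \<union> (\<lambda>x. n + x) ` B" unfolding Y_def using finB by simp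
  have Y: "Y < 2 ^ C" unfolding Y_def by (rule set_encode_less) (use Yl B in \<open>auto simp: C_def\<close>)
  have Y1: "x \<in> set_decode Y \<longleftrightarrow> x \<in> set Yl" if "x < n" for x using that by (auto simp: dY)
  have Y2: "n + x \<in> set_decode Y \<longleftrightarrow> x \<in> B" if "x < k" for x using Yl by (auto simp: dY)
  obtain u' where u': "u' < U" "geq C M D u j Y u'"
    using closed u j(1) Y unfolding grid_closed_def C_def M_def D_def J_def by blast
  have "gstep \<sigma> p u j Y p' u'"
    unfolding gstep_def using r guard_transfer[OF r(1) j(2)] Y1 u'(2) by blast
  moreover have "eqv C M (cv (reset (set Yl) (delay v d)) (reset B (delay \<mu> d))) (gv D u')"
    by (rule reset_transfer[OF j(2) Yl Y1 Y2]) (use u'(2) in \<open>simp_all add: geq_eqv gdelay_def\<close>)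
  ultimately show ?thesis using j Y u'(1) Y2 by blast
qed

subsection \<open>From budgets to a controller\<close>

text \<open>Memory states are indices of budgets. Along any run against this controller, grid points
  are chosen step by step so that the current vertex keeps a positive budget; the budget never grows
  and drops at each flag, so an accepting run is impossible.\<close>

lemma controller_of_budgets:
  fixes N :: nat
  assumes bud: "budget_family E0 E1 Init (Xs na) (Ys nb) (\<beta> ` {..<N})"
  shows "has_winning_controller k m (na, nb, T)"
proof -
  have bud': "(\<exists>l\<in>{..<N}. \<forall>s\<in>Init. 0 < \<beta> l s)"
    "\<forall>l\<in>{..<N}. \<forall>(s, s')\<in>E0. 0 < \<beta> l s \<longrightarrow> 0 < \<beta> l s' \<and> \<beta> l s' \<le> \<beta> l s"
    "\<forall>l\<in>{..<N}. \<forall>x\<in>(Xs na). \<exists>y\<in>(Ys nb). \<exists>l'\<in>{..<N}. \<forall>(s, c, s')\<in>E1 x y. 0 < \<beta> l s \<longrightarrow> 0 < \<beta> l' s' \<and> \<beta> l' s' + of_bool c \<le> \<beta> l s"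
    using bud[unfolded budget_family_def ball_simps bex_simps] by - (elim conjE, assumption)+
  obtain l0 where l0: "l0 < N" "\<And>s. s \<in> Init \<Longrightarrow> 0 < \<beta> l0 s" using bud'(1) by blast
  have b0: "0 < \<beta> l s' \<and> \<beta> l s' \<le> \<beta> l s" if "l < N" "(s, s') \<in> E0" "0 < \<beta> l s" for l s s'
    using bspec[OF bspec[OF bud'(2), of l] that(2)] that by simp
  have b1: "\<exists>y\<in>(Ys nb). \<exists>l'<N. \<forall>(s, c, s')\<in>E1 x y. 0 < \<beta> l s \<longrightarrow> 0 < \<beta> l' s' \<and> \<beta> l' s' + of_bool c \<le> \<beta> l s"
    if "l < N" "x \<in> (Xs na)" for l x
    using bspec[OF bspec[OF bud'(3), of l] that(2)] that(1) by (simp add: Bex_def)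
  \<comment> \<open>A controller receives a region as a set of valuations, so a code
    \<open>\<rho>\<close> of it has to be chosen. For a region without a code below \<open>U\<close>
    only the type of the answer matters.\<close>
  define ok where "ok l a r z \<longleftrightarrow> (case z of (l', b, Y) \<Rightarrow> l' < N \<and> b < nb \<and> Y \<subseteq> {0..<k} \<and>
    ((\<exists>\<rho><U. r = reg \<rho>) \<longrightarrow> (\<exists>\<rho><U. r = reg \<rho> \<and> (\<exists>Yc. Y = set_decode Yc \<and>
      (\<forall>(s, c, s')\<in>E1 (a, \<rho>) (b, Yc). 0 < \<beta> l s \<longrightarrow> 0 < \<beta> l' s' \<and> \<beta> l' s' + of_bool c \<le> \<beta> l s)))))" for l a r z
  have ex: "\<exists>z. ok l a r z" if la: "l < N" "a < na" for l a r
  proof (cases "\<exists>\<rho><U. r = reg \<rho>")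
    case True
    then obtain \<rho> where \<rho>: "\<rho> < U" "r = reg \<rho>" by blast
    then obtain b Yc l' where z: "b < nb" "Yc < 2 ^ k" "l' < N"
      "\<forall>(s, c, s')\<in>E1 (a, \<rho>) (b, Yc). 0 < \<beta> l s \<longrightarrow> 0 < \<beta> l' s' \<and> \<beta> l' s' + of_bool c \<le> \<beta> l s"
      using b1[of l "(a, \<rho>)"] la by (auto simp: Xs_def Ys_def)
    then have "ok l a r (l', b, set_decode Yc)"
      using set_decode_less[OF z(2)] \<rho> unfolding ok_def by (auto simp: lessThan_atLeast0)
    then show ?thesis by blast
  next
    case False
    have "\<exists>y. y \<in> (Ys nb)" using b1[of l "(a, 0)"] la by (auto simp: Xs_def)
    then have "0 < nb" by (auto simp: Ys_def)
    then have "ok l a r (l, 0, {})" using False la by (auto simp: ok_def)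
    then show ?thesis by blast
  qed
  define \<delta> where "\<delta> l a r = (SOME z. ok l a r z)" for l a r
  have \<delta>: "ok l a r (\<delta> l a r)" if "l < N" "a < na" for l a r
    unfolding \<delta>_def using ex[OF that] by (rule someI_ex)
  have con: "is_controller k m {0..<na} {0..<nb} {..<N} l0 \<delta>"
    unfolding is_controller_def
  proof (intro conjI ballI)
    fix l a r assume "l \<in> {..<N}" "a \<in> {0..<na}"
    then show "\<delta> l a r \<in> {..<N} \<times> {0..<nb} \<times> Pow {0..<k}"
      using \<delta>[of l a r] by (cases "\<delta> l a r") (auto simp: ok_def)
  qed (use l0 in auto)
  have False if play: "consistent_play k m {0..<na} l0 \<delta> w" "w \<in> timed_lang T" for w
  proof -
    obtain p v \<mu> l d a where run: "combined_run k m na T l0 \<delta> p v \<mu> l d a"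
      using combined_of_play[OF play] by blast
    have d: "\<And>i. 0 \<le> d i" and inf: "infinite {i. p i \<in> set (ta_final T)}" "infinite {i. \<not> a i = None}"
      and ru: "\<And>i. \<exists>\<phi> Y. (p i, a i, \<phi>, Y, p (Suc i)) \<in> set (ta_rules T) \<and> set Y \<subseteq> {0..<ta_clocks T} \<and>
        sat \<phi> (delay (v i) (d i)) \<and> v (Suc i) = reset (set Y) (delay (v i) (d i))"
      and cs: "\<And>i. cstep k m na \<delta> (a i) (l i) (delay (\<mu> i) (d i)) (l (Suc i)) (\<mu> (Suc i))"
      and st: "p 0 \<in> set (ta_init T)" "v 0 = (\<lambda>_. 0)" "\<mu> 0 = (\<lambda>_. 0)" "l 0 = l0"
      using run unfolding combined_run_def by auto
    have pn: "p i < n" for i using ru[of i] rules by blast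
    have vn: "0 \<le> v i x" for i x
    proof (induction i)
      case (Suc i)
      then show ?case using ru[of i] d[of i] by (auto simp: reset_def delay_def)
    qed (simp add: st)
    have \<mu>n: "0 \<le> \<mu> i x" for i x
    proof (induction i)
      case (Suc i)
      then show ?case using cs[of i] d[of i] by (cases "a i") (auto simp: reset_def delay_def)
    qed (simp add: st)
    have lN: "l i < N" for i
    proof (induction i)
      case (Suc i)
      show ?case
      proof (cases "a i")
        case None
        then show ?thesis using cs[of i] Suc by simp
      next
        case (Some ab)
        then obtain x y Y where "x < na" "\<delta> (l i) x (region_of {0..<k} m (delay (\<mu> i) (d i))) = (l (Suc i), y, Y)"
          using cs[of i] by (cases ab) auto
        then show ?thesis using \<delta>[OF Suc, of x "region_of {0..<k} m (delay (\<mu> i) (d i))"] by (simp add: ok_def)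
      qed
    qed (use st l0 in simp)
    define P where "P i z \<longleftrightarrow> fst z < 2 \<and> snd z < U \<and> eqv C M (cv (v i) (\<mu> i)) (gv D (snd z)) \<and>
      0 < \<beta> (l i) (stc (p i) (fst z) (snd z)) \<and> (i = 0 \<longrightarrow> z = (0, 0))" for i :: nat and z :: "nat \<times> nat"
    define R where "R i z z' \<longleftrightarrow>
      \<beta> (l (Suc i)) (stc (p (Suc i)) (fst z') (snd z')) + of_bool (a i \<noteq> None \<and> fst z = 1) \<le> \<beta> (l i) (stc (p i) (fst z) (snd z)) \<and>
      fst z' = (if p (Suc i) \<in> set (ta_final T) then 1 else if a i = None then fst z else 0)"
      for i :: nat and z z' :: "nat \<times> nat"
    have P0: "\<exists>z. P 0 z"
    proof (rule exI[of _ "(0, 0)"])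
      have "cv (v 0) (\<mu> 0) = gv D 0" by (auto simp: cv_def gv_def st)
      then show "P 0 (0, 0)" using l0(2)[of "stc (p 0) 0 0"] st pn by (simp add: P_def Init_def)
    qed
    have PR: "\<exists>z'. P (Suc i) z' \<and> R i z z'" if Pz: "P i z" for i z
    proof -
      obtain f u where z: "z = (f, u)" by fastforce
      have fu: "f < 2" "u < U" "eqv C M (cv (v i) (\<mu> i)) (gv D u)" "0 < \<beta> (l i) (stc (p i) f u)"
        using Pz by (auto simp: P_def z)
      obtain \<phi> Yl where r: "(p i, a i, \<phi>, Yl, p (Suc i)) \<in> set (ta_rules T)" "set Yl \<subseteq> {0..<ta_clocks T}"
        "sat \<phi> (delay (v i) (d i))" "v (Suc i) = reset (set Yl) (delay (v i) (d i))" using ru[of i] by blast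
      define f' where "f' = (if p (Suc i) \<in> set (ta_final T) then 1 else if a i = None then f else 0)"
      have f': "f' < 2" using fu(1) by (simp add: f'_def)
      show ?thesis
      proof (cases "a i")
        case None
        have c: "l (Suc i) = l i" "\<mu> (Suc i) = reset {} (delay (\<mu> i) (d i))"
          using cs[of i] None by (simp_all add: reset_def)
        obtain j Y u' where g: "j \<le> J" "Y < 2 ^ C" "u' < U" "gstep (a i) (p i) u j Y (p (Suc i)) u'"
          "\<forall>x<k. n + x \<notin> set_decode Y" "eqv C M (cv (v (Suc i)) (\<mu> (Suc i))) (gv D u')"
          using concrete_step_to_grid[OF fu(3) vn \<mu>n d fu(2) r(1-3), of "{}"] unfolding r(4) c(2) by auto
        then have "eps (p i) f u (p (Suc i)) f' u'" unfolding eps_def f'_def None by auto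
        then have "(stc (p i) f u, stc (p (Suc i)) f' u') \<in> E0"
          unfolding E0_def using pn fu f' g(3) by blast
        from b0[OF lN this fu(4)] show ?thesis using g(3,6) f' None
          by (intro exI[of _ "(f', u')"]) (simp add: P_def R_def z c(1) f'_def)
      next
        case (Some ab)
        obtain x y where ab: "ab = (x, y)" by fastforce
        let ?r = "region_of {0..<k} m (delay (\<mu> i) (d i))"
        obtain B where B: "x < na" "\<delta> (l i) x ?r = (l (Suc i), y, B)" "\<mu> (Suc i) = reset B (delay (\<mu> i) (d i))"
          using cs[of i] Some ab by auto
        have okr: "ok (l i) x ?r (l (Suc i), y, B)" using \<delta>[OF lN[of i] B(1), of ?r] B(2) by simp
        then have Bk: "B \<subseteq> {0..<k}" by (simp add: ok_def)
        obtain j Y u' where g: "j \<le> J" "Y < 2 ^ C" "u' < U" "gstep (a i) (p i) u j Y (p (Suc i)) u'"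
          "\<forall>x<k. n + x \<in> set_decode Y \<longleftrightarrow> x \<in> B" "eqv C M (cv (delay (v i) (d i)) (delay (\<mu> i) (d i))) (gdelay u j)"
          "eqv C M (cv (v (Suc i)) (\<mu> (Suc i))) (gv D u')"
          using concrete_step_to_grid[OF fu(3) vn \<mu>n d fu(2) r(1-3) Bk] unfolding r(4) B(3) by auto
        \<comment> \<open>Closure with \<open>Y = 0\<close>, no resets, gives the region seen by the
          controller a code below \<open>U\<close>; so its answer was chosen according to the
          budgets.\<close>
        obtain u1 where u1: "u1 < U" "geq C M D u j 0 u1"
          using closed fu(2) g(1) unfolding grid_closed_def C_def M_def D_def J_def by fastforce
        then have "eqv C M (gdelay u j) (gv D u1)" by (simp add: geq_eqv gdelay_def reset_def)
        then have "?r = reg u1"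
          unfolding reg_def region_of_eq_iff using region_transfer[OF eqv_trans[OF g(6)]] by blast
        then obtain \<rho> Yc where \<rho>: "\<rho> < U" "?r = reg \<rho>" "B = set_decode Yc"
          "\<forall>(s, c, s')\<in>E1 (x, \<rho>) (y, Yc). 0 < \<beta> (l i) s \<longrightarrow> 0 < \<beta> (l (Suc i)) s' \<and> \<beta> (l (Suc i)) s' + of_bool c \<le> \<beta> (l i) s"
          using okr u1(1) unfolding ok_def by auto
        have "let_edge x \<rho> y Yc (p i) u (p (Suc i)) f' u'"
        proof -
          have "rgeq n k m D u j \<rho>" using rgeq_reg[OF g(6)] \<rho>(2) by simp
          moreover have "gstep (Some (x, y)) (p i) u j Y (p (Suc i)) u'" using g(4) Some ab by simp
          ultimately show ?thesis unfolding let_edge_def using g(1,2,5) \<rho>(3) Some by (auto simp: f'_def)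
        qed
        then have "(stc (p i) f u, f = 1, stc (p (Suc i)) f' u') \<in> E1 (x, \<rho>) (y, Yc)"
          unfolding E1_def using pn fu f' g(3) by auto
        from bspec[OF \<rho>(4) this] have "0 < \<beta> (l (Suc i)) (stc (p (Suc i)) f' u') \<and>
          \<beta> (l (Suc i)) (stc (p (Suc i)) f' u') + of_bool (f = 1) \<le> \<beta> (l i) (stc (p i) f u)" using fu(4) by simp
        then show ?thesis using g(3,7) f' Some
          by (intro exI[of _ "(f', u')"]) (simp add: P_def R_def z f'_def)
      qed
    qed
    obtain z where z: "\<And>i. P i (z i)" "\<And>i. R i (z i) (z (Suc i))"
      using dependent_nat_choice[of P R] P0 PR by blast
    define b where "b i = \<beta> (l i) (stc (p i) (fst (z i)) (snd (z i)))" for i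
    have bd: "b (Suc i) + of_bool (a i \<noteq> None \<and> fst (z i) = 1) \<le> b i" for i
      unfolding b_def by (rule conjunct1[OF z(2)[of i, unfolded R_def]])
    have "infinite {i. \<not> a i = None \<and> fst (z i) = 1}"
      by (rule infinite_flags_of_final[of "\<lambda>i. fst (z i)" "\<lambda>i. p i \<in> set (ta_final T)" "\<lambda>i. a i = None"])
        (use z(2) inf in \<open>simp_all add: R_def\<close>)
    moreover have "{i. \<not> a i = None \<and> fst (z i) = 1} \<subseteq> {i. (b (Suc i), b i) \<in> less_than}"
    proof
      fix i assume "i \<in> {i. \<not> a i = None \<and> fst (z i) = 1}"
      then show "i \<in> {i. (b (Suc i), b i) \<in> less_than}" using bd[of i] by simp
    qed
    moreover have "finite {i. (b (Suc i), b i) \<in> less_than}"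
    proof (rule wf_sequence_finite_drops[where A = b and ?t0.0 = 0])
      fix t show "(b (Suc t), b t) \<in> less_than \<or> b (Suc t) = b t" using bd[of t] by auto
    qed simp
    ultimately show False using finite_subset by blast
  qed
  then have "winning_controller k m (na, nb, T) {..<N} l0 \<delta>" using con by (auto simp: winning_controller_def)
  then show ?thesis unfolding has_winning_controller_def by blast
qed

subsection \<open>From a controller to budgets\<close>

text \<open>A flagged path in the product of the controller with the finite game lifts to a concrete
  run, since delays transfer from grid points back to valuations. This run is a play that the
  controller loses, so no such path exists and \<open>bounded_budget_family\<close> applies.\<close>

lemma budgets_of_controller:
  assumes "has_winning_controller k m (na, nb, T)"
  obtains W where "finite W" "card W \<le> memory_bound (card Q)"
    "\<And>\<beta> s. \<beta> \<in> W \<Longrightarrow> \<beta> s \<le> Suc (memory_bound (card Q) * card Q)" "budget_family E0 E1 Init (Xs na) (Ys nb) W"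
proof -
  obtain L l0 \<delta> where con: "is_controller k m {0..<na} {0..<nb} L l0 \<delta>"
    and win: "\<And>w. consistent_play k m {0..<na} l0 \<delta> w \<Longrightarrow> w \<notin> timed_lang T"
    using assms by (auto simp: has_winning_controller_def winning_controller_def)
  define \<delta>a where "\<delta>a l x = (case \<delta> l (fst x) (reg (snd x)) of (l', b, Y) \<Rightarrow> (l', (b, set_encode Y)))" for l x
  have \<delta>: "\<delta> l a (reg r) \<in> L \<times> {0..<nb} \<times> Pow {0..<k}" if "l \<in> L" "a < na" for l a r
    using con that by (auto simp: is_controller_def regions_def reg_def)
  have \<delta>a: "\<delta>a l x \<in> L \<times> (Ys nb)" if "l \<in> L" "x \<in> (Xs na)" for l x
  proof -
    obtain l' b Y where e: "\<delta> l (fst x) (reg (snd x)) = (l', b, Y)" using prod_cases3 by blast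
    moreover have "fst x < na" using that(2) by (auto simp: Xs_def)
    ultimately have "l' \<in> L" "b < nb" "Y \<subseteq> {0..<k}" using \<delta>[of l "fst x" "snd x"] that(1) by simp_all
    then show ?thesis using set_encode_less[of Y k] e by (simp add: \<delta>a_def Ys_def lessThan_atLeast0)
  qed
  have "\<not> flagged_path (product_edges E0 E1 (Xs na) L \<delta>a) ({l0} \<times> Init) f c" for f c
  proof
    assume fp: "flagged_path (product_edges E0 E1 (Xs na) L \<delta>a) ({l0} \<times> Init) f c"
    define l where "l i = fst (f i)" for i
    define p where "p i = pf (snd (f i))" for i
    define fl where "fl i = pf (ps (snd (f i)))" for i
    define u where "u i = ps (ps (snd (f i)))" for i
    have fi: "f i = (l i, stc (p i) (fl i) (u i))" for i by (simp add: l_def p_def fl_def u_def stc_def)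
    have f0: "l 0 = l0" "p 0 \<in> set (ta_init T)" "u 0 = 0"
      using fp fi[of 0] by (auto simp: flagged_path_def Init_def)
    have edge: "(\<not> c i \<and> l (Suc i) = l i \<and> l i \<in> L \<and> u (Suc i) < U \<and> eps (p i) (fl i) (u i) (p (Suc i)) (fl (Suc i)) (u (Suc i))) \<or>
      (\<exists>a r b Y. l i \<in> L \<and> a < na \<and> r < U \<and> c i = (fl i = 1) \<and> \<delta> (l i) a (reg r) = (l (Suc i), b, Y) \<and>
        let_edge a r b (set_encode Y) (p i) (u i) (p (Suc i)) (fl (Suc i)) (u (Suc i)))" for i
    proof -
      have "((l i, stc (p i) (fl i) (u i)), c i, (l (Suc i), stc (p (Suc i)) (fl (Suc i)) (u (Suc i)))) \<in> product_edges E0 E1 (Xs na) L \<delta>a"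
        using fp unfolding flagged_path_def fi[symmetric] by blast
      then consider (e) "\<not> c i" "l (Suc i) = l i" "l i \<in> L" "(stc (p i) (fl i) (u i), stc (p (Suc i)) (fl (Suc i)) (u (Suc i))) \<in> E0"
        | (x) x y where "l i \<in> L" "x \<in> (Xs na)" "\<delta>a (l i) x = (l (Suc i), y)"
          "(stc (p i) (fl i) (u i), c i, stc (p (Suc i)) (fl (Suc i)) (u (Suc i))) \<in> E1 x y"
        unfolding product_edges_def strategy_edges_def by auto
      then show ?thesis
      proof cases
        case e
        then show ?thesis by (auto simp: E0_def)
      next
        case x
        obtain l' b Y where d: "\<delta> (l i) (fst x) (reg (snd x)) = (l', b, Y)" using prod_cases3 by blast
        then have "l' = l (Suc i)" "y = (b, set_encode Y)" using x(3) by (auto simp: \<delta>a_def)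
        moreover have "fst x < na" "snd x < U" using x(2) by (auto simp: Xs_def)
        moreover have "c i = (fl i = 1)" "let_edge (fst x) (snd x) (fst y) (snd y) (p i) (u i) (p (Suc i)) (fl (Suc i)) (u (Suc i))"
          using x(4) by (auto simp: E1_def)
        ultimately show ?thesis using d x(1) by (intro disjI2 exI[of _ "fst x"] exI[of _ "snd x"] exI[of _ b] exI[of _ Y]) auto
      qed
    qed
    define P where "P i z \<longleftrightarrow> eqv C M (cv (fst z) (snd z)) (gv D (u i)) \<and> (\<forall>x. 0 \<le> fst z x) \<and> (\<forall>x. 0 \<le> snd z x) \<and>
      (i = 0 \<longrightarrow> z = ((\<lambda>_. 0), (\<lambda>_. 0)))" for i :: nat and z :: "valuation \<times> valuation"
    define R1 where "R1 i z z' d a \<longleftrightarrow> 0 \<le> d \<and> (\<exists>\<phi> Y. (p i, a, \<phi>, Y, p (Suc i)) \<in> set (ta_rules T) \<and> set Y \<subseteq> {0..<ta_clocks T} \<and>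
        sat \<phi> (delay (fst z) d) \<and> fst z' = reset (set Y) (delay (fst z) d)) \<and>
      cstep k m na \<delta> a (l i) (delay (snd z) d) (l (Suc i)) (snd z') \<and>
      (c i \<longrightarrow> a \<noteq> None \<and> fl i = 1) \<and> fl (Suc i) = (if p (Suc i) \<in> set (ta_final T) then 1 else if a = None then fl i else 0)"
      for i :: nat and z z' :: "valuation \<times> valuation" and d :: real and a :: "letter option"
    have P0: "\<exists>z. P 0 z"
    proof -
      have "cv (\<lambda>_. 0) (\<lambda>_. 0) = gv D (u 0)" by (auto simp: cv_def gv_def f0)
      then show ?thesis by (intro exI[of _ "((\<lambda>_. 0), (\<lambda>_. 0))"]) (simp add: P_def)
    qed
    have PR: "\<exists>z'. P (Suc i) z' \<and> (\<exists>d a. R1 i z z' d a)" if Pz: "P i z" for i z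
    proof -
      obtain v \<mu> where z: "z = (v, \<mu>)" by fastforce
      have e: "eqv C M (cv v \<mu>) (gv D (u i))" and nn: "\<And>x. 0 \<le> v x" "\<And>x. 0 \<le> \<mu> x" using Pz by (auto simp: P_def z)
      have main: "\<exists>d\<ge>0. \<exists>\<phi> Yl. (p i, \<sigma>, \<phi>, Yl, p (Suc i)) \<in> set (ta_rules T) \<and> set Yl \<subseteq> {0..<ta_clocks T} \<and> sat \<phi> (delay v d) \<and>
          eqv C M (cv (delay v d) (delay \<mu> d)) (gdelay (u i) j) \<and>
          P (Suc i) (reset (set Yl) (delay v d), reset B (delay \<mu> d))"
        if g: "gstep \<sigma> (p i) (u i) j Y (p (Suc i)) (u (Suc i))" "\<forall>x<k. n + x \<in> set_decode Y \<longleftrightarrow> x \<in> B" for \<sigma> j Y B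
      proof -
        obtain d where d: "d \<ge> 0" "eqv C M (cv (delay v d) (delay \<mu> d)) (gdelay (u i) j)"
          using delay_of_grid[OF e nn] by blast
        obtain \<phi> Yl where r: "(p i, \<sigma>, \<phi>, Yl, p (Suc i)) \<in> set (ta_rules T)" "set Yl \<subseteq> {0..<ta_clocks T}"
          "\<forall>x<n. x \<in> set_decode Y \<longleftrightarrow> x \<in> set Yl" "sat \<phi> (gdelay (u i) j)" "geq C M D (u i) j Y (u (Suc i))"
          using g(1) unfolding gstep_def by blast
        have "eqv C M (cv (reset (set Yl) (delay v d)) (reset B (delay \<mu> d))) (gv D (u (Suc i)))"
          by (rule reset_transfer[OF d(2), of _ "set_decode Y"])
            (use r g(2) clocks in \<open>auto simp: geq_eqv gdelay_def\<close>)
        then have "P (Suc i) (reset (set Yl) (delay v d), reset B (delay \<mu> d))"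
          using nn d(1) by (auto simp: P_def reset_def delay_def)
        then show ?thesis using d r(1,2,4) guard_transfer[OF r(1) d(2)] by blast
      qed
      from edge[of i] show ?thesis
      proof (elim disjE exE conjE)
        assume a: "\<not> c i" "l (Suc i) = l i" "eps (p i) (fl i) (u i) (p (Suc i)) (fl (Suc i)) (u (Suc i))"
        then obtain j Y where g: "gstep None (p i) (u i) j Y (p (Suc i)) (u (Suc i))" "\<forall>x<k. n + x \<in> set_decode Y \<longleftrightarrow> x \<in> {}"
          unfolding eps_def by auto
        from main[OF g] obtain d \<phi> Yl where d: "0 \<le> d" "(p i, None, \<phi>, Yl, p (Suc i)) \<in> set (ta_rules T)" "set Yl \<subseteq> {0..<ta_clocks T}"
          "sat \<phi> (delay v d)" "P (Suc i) (reset (set Yl) (delay v d), reset {} (delay \<mu> d))" by blast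
        have "R1 i z (reset (set Yl) (delay v d), reset {} (delay \<mu> d)) d None"
          unfolding R1_def z using d a by (auto simp: eps_def reset_def)
        then show ?thesis using d(5) by blast
      next
        fix a r b Y
        assume a: "l i \<in> L" "a < na" "r < U" "c i = (fl i = 1)" "\<delta> (l i) a (reg r) = (l (Suc i), b, Y)"
          "let_edge a r b (set_encode Y) (p i) (u i) (p (Suc i)) (fl (Suc i)) (u (Suc i))"
        have "Y \<subseteq> {0..<k}" using \<delta>[OF a(1,2), of r] a(5) by auto
        then have dY: "set_decode (set_encode Y) = Y" using finite_subset by (metis finite_atLeastLessThan set_encode_inverse)
        obtain j Yg where g: "gstep (Some (a, b)) (p i) (u i) j Yg (p (Suc i)) (u (Suc i))"
          "\<forall>x<k. n + x \<in> set_decode Yg \<longleftrightarrow> x \<in> Y" "rgeq n k m D (u i) j r"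
          using a(6) unfolding let_edge_def dY by blast
        from main[OF g(1,2)] obtain d \<phi> Yl where d: "0 \<le> d" "(p i, Some (a, b), \<phi>, Yl, p (Suc i)) \<in> set (ta_rules T)" "set Yl \<subseteq> {0..<ta_clocks T}"
          "sat \<phi> (delay v d)" "eqv C M (cv (delay v d) (delay \<mu> d)) (gdelay (u i) j)"
          "P (Suc i) (reset (set Yl) (delay v d), reset Y (delay \<mu> d))" by blast
        have "region_of {0..<k} m (delay \<mu> d) = reg r" using rgeq_reg[OF d(5)] g(3) by simp
        then have "R1 i z (reset (set Yl) (delay v d), reset Y (delay \<mu> d)) d (Some (a, b))"
          unfolding R1_def z using d a by (auto simp: let_edge_def)
        then show ?thesis using d(6) by blast
      qed
    qed
    obtain z where z: "\<And>i. P i (z i)" "\<And>i. \<exists>d a. R1 i (z i) (z (Suc i)) d a"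
      using dependent_nat_choice[of P "\<lambda>i z z'. \<exists>d a. R1 i z z' d a"] P0 PR by blast
    from z(2) have "\<forall>i. \<exists>da. R1 i (z i) (z (Suc i)) (fst da) (snd da)" by simp
    from choice[OF this] obtain da where da: "\<And>i. R1 i (z i) (z (Suc i)) (fst (da i)) (snd (da i))" by blast
    have "infinite {i. c i}" using fp by (simp add: flagged_path_def)
    then have inf: "infinite {i. \<not> snd (da i) = None \<and> fl i = 1}"
      by (rule infinite_super[rotated]) (use da in \<open>auto simp: R1_def\<close>)
    have "combined_run k m na T l0 \<delta> p (\<lambda>i. fst (z i)) (\<lambda>i. snd (z i)) l (\<lambda>i. fst (da i)) (\<lambda>i. snd (da i))"
      unfolding combined_run_def
    proof (intro conjI allI)
      show "infinite {i. p i \<in> set (ta_final T)}"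
        by (rule infinite_final_of_flags[OF _ inf]) (use da in \<open>simp add: R1_def\<close>)
      show "infinite {i. snd (da i) \<noteq> None}" using inf by (rule infinite_super[rotated]) auto
      show "fst (z 0) = (\<lambda>_. 0)" "snd (z 0) = (\<lambda>_. 0)" using z(1)[of 0] by (simp_all add: P_def)
    qed (use da f0 in \<open>simp_all add: R1_def\<close>)
    from play_of_combined[OF this] show False using win by blast
  qed
  then have no: "\<not> (\<exists>f c. flagged_path (product_edges E0 E1 (Xs na) L \<delta>a) ({l0} \<times> Init) f c)" by simp
  have "finite Q" "finite L" "l0 \<in> L" using con by (auto simp: Q_def is_controller_def)
  from bounded_budget_family[OF this(1,2) E0_Q E1_Q Init_Q this(3) \<delta>a no] that show thesis by blast
qed

end

section \<open>The decision procedure on codes\<close>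

lemma dec7:
  assumes "decidable (\<lambda>e. g (pf e) (pf (ps e)) (pf (ps (ps e))) (pf (ps (ps (ps e)))) (pf (ps (ps (ps (ps e)))))
      (pf (ps (ps (ps (ps (ps e)))))) (ps (ps (ps (ps (ps (ps e)))))))"
    "computable f1" "computable f2" "computable f3" "computable f4" "computable f5" "computable f6" "computable f7"
  shows "decidable (\<lambda>e. g (f1 e) (f2 e) (f3 e) (f4 e) (f5 e) (f6 e) (f7 e))"
  using dec_compose[OF assms(1) comp_pr[OF assms(2) comp_pr[OF assms(3) comp_pr[OF assms(4) comp_pr[OF assms(5)
    comp_pr[OF assms(6) comp_pr[OF assms(7,8)]]]]]]] by simp

lemma comp_gval [comp_intros]:
  assumes "computable c" "computable u" "computable j" "computable Y" "computable x"
  shows "computable (\<lambda>e. gval (c e) (u e) (j e) (Y e) (x e))"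
  unfolding gval_def by (intro comp_intros assms)

lemma dec_geq [comp_intros]:
  assumes "computable f1" "computable f2" "computable f3" "computable f4" "computable f5" "computable f6" "computable f7"
  shows "decidable (\<lambda>e. geq (f1 e) (f2 e) (f3 e) (f4 e) (f5 e) (f6 e) (f7 e))"
  by (rule dec7[OF _ assms]) (unfold geq_def, intro comp_intros)

lemma dec_rgeq [comp_intros]:
  "computable f1 \<Longrightarrow> computable f2 \<Longrightarrow> computable f3 \<Longrightarrow> computable f4 \<Longrightarrow> computable f5 \<Longrightarrow> computable f6 \<Longrightarrow>
    computable f7 \<Longrightarrow> decidable (\<lambda>e. rgeq (f1 e) (f2 e) (f3 e) (f4 e) (f5 e) (f6 e) (f7 e))"
  unfolding rgeq_def by (intro comp_intros)

lemma dec_grid_closed [comp_intros]: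
  assumes "computable f1" "computable f2" "computable f3" "computable f4"
  shows "decidable (\<lambda>e. grid_closed (f1 e) (f2 e) (f3 e) (f4 e))"
  unfolding decidable_def
  by (rule comp4[OF _ assms]) (unfold grid_closed_def decidable_def[symmetric], intro comp_intros)

subsection \<open>Guards\<close>

text \<open>Positive and, with \<open>negc\<close>, negative part of a coded integer, so that guards
  can be evaluated with natural numbers only.\<close>

definition posc :: "nat \<Rightarrow> nat" where "posc z = (if even z then z div 2 else 0)"
definition negc :: "nat \<Rightarrow> nat" where "negc z = (if even z then 0 else Suc (z div 2))"

lemma int_encode_posc_negc: "real_of_int z = real (posc (int_encode z)) - real (negc (int_encode z))"
  by (auto simp: int_encode_def sum_encode_def posc_def negc_def)

definition cmpc :: "nat \<Rightarrow> nat \<Rightarrow> nat \<Rightarrow> bool" where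
  "cmpc c a b \<longleftrightarrow> c = 0 \<and> a < b \<or> c = 1 \<and> a \<le> b \<or> c = 2 \<and> a = b \<or> c = 3 \<and> b \<le> a \<or> c = 4 \<and> b < a"

lemma cmpc_enc: "cmpc (enc_cmp c) a b \<longleftrightarrow> cmp_sem c (real a) (real b)"
  by (cases c) (auto simp: cmpc_def)

text \<open>Multiply by \<open>2 * D\<close> and move each negative term to the other side.\<close>

lemma cmpc_scaled:
  assumes "0 < D" "s = 2 * D"
  shows "cmpc (enc_cmp c) (a + negc (int_encode z) * s) (b + posc (int_encode z) * s) \<longleftrightarrow>
    cmp_sem c (real a / real (2 * D) - real b / real (2 * D)) (of_int z)"
proof -
  have s: "0 < real s" using assms by simp
  define z' where "z' = real_of_int z"
  have "real (a + negc (int_encode z) * s) - real (b + posc (int_encode z) * s) =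
      real s * (real a / real s - real b / real s - z')"
  proof -
    have "real s * (real a / real s - real b / real s - z') = real a - real b - real s * z'"
      using s by (simp add: right_diff_distrib)
    then show ?thesis unfolding z'_def int_encode_posc_negc[of z] by (simp add: algebra_simps)
  qed
  moreover define x where "x = real a / real s - real b / real s - z'"
  ultimately have e: "real (a + negc (int_encode z) * s) = real (b + posc (int_encode z) * s) + real s * x" by simp
  have k: "cmp_sem c (y + real s * x) y \<longleftrightarrow> cmp_sem c (x + z') z'" for y
    using s by (cases c) (simp_all add: mult_less_0_iff mult_le_0_iff zero_less_mult_iff zero_le_mult_iff)
  have "real a / real (2 * D) - real b / real (2 * D) = x + z'" using assms(2) by (simp add: x_def)
  then show ?thesis unfolding cmpc_enc e k by (simp add: z'_def)
qed

definition lookc :: "nat \<Rightarrow> nat \<Rightarrow> nat \<Rightarrow> nat" where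
  "lookc h c i = nthc h (c - Suc (nthc c i))"

lemma lookc_hist: "0 < c \<Longrightarrow> lookc (hist G e c) c i = cov G e (nthc c i)"
  unfolding lookc_def by (rule nthc_hist[OF nthc_less])

lemma comp_lookc [comp_intros]:
  "computable f \<Longrightarrow> computable g \<Longrightarrow> computable h \<Longrightarrow> computable (\<lambda>e. lookc (f e) (g e) (h e))"
  unfolding lookc_def by (intro comp_intros)

lemma comp_posc [comp_intros]: "computable f \<Longrightarrow> computable (\<lambda>e. posc (f e))"
  unfolding posc_def by (intro comp_intros)

lemma comp_negc [comp_intros]: "computable f \<Longrightarrow> computable (\<lambda>e. negc (f e))"
  unfolding negc_def by (intro comp_intros)

lemma dec_cmpc [comp_intros]:
  "computable f \<Longrightarrow> computable g \<Longrightarrow> computable h \<Longrightarrow> decidable (\<lambda>e. cmpc (f e) (g e) (h e))"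
  unfolding cmpc_def by (intro comp_intros)

text \<open>The parameter \<open>e\<close> codes the triple of a grid point \<open>u\<close>, a delay \<open>j\<close> and the grid width \<open>D\<close>.\<close>

definition clkc :: "nat \<Rightarrow> nat \<Rightarrow> nat" where "clkc e x = 2 * nthc (pf e) x + pf (ps e)"

definition satG :: "nat \<Rightarrow> nat \<Rightarrow> nat \<Rightarrow> nat" where
  "satG e c h =
    (if nthc c 0 = 0 then 1
     else if nthc c 0 = 1 then
       (if cmpc (nthc c 2) (clkc e (nthc c 1) + negc (nthc c 3) * (2 * ps (ps e))) (posc (nthc c 3) * (2 * ps (ps e))) then 1 else 0)
     else if nthc c 0 = 2 then
       (if cmpc (nthc c 3) (clkc e (nthc c 1) + negc (nthc c 4) * (2 * ps (ps e)))
          (clkc e (nthc c 2) + posc (nthc c 4) * (2 * ps (ps e))) then 1 else 0)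
     else if nthc c 0 = 3 then 1 - lookc h c 1
     else if nthc c 0 = 4 then lookc h c 1 * lookc h c 2
     else (if lookc h c 1 + lookc h c 2 = 0 then 0 else 1))"

definition satc :: "nat \<Rightarrow> nat \<Rightarrow> nat" where "satc e c = cov satG e c"

lemma comp_clkc [comp_intros]: "computable f \<Longrightarrow> computable g \<Longrightarrow> computable (\<lambda>e. clkc (f e) (g e))"
  unfolding clkc_def by (intro comp_intros)

lemma comp_satc [comp_intros]: "computable f \<Longrightarrow> computable g \<Longrightarrow> computable (\<lambda>e. satc (f e) (g e))"
  unfolding satc_def by (rule comp_cov) (unfold satG_def, intro comp_intros)

lemma enc_cc_pos: "0 < enc_cc \<phi>"
  by (cases \<phi>) auto

lemma satc_sat:
  assumes D: "0 < D"
  shows "satc (pr u (pr j D)) (enc_cc \<phi>) = (if sat \<phi> (delay (gv D u) (real j / real (2 * D))) then 1 else 0)"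
proof (induction \<phi>)
  case CTrue
  then show ?case by (simp add: satc_def cov_def satG_def nthc_encode del: list_encode.simps)
next
  case (CAtom x c z)
  have "delay (gv D u) (real j / real (2 * D)) x = real (2 * nthc u x + j) / real (2 * D) - real 0 / real (2 * D)"
    using D by (simp add: delay_def gv_def add_divide_distrib)
  then show ?case using cmpc_scaled[OF D refl, of c "2 * nthc u x + j" z 0]
    by (simp add: satc_def cov_def satG_def nthc_encode clkc_def del: list_encode.simps)
next
  case (CDiff x y c z)
  have "delay (gv D u) (real j / real (2 * D)) x = real (2 * nthc u x + j) / real (2 * D)" for x
    using D by (simp add: delay_def gv_def add_divide_distrib)
  then show ?case using cmpc_scaled[OF D refl, of c "2 * nthc u x + j" z "2 * nthc u y + j"]
    by (simp add: satc_def cov_def satG_def nthc_encode clkc_def del: list_encode.simps)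
next
  case (CNot \<phi>)
  then show ?case using lookc_hist[OF enc_cc_pos[of "CNot \<phi>"], of satG "pr u (pr j D)" 1]
    by (simp add: satc_def cov_def[of satG _ "list_encode _"] satG_def[of _ "list_encode _"] nthc_encode del: list_encode.simps)
next
  case (CAnd \<phi> \<psi>)
  then show ?case using lookc_hist[OF enc_cc_pos[of "CAnd \<phi> \<psi>"], of satG "pr u (pr j D)" 1]
    lookc_hist[OF enc_cc_pos[of "CAnd \<phi> \<psi>"], of satG "pr u (pr j D)" 2]
    by (simp add: satc_def cov_def[of satG _ "list_encode _"] satG_def[of _ "list_encode _"] nthc_encode del: list_encode.simps)
next
  case (COr \<phi> \<psi>)
  then show ?case using lookc_hist[OF enc_cc_pos[of "COr \<phi> \<psi>"], of satG "pr u (pr j D)" 1]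
    lookc_hist[OF enc_cc_pos[of "COr \<phi> \<psi>"], of satG "pr u (pr j D)" 2]
    by (simp add: satc_def cov_def[of satG _ "list_encode _"] satG_def[of _ "list_encode _"] nthc_encode del: list_encode.simps)
qed

lemma abs_le_int_encode: "\<bar>z\<bar> \<le> int (int_encode z)"
  by (auto simp: int_encode_def sum_encode_def)

text \<open>A code exceeds all clocks and constants written in it, so the code of an instance can
  bound both.\<close>

lemma cc_over_enc: "enc_cc \<phi> \<le> N \<Longrightarrow> cc_over {0..<N} N \<phi>"
proof (induction \<phi>)
  case (CAtom x c z)
  have "x < enc_cc (CAtom x c z)" "int_encode z < enc_cc (CAtom x c z)"
    unfolding enc_cc.simps by (rule list_encode_nth_less, simp)+
  then show ?case using CAtom abs_le_int_encode[of z] by auto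
next
  case (CDiff x y c z)
  have "x < enc_cc (CDiff x y c z)" "y < enc_cc (CDiff x y c z)" "int_encode z < enc_cc (CDiff x y c z)"
    unfolding enc_cc.simps by (rule list_encode_nth_less, simp)+
  then show ?case using CDiff abs_le_int_encode[of z] by auto
next
  case (CNot \<phi>)
  have "enc_cc \<phi> < enc_cc (CNot \<phi>)" unfolding enc_cc.simps by (rule list_encode_nth_less) simp
  then show ?case using CNot by simp
next
  case (CAnd \<phi> \<psi>)
  have "enc_cc \<phi> < enc_cc (CAnd \<phi> \<psi>)" "enc_cc \<psi> < enc_cc (CAnd \<phi> \<psi>)"
    unfolding enc_cc.simps by (rule list_encode_nth_less, simp)+
  then show ?case using CAnd by simp
next
  case (COr \<phi> \<psi>)
  have "enc_cc \<phi> < enc_cc (COr \<phi> \<psi>)" "enc_cc \<psi> < enc_cc (COr \<phi> \<psi>)"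
    unfolding enc_cc.simps by (rule list_encode_nth_less, simp)+
  then show ?case using COr by simp
qed simp

subsection \<open>Valid codes\<close>

text \<open>The set to be decided consists of codes only, so numbers that code no guard must be
  recognised; arities and the five comparison tags are checked.\<close>

definition validG :: "nat \<Rightarrow> nat \<Rightarrow> nat \<Rightarrow> nat" where
  "validG e c h = (if
     lenc c = 1 \<and> nthc c 0 = 0 \<or>
     lenc c = 4 \<and> nthc c 0 = 1 \<and> nthc c 2 < 5 \<or>
     lenc c = 5 \<and> nthc c 0 = 2 \<and> nthc c 3 < 5 \<or>
     lenc c = 2 \<and> nthc c 0 = 3 \<and> lookc h c 1 = 1 \<or>
     lenc c = 3 \<and> (nthc c 0 = 4 \<or> nthc c 0 = 5) \<and> lookc h c 1 = 1 \<and> lookc h c 2 = 1 then 1 else 0)"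

definition cc_valid :: "nat \<Rightarrow> bool" where "cc_valid c \<longleftrightarrow> cov validG 0 c = 1"

lemma dec_cc_valid [comp_intros]: assumes "computable f" shows "decidable (\<lambda>e. cc_valid (f e))"
proof -
  have "computable (\<lambda>e. cov validG 0 (f e))"
    by (rule comp_cov[OF _ comp_const assms]) (unfold validG_def, intro comp_intros)
  then show ?thesis unfolding cc_valid_def by (intro comp_intros)
qed

lemma cc_valid_unfold: "cc_valid c \<longleftrightarrow>
     lenc c = 1 \<and> nthc c 0 = 0 \<or>
     lenc c = 4 \<and> nthc c 0 = 1 \<and> nthc c 2 < 5 \<or>
     lenc c = 5 \<and> nthc c 0 = 2 \<and> nthc c 3 < 5 \<or>
     lenc c = 2 \<and> nthc c 0 = 3 \<and> cc_valid (nthc c 1) \<or>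
     lenc c = 3 \<and> (nthc c 0 = 4 \<or> nthc c 0 = 5) \<and> cc_valid (nthc c 1) \<and> cc_valid (nthc c 2)"
proof (cases "c = 0")
  case True
  then show ?thesis by (simp add: cc_valid_def cov_def validG_def lenc_def)
next
  case False
  then show ?thesis using lookc_hist[of c validG 0]
    by (simp add: cc_valid_def cov_def[of validG _ c] validG_def[of _ c])
qed

lemma enc_cmp_surj: "c < 5 \<Longrightarrow> \<exists>r. enc_cmp r = c"
proof -
  assume "c < 5"
  then consider "c = 0" | "c = 1" | "c = 2" | "c = 3" | "c = 4" by linarith
  then show ?thesis using enc_cmp.simps by cases metis+
qed

lemma code_eq_list:
  assumes "lenc c = l" shows "c = list_encode (map (nthc c) [0..<l])"
proof -
  have "map (nthc c) [0..<l] = list_decode c"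
    by (rule nth_equalityI) (use assms nthc_encode[of "list_decode c"] in \<open>auto simp: lenc_def\<close>)
  then show ?thesis by simp
qed

lemma cc_valid_enc: "cc_valid (enc_cc \<phi>)"
proof (induction \<phi>)
  case (CAtom x c z)
  then show ?case by (subst cc_valid_unfold) (cases c; simp add: nthc_encode del: list_encode.simps)
next
  case (CDiff x y c z)
  then show ?case by (subst cc_valid_unfold) (cases c; simp add: nthc_encode del: list_encode.simps)
qed (subst cc_valid_unfold, simp add: nthc_encode del: list_encode.simps)+

lemma cc_valid_exists: "cc_valid c \<Longrightarrow> \<exists>\<phi>. enc_cc \<phi> = c"
proof (induction c rule: less_induct)
  case (less c)
  have pos: "0 < c" using less.prems by (subst (asm) cc_valid_unfold) (auto simp: lenc_def intro: gr0I)
  note v = less.prems[unfolded cc_valid_unfold[of c]]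
  have sub: "\<exists>\<phi>. enc_cc \<phi> = nthc c i" if "cc_valid (nthc c i)" for i
    using less.IH[OF nthc_less[OF pos] that] .
  have three: "\<exists>\<phi> \<psi>. c = list_encode [nthc c 0, enc_cc \<phi>, enc_cc \<psi>]"
    if a: "lenc c = 3" "cc_valid (nthc c 1)" "cc_valid (nthc c 2)"
  proof -
    have "c = list_encode [nthc c 0, nthc c 1, nthc c 2]"
      using code_eq_list[OF a(1)] by (simp add: upt_rec numeral_eq_Suc del: list_encode.simps)
    then show ?thesis using sub[OF a(2)] sub[OF a(3)] by metis
  qed
  from v show ?case
  proof (elim disjE conjE)
    assume a: "lenc c = 1" "nthc c 0 = 0"
    have "c = enc_cc CTrue" using code_eq_list[OF a(1)] a(2) by simp
    then show ?thesis by metis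
  next
    assume a: "lenc c = 4" "nthc c 0 = 1" "nthc c 2 < 5"
    obtain r where r: "enc_cmp r = nthc c 2" using enc_cmp_surj[OF a(3)] by blast
    have "c = list_encode [nthc c 0, nthc c 1, nthc c 2, nthc c 3]"
      using code_eq_list[OF a(1)] by (simp add: upt_rec numeral_eq_Suc del: list_encode.simps)
    then have "enc_cc (CAtom (nthc c 1) r (int_decode (nthc c 3))) = c" using a(2) r by simp
    then show ?thesis by blast
  next
    assume a: "lenc c = 5" "nthc c 0 = 2" "nthc c 3 < 5"
    obtain r where r: "enc_cmp r = nthc c 3" using enc_cmp_surj[OF a(3)] by blast
    have "c = list_encode [nthc c 0, nthc c 1, nthc c 2, nthc c 3, nthc c 4]"
      using code_eq_list[OF a(1)] by (simp add: upt_rec numeral_eq_Suc del: list_encode.simps)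
    then have "enc_cc (CDiff (nthc c 1) (nthc c 2) r (int_decode (nthc c 4))) = c" using a(2) r by simp
    then show ?thesis by blast
  next
    assume a: "lenc c = 2" "nthc c 0 = 3" "cc_valid (nthc c 1)"
    obtain \<phi> where \<phi>: "enc_cc \<phi> = nthc c 1" using sub[OF a(3)] by blast
    have "c = list_encode [nthc c 0, nthc c 1]"
      using code_eq_list[OF a(1)] by (simp add: upt_rec numeral_eq_Suc del: list_encode.simps)
    then have "enc_cc (CNot \<phi>) = c" using a(2) \<phi> by simp
    then show ?thesis by blast
  next
    assume a: "lenc c = 3" "nthc c 0 = 4" "cc_valid (nthc c 1)" "cc_valid (nthc c 2)"
    from three[OF a(1,3,4)] obtain \<phi> \<psi> where "c = list_encode [nthc c 0, enc_cc \<phi>, enc_cc \<psi>]" by blast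
    then have "enc_cc (CAnd \<phi> \<psi>) = c" using a(2) by simp
    then show ?thesis by blast
  next
    assume a: "lenc c = 3" "nthc c 0 = 5" "cc_valid (nthc c 1)" "cc_valid (nthc c 2)"
    from three[OF a(1,3,4)] obtain \<phi> \<psi> where "c = list_encode [nthc c 0, enc_cc \<phi>, enc_cc \<psi>]" by blast
    then have "enc_cc (COr \<phi> \<psi>) = c" using a(2) by simp
    then show ?thesis by blast
  qed
qed

text \<open>Lists of naturals, letters and integers are coded onto the naturals, so invalid numbers
  can only come from wrong lengths or wrong guards.\<close>

definition instance_valid :: "nat \<Rightarrow> bool" where
  "instance_valid n \<longleftrightarrow> lenc n = 6 \<and>
    (\<forall>i<lenc (nthc n 5). lenc (nthc (nthc n 5) i) = 5 \<and> cc_valid (nthc (nthc (nthc n 5) i) 2))"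

lemma enc_letter_surj: "\<exists>\<sigma>. enc_letter \<sigma> = c"
proof (cases c)
  case 0
  then show ?thesis using enc_letter.simps(1) by metis
next
  case (Suc x)
  obtain a b where "prod_decode x = (a, b)" by fastforce
  then have "prod_encode (a, b) = x" by (metis prod_decode_inverse)
  then have "enc_letter (Some (a, b)) = c" using Suc by simp
  then show ?thesis by blast
qed

lemma enc_letter_eq [simp]: "enc_letter \<sigma> = enc_letter \<sigma>' \<longleftrightarrow> \<sigma> = \<sigma>'"
  by (cases \<sigma> rule: enc_letter.cases; cases \<sigma>' rule: enc_letter.cases) auto

lemma instance_valid_iff: "instance_valid n \<longleftrightarrow> (\<exists>I. enc_instance I = n)"
proof
  assume v: "instance_valid n"
  have "\<exists>r. enc_rule r = c" if c: "c \<in> set (list_decode (nthc n 5))" for c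
  proof -
    obtain i where i: "i < lenc (nthc n 5)" "c = nthc (nthc n 5) i"
      using c nthc_encode[of "list_decode (nthc n 5)"] by (auto simp: in_set_conv_nth lenc_def)
    have c: "lenc c = 5" "cc_valid (nthc c 2)" using v i by (auto simp: instance_valid_def)
    obtain \<sigma> \<phi> where "enc_letter \<sigma> = nthc c 1" "enc_cc \<phi> = nthc c 2"
      using enc_letter_surj cc_valid_exists[OF c(2)] by blast
    moreover have "c = list_encode [nthc c 0, nthc c 1, nthc c 2, nthc c 3, nthc c 4]"
      using code_eq_list[OF c(1)] by (simp add: upt_rec numeral_eq_Suc del: list_encode.simps)
    ultimately have "enc_rule (nthc c 0, \<sigma>, \<phi>, list_decode (nthc c 3), nthc c 4) = c" by simp
    then show ?thesis by blast
  qed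
  then have "\<forall>c\<in>set (list_decode (nthc n 5)). \<exists>r. enc_rule r = c" by blast
  from bchoice[OF this] obtain g where g: "\<And>c. c \<in> set (list_decode (nthc n 5)) \<Longrightarrow> enc_rule (g c) = c" by blast
  define T where "T = \<lparr>ta_clocks = nthc n 2, ta_init = list_decode (nthc n 3), ta_final = list_decode (nthc n 4),
    ta_rules = map g (list_decode (nthc n 5))\<rparr>"
  have "map enc_rule (ta_rules T) = list_decode (nthc n 5)"
    unfolding T_def using g by (simp add: map_idI)
  moreover have "n = list_encode [nthc n 0, nthc n 1, nthc n 2, nthc n 3, nthc n 4, nthc n 5]"
    using code_eq_list[of n 6] v by (simp add: instance_valid_def upt_rec numeral_eq_Suc del: list_encode.simps)
  ultimately have "enc_instance (nthc n 0, nthc n 1, T) = n"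
    by (simp add: T_def del: list_encode.simps)
  then show "\<exists>I. enc_instance I = n" by blast
next
  assume "\<exists>I. enc_instance I = n"
  then obtain na nb T where "n = enc_instance (na, nb, T)" by (metis prod_cases3)
  moreover have "lenc (enc_rule r) = 5 \<and> cc_valid (nthc (enc_rule r) 2)" for r
    by (cases r) (simp add: nthc_encode cc_valid_enc del: list_encode.simps)
  ultimately show "instance_valid n"
    by (simp add: instance_valid_def nthc_encode del: list_encode.simps)
qed

subsection \<open>Deciding the existence of budgets\<close>

definition memc :: "nat \<Rightarrow> nat \<Rightarrow> bool" where "memc x c \<longleftrightarrow> (\<exists>i<lenc c. nthc c i = x)"

lemma memc_encode [simp]: "memc x (list_encode xs) \<longleftrightarrow> x \<in> set xs"
  by (auto simp: memc_def nthc_encode in_set_conv_nth)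

lemma bex_code:
  "(\<exists>r<lenc (list_encode (map g xs)). P (nthc (list_encode (map g xs)) r)) \<longleftrightarrow> (\<exists>x\<in>set xs. P (g x))"
proof -
  have "(\<exists>r<length xs. P (nthc (list_encode (map g xs)) r)) \<longleftrightarrow> (\<exists>r<length xs. P (g (xs ! r)))"
    by (rule ex_cong1) (simp add: nthc_encode cong: conj_cong)
  then show ?thesis by (auto simp: set_conv_nth)
qed

lemma dec_memc [comp_intros]:
  assumes "computable f" "computable g" shows "decidable (\<lambda>e. memc (f e) (g e))"
  by (rule dec2[OF _ assms]) (unfold memc_def, intro comp_intros)

lemma comp_stc [comp_intros]:
  "computable f \<Longrightarrow> computable g \<Longrightarrow> computable h \<Longrightarrow> computable (\<lambda>e. stc (f e) (g e) (h e))"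
  unfolding stc_def by (intro comp_intros)

definition rule_step :: "nat \<Rightarrow> nat \<Rightarrow> nat \<Rightarrow> nat \<Rightarrow> nat \<Rightarrow> nat \<Rightarrow> nat \<Rightarrow> nat \<Rightarrow> nat \<Rightarrow> nat \<Rightarrow> nat \<Rightarrow> bool" where
  "rule_step k m n rl c p u j Y p' u' \<longleftrightarrow>
    nthc rl 0 = p \<and> nthc rl 1 = c \<and> nthc rl 4 = p' \<and> (\<forall>i<lenc (nthc rl 3). nthc (nthc rl 3) i < nthc n 2) \<and>
    (\<forall>x<n. x \<in> set_decode Y \<longleftrightarrow> memc x (nthc rl 3)) \<and>
    satc (pr u (pr j (Suc (n + k)))) (nthc rl 2) = 1 \<and> geq (n + k) (n + m) (Suc (n + k)) u j Y u'"

definition gstepc :: "nat \<Rightarrow> nat \<Rightarrow> nat \<Rightarrow> nat \<Rightarrow> nat \<Rightarrow> nat \<Rightarrow> nat \<Rightarrow> nat \<Rightarrow> nat \<Rightarrow> nat \<Rightarrow> bool" where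
  "gstepc k m n c p u j Y p' u' \<longleftrightarrow>
    (\<exists>r<lenc (nthc n 5). rule_step k m n (nthc (nthc n 5) r) c p u j Y p' u')"

lemma dec8:
  assumes "decidable (\<lambda>e. g (pf e) (pf (ps e)) (pf (ps (ps e))) (pf (ps (ps (ps e)))) (pf (ps (ps (ps (ps e)))))
      (pf (ps (ps (ps (ps (ps e)))))) (pf (ps (ps (ps (ps (ps (ps e)))))))  (ps (ps (ps (ps (ps (ps (ps e))))))))"
    "computable f1" "computable f2" "computable f3" "computable f4" "computable f5" "computable f6" "computable f7" "computable f8"
  shows "decidable (\<lambda>e. g (f1 e) (f2 e) (f3 e) (f4 e) (f5 e) (f6 e) (f7 e) (f8 e))"
  using dec_compose[OF assms(1) comp_pr[OF assms(2) comp_pr[OF assms(3) comp_pr[OF assms(4) comp_pr[OF assms(5)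
    comp_pr[OF assms(6) comp_pr[OF assms(7) comp_pr[OF assms(8,9)]]]]]]]] by simp

lemma dec_gstepc [comp_intros]:
  assumes "computable f1" "computable f2" "computable f3" "computable f4" "computable f5" "computable f6" "computable f7" "computable f8"
  shows "decidable (\<lambda>e. gstepc k m (f1 e) (f2 e) (f3 e) (f4 e) (f5 e) (f6 e) (f7 e) (f8 e))"
  by (rule dec8[OF _ assms]) (unfold gstepc_def rule_step_def, intro comp_intros)

text \<open>\<open>budget_family\<close> for the list of budget tables coded by \<open>W\<close>,
  with every quantifier bounded and every edge spelled out on codes.\<close>

definition check :: "nat \<Rightarrow> nat \<Rightarrow> nat \<Rightarrow> nat \<Rightarrow> nat \<Rightarrow> bool" where
  "check k m n U W \<longleftrightarrow>
    (\<exists>i<lenc W. \<forall>p<n. memc p (nthc n 3) \<longrightarrow> 0 < nthc (nthc W i) (stc p 0 0)) \<and>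
    (\<forall>i<lenc W. \<forall>p<n. \<forall>f<2. \<forall>u<U. \<forall>p'<n. \<forall>f'<2. \<forall>u'<U.
      f' = (if memc p' (nthc n 4) then 1 else f) \<and>
      (\<exists>j\<le>2 * (n + m) * Suc (n + k) + 1. \<exists>Y<2 ^ (n + k). gstepc k m n 0 p u j Y p' u' \<and> (\<forall>x<k. n + x \<notin> set_decode Y)) \<longrightarrow>
      0 < nthc (nthc W i) (stc p f u) \<longrightarrow>
      0 < nthc (nthc W i) (stc p' f' u') \<and> nthc (nthc W i) (stc p' f' u') \<le> nthc (nthc W i) (stc p f u)) \<and>
    (\<forall>i<lenc W. \<forall>a<nthc n 0. \<forall>r<U. \<exists>b<nthc n 1. \<exists>Y'<2 ^ k. \<exists>i'<lenc W.
      \<forall>p<n. \<forall>f<2. \<forall>u<U. \<forall>p'<n. \<forall>f'<2. \<forall>u'<U.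
      f' = (if memc p' (nthc n 4) then 1 else 0) \<and>
      (\<exists>j\<le>2 * (n + m) * Suc (n + k) + 1. \<exists>Y<2 ^ (n + k). gstepc k m n (Suc (pr a b)) p u j Y p' u' \<and>
        (\<forall>x<k. n + x \<in> set_decode Y \<longleftrightarrow> x \<in> set_decode Y') \<and> rgeq n k m (Suc (n + k)) u j r) \<longrightarrow>
      0 < nthc (nthc W i) (stc p f u) \<longrightarrow>
      0 < nthc (nthc W i') (stc p' f' u') \<and>
      nthc (nthc W i') (stc p' f' u') + (if f = 1 then 1 else 0) \<le> nthc (nthc W i) (stc p f u))"

lemma dec_check [comp_intros]:
  assumes "computable f1" "computable f2" "computable f3"
  shows "decidable (\<lambda>e. check k m (f1 e) (f2 e) (f3 e))"
  by (rule dec3[OF _ assms]) (unfold check_def, intro comp_intros)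

lemma instance_game_enc:
  assumes n: "n = enc_instance (na, nb, T)" and closed: "grid_closed (n + k) (n + m) (Suc (n + k)) U"
  shows "instance_game k m T n U"
proof
  have less: "x < n" if "x \<in> set [na, nb, ta_clocks T, list_encode (ta_init T), list_encode (ta_final T),
      list_encode (map enc_rule (ta_rules T))]" for x
    unfolding n enc_instance.simps using that by (rule list_encode_nth_less)
  show "ta_clocks T \<le> n" using less[of "ta_clocks T"] by simp
  show "p < n" if "p \<in> set (ta_init T)" for p
    using list_encode_nth_less[OF that] less[of "list_encode (ta_init T)"] by simp
  show "grid_closed (n + k) (n + m) (Suc (n + k)) U" by (rule closed)
  fix p \<sigma> \<phi> Y q assume r: "(p, \<sigma>, \<phi>, Y, q) \<in> set (ta_rules T)"
  have "enc_rule (p, \<sigma>, \<phi>, Y, q) < list_encode (map enc_rule (ta_rules T))"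
    by (rule list_encode_nth_less) (use r in force)
  also have "\<dots> < n" by (rule less) simp
  finally have rn: "enc_rule (p, \<sigma>, \<phi>, Y, q) < n" .
  have "x < enc_rule (p, \<sigma>, \<phi>, Y, q)" if "x \<in> set [p, enc_letter \<sigma>, enc_cc \<phi>, list_encode Y, q]" for x
    unfolding enc_rule.simps using that by (rule list_encode_nth_less)
  from this[of p] this[of q] this[of "enc_cc \<phi>"] rn have "p < n" "q < n" "enc_cc \<phi> \<le> n" by simp_all
  then show "p < n \<and> q < n \<and> cc_over {0..<n} n \<phi>" using cc_over_enc by blast
qed

context instance_game
begin

lemma gstepc_iff:
  assumes n: "n = enc_instance (na, nb, T)"
  shows "gstepc k m n (enc_letter \<sigma>) p u j Y p' u' \<longleftrightarrow> gstep \<sigma> p u j Y p' u'"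
proof -
  have n5: "nthc n 5 = list_encode (map enc_rule (ta_rules T))" and n2: "nthc n 2 = ta_clocks T"
    by (simp_all add: n nthc_encode del: list_encode.simps)
  have st: "rule_step k m n (enc_rule (p0, \<sigma>0, \<phi>, Yl, q0)) (enc_letter \<sigma>) p u j Y p' u' \<longleftrightarrow>
    p0 = p \<and> \<sigma>0 = \<sigma> \<and> q0 = p' \<and> set Yl \<subseteq> {0..<ta_clocks T} \<and>
    (\<forall>x<n. x \<in> set_decode Y \<longleftrightarrow> x \<in> set Yl) \<and> sat \<phi> (gdelay u j) \<and> geq C M D u j Y u'" for p0 \<sigma>0 \<phi> Yl q0
  proof -
    have "(\<forall>i<length Yl. nthc (list_encode Yl) i < ta_clocks T) \<longleftrightarrow> set Yl \<subseteq> {0..<ta_clocks T}"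
      by (auto simp: nthc_encode in_set_conv_nth subset_iff)
    moreover have "satc (pr u (pr j D)) (enc_cc \<phi>) = 1 \<longleftrightarrow> sat \<phi> (gdelay u j)"
      by (simp add: satc_sat[OF D_pos] gdelay_def)
    ultimately show ?thesis
      unfolding rule_step_def enc_rule.simps n2 by (simp add: nthc_encode C_def M_def D_def del: list_encode.simps)
  qed
  have "gstepc k m n (enc_letter \<sigma>) p u j Y p' u' \<longleftrightarrow>
    (\<exists>r\<in>set (ta_rules T). rule_step k m n (enc_rule r) (enc_letter \<sigma>) p u j Y p' u')"
    unfolding gstepc_def n5 by (rule bex_code)
  also have "\<dots> \<longleftrightarrow> gstep \<sigma> p u j Y p' u'"
  proof
    assume "\<exists>r\<in>set (ta_rules T). rule_step k m n (enc_rule r) (enc_letter \<sigma>) p u j Y p' u'"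
    then obtain p0 \<sigma>0 \<phi> Yl q0 where "(p0, \<sigma>0, \<phi>, Yl, q0) \<in> set (ta_rules T)"
      "rule_step k m n (enc_rule (p0, \<sigma>0, \<phi>, Yl, q0)) (enc_letter \<sigma>) p u j Y p' u'" by (metis prod_cases5)
    then show "gstep \<sigma> p u j Y p' u'" unfolding st gstep_def by blast
  next
    assume "gstep \<sigma> p u j Y p' u'"
    then obtain \<phi> Yl where r: "(p, \<sigma>, \<phi>, Yl, p') \<in> set (ta_rules T)"
      "set Yl \<subseteq> {0..<ta_clocks T} \<and> (\<forall>x<n. x \<in> set_decode Y \<longleftrightarrow> x \<in> set Yl) \<and> sat \<phi> (gdelay u j) \<and> geq C M D u j Y u'"
      unfolding gstep_def by blast
    then have "rule_step k m n (enc_rule (p, \<sigma>, \<phi>, Yl, p')) (enc_letter \<sigma>) p u j Y p' u'" unfolding st by blast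
    then show "\<exists>r\<in>set (ta_rules T). rule_step k m n (enc_rule r) (enc_letter \<sigma>) p u j Y p' u'" using r(1) by blast
  qed
  finally show ?thesis .
qed

lemma ball_E0: "(\<forall>(s, s')\<in>E0. P s s') \<longleftrightarrow>
  (\<forall>p<n. \<forall>f<2. \<forall>u<U. \<forall>p'<n. \<forall>f'<2. \<forall>u'<U. eps p f u p' f' u' \<longrightarrow> P (stc p f u) (stc p' f' u'))"
  unfolding E0_def by fast

lemma ball_E1: "(\<forall>(s, c, s')\<in>E1 x y. P s c s') \<longleftrightarrow>
  (\<forall>p<n. \<forall>f<2. \<forall>u<U. \<forall>p'<n. \<forall>f'<2. \<forall>u'<U. let_edge (fst x) (snd x) (fst y) (snd y) p u p' f' u' \<longrightarrow>
    P (stc p f u) (f = 1) (stc p' f' u'))"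
  unfolding E1_def by fast

lemma check_iff:
  assumes n: "n = enc_instance (na, nb, T)"
  shows "check k m n U W \<longleftrightarrow> budget_family E0 E1 Init (Xs na) (Ys nb) ((\<lambda>i. nthc (nthc W i)) ` {..<lenc W})"
proof -
  have n0: "nthc n 0 = na" "nthc n 1 = nb" "nthc n 3 = list_encode (ta_init T)" "nthc n 4 = list_encode (ta_final T)"
    by (simp_all add: n nthc_encode del: list_encode.simps)
  have none: "gstepc k m n 0 p u j Y p' u' \<longleftrightarrow> gstep None p u j Y p' u'" for p u j Y p' u'
    using gstepc_iff[OF n, of None] by simp
  have some: "gstepc k m n (Suc (pr a b)) p u j Y p' u' \<longleftrightarrow> gstep (Some (a, b)) p u j Y p' u'" for a b p u j Y p' u'
    using gstepc_iff[OF n, of "Some (a, b)"] by (simp add: pr_def)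
  have eps': "f' = (if memc p' (nthc n 4) then 1 else f) \<and>
      (\<exists>j\<le>2 * (n + m) * Suc (n + k) + 1. \<exists>Y<2 ^ (n + k). gstepc k m n 0 p u j Y p' u' \<and> (\<forall>x<k. n + x \<notin> set_decode Y)) \<longleftrightarrow>
      eps p f u p' f' u'" for p f u p' f' u'
    unfolding eps_def none n0 memc_encode J_def C_def M_def D_def ..
  have let': "f' = (if memc p' (nthc n 4) then 1 else 0) \<and>
      (\<exists>j\<le>2 * (n + m) * Suc (n + k) + 1. \<exists>Y<2 ^ (n + k). gstepc k m n (Suc (pr a b)) p u j Y p' u' \<and>
        (\<forall>x<k. n + x \<in> set_decode Y \<longleftrightarrow> x \<in> set_decode Y') \<and> rgeq n k m (Suc (n + k)) u j r) \<longleftrightarrow>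
      let_edge a r b Y' p u p' f' u'" for a r b Y' p u p' f' u'
    unfolding let_edge_def some n0 memc_encode J_def C_def M_def D_def ..
  have X: "(\<forall>x\<in>Xs na. P x) \<longleftrightarrow> (\<forall>a<na. \<forall>r<U. P (a, r))" for P by (auto simp: Xs_def)
  have Y: "(\<exists>y\<in>Ys nb. P y) \<longleftrightarrow> (\<exists>b<nb. \<exists>Y<2 ^ k. P (b, Y))" for P by (auto simp: Ys_def)
  have I: "(\<forall>s\<in>Init. P s) \<longleftrightarrow> (\<forall>p<n. p \<in> set (ta_init T) \<longrightarrow> P (stc p 0 0))" for P by (auto simp: Init_def)
  have lt: "(\<forall>i\<in>{..<N}. P i) \<longleftrightarrow> (\<forall>i<N. P i)" "(\<exists>i\<in>{..<N}. P i) \<longleftrightarrow> (\<exists>i<N. P i)" for N :: nat and P by auto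
  have img: "(\<forall>x\<in>g ` A. P x) \<longleftrightarrow> (\<forall>i\<in>A. P (g i))" "(\<exists>x\<in>g ` A. P x) \<longleftrightarrow> (\<exists>i\<in>A. P (g i))"
    for g :: "nat \<Rightarrow> nat \<Rightarrow> nat" and A P by auto
  show ?thesis
    \<comment> \<open>The edge conditions are folded back into \<open>eps\<close> and
      \<open>let_edge\<close> first, before unfolding \<open>n0\<close> and
      \<open>memc_encode\<close> would destroy their shape.\<close>
    unfolding check_def unfolding eps' let'
    unfolding budget_family_def ball_E0 ball_E1 X Y I img lt n0 memc_encode fst_conv snd_conv of_bool_def ..
qed

end

text \<open>The code of a list of maximal length whose tables are all full, of length
  \<open>Suc (stc n 2 U) = card Q\<close>, and filled with the largest budget; by
  \<open>list_encode_mono\<close> it bounds the codes of all families to be searched.\<close>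

definition mem_bound :: "nat \<Rightarrow> nat \<Rightarrow> nat" where
  "mem_bound n U = list_encode (replicate (memory_bound (Suc (stc n 2 U)))
    (list_encode (replicate (Suc (stc n 2 U)) (Suc (memory_bound (Suc (stc n 2 U)) * Suc (stc n 2 U))))))"

lemma comp_mem_bound [comp_intros]:
  "computable f \<Longrightarrow> computable g \<Longrightarrow> computable (\<lambda>e. mem_bound (f e) (g e))"
  unfolding mem_bound_def memory_bound_def by (intro comp_intros)

text \<open>Budgets become finite tables by cutting them off outside \<open>Q\<close>; this keeps
  the conditions, since all edges and initial vertices lie inside \<open>Q\<close>.\<close>

lemma has_winning_controller_iff_check:
  assumes n: "n = enc_instance (na, nb, T)" and closed: "grid_closed (n + k) (n + m) (Suc (n + k)) U"
  shows "has_winning_controller k m (na, nb, T) \<longleftrightarrow> (\<exists>W\<le>mem_bound n U. check k m n U W)"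
proof -
  interpret instance_game k m T n U by (rule instance_game_enc[OF n closed])
  show ?thesis
  proof
    assume "\<exists>W\<le>mem_bound n U. check k m n U W"
    then show "has_winning_controller k m (na, nb, T)"
      using check_iff[OF n] controller_of_budgets by blast
  next
    assume "has_winning_controller k m (na, nb, T)"
    then obtain F where F: "finite F" "card F \<le> memory_bound (card Q)"
      "\<And>\<beta> s. \<beta> \<in> F \<Longrightarrow> \<beta> s \<le> Suc (memory_bound (card Q) * card Q)" "budget_family E0 E1 Init (Xs na) (Ys nb) F"
      using budgets_of_controller by blast
    obtain ws where ws: "set ws = F" "distinct ws" using finite_distinct_list[OF F(1)] by blast
    have len: "length ws = card F" using distinct_card[OF ws(2)] ws(1) by simp
    define q where "q = Suc (stc n 2 U)"
    have cq: "card Q = q" by (simp add: Q_def q_def)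
    define W where "W = list_encode (map (\<lambda>\<beta>. list_encode (map \<beta> [0..<q])) ws)"
    have lW: "lenc W = length ws" by (simp add: W_def)
    have nW: "nthc (nthc W i) = (\<lambda>s. if s < q then (ws ! i) s else 0)" if "i < length ws" for i
      using that by (auto simp: W_def nthc_encode)
    define h where "h \<beta> = (\<lambda>s. if s < q then \<beta> s else 0)" for \<beta> :: "nat \<Rightarrow> nat"
    have "(\<lambda>i. nthc (nthc W i)) ` {..<lenc W} = h ` F"
    proof -
      have "(\<lambda>i. nthc (nthc W i)) ` {..<lenc W} = (\<lambda>i. h (ws ! i)) ` {..<length ws}"
        unfolding lW h_def by (rule image_cong[OF refl]) (simp add: nW)
      also have "\<dots> = h ` (\<lambda>i. ws ! i) ` {..<length ws}" by (simp only: image_image)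
      also have "(\<lambda>i. ws ! i) ` {..<length ws} = F" using ws(1) by (auto simp: set_conv_nth)
      finally show ?thesis .
    qed
    moreover have "budget_family E0 E1 Init (Xs na) (Ys nb) (h ` F)"
    proof -
      have hQ: "h \<beta> s = \<beta> s" if "s \<in> Q" for \<beta> s using that by (simp add: h_def Q_def q_def)
      have e0: "h \<beta> (fst e) = \<beta> (fst e)" "h \<beta> (snd e) = \<beta> (snd e)" if "e \<in> E0" for \<beta> e
        using subsetD[OF E0_Q that] by (auto intro: hQ)
      have e1: "h \<beta> (fst e) = \<beta> (fst e)" "h \<beta> (snd (snd e)) = \<beta> (snd (snd e))" if "e \<in> E1 x y" for \<beta> e x y
        using subsetD[OF E1_Q that] by (auto intro: hQ)
      have i0: "h \<beta> s = \<beta> s" if "s \<in> Init" for \<beta> s using subsetD[OF Init_Q that] by (rule hQ)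
      have img: "(\<forall>x\<in>h ` A. P x) \<longleftrightarrow> (\<forall>i\<in>A. P (h i))" "(\<exists>x\<in>h ` A. P x) \<longleftrightarrow> (\<exists>i\<in>A. P (h i))" for A P by auto
      have "budget_family E0 E1 Init (Xs na) (Ys nb) (h ` F) = budget_family E0 E1 Init (Xs na) (Ys nb) F"
        unfolding budget_family_def split_beta img by (simp only: e0 e1 i0 cong: ball_cong bex_cong)
      then show ?thesis using F(4) by simp
    qed
    ultimately have "check k m n U W" using check_iff[OF n] by simp
    moreover have "W \<le> mem_bound n U"
      unfolding W_def mem_bound_def q_def[symmetric]
    proof (rule list_encode_mono)
      show "length (map (\<lambda>\<beta>. list_encode (map \<beta> [0..<q])) ws) \<le> memory_bound q" using F(2) len cq by simp
      have "list_encode (map \<beta> [0..<q]) \<le> list_encode (replicate q (Suc (memory_bound q * q)))" if "\<beta> \<in> F" for \<beta>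
        by (rule list_encode_mono) (use F(3)[OF that] cq in auto)
      then show "\<forall>x\<in>set (map (\<lambda>\<beta>. list_encode (map \<beta> [0..<q])) ws).
        x \<le> list_encode (replicate q (Suc (memory_bound q * q)))" using ws(1) by auto
    qed
    ultimately show "\<exists>W\<le>mem_bound n U. check k m n U W" by blast
  qed
qed

definition grid_size :: "nat \<Rightarrow> nat \<Rightarrow> nat \<Rightarrow> nat" where
  "grid_size k m n = (LEAST U. grid_closed (n + k) (n + m) (Suc (n + k)) U)"

lemma grid_size_closed: "grid_closed (n + k) (n + m) (Suc (n + k)) (grid_size k m n)"
  unfolding grid_size_def using grid_closed_exists by (rule LeastI_ex)

lemma comp_grid_size [comp_intros]: assumes "computable f" shows "computable (\<lambda>e. grid_size k m (f e))"
proof (rule comp_compose[OF _ assms])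
  show "computable (grid_size k m)"
    unfolding grid_size_def[abs_def] by (intro comp_intros grid_closed_exists)
qed

theorem theorem2:
  fixes k m :: nat
  shows "decidable_set {enc_instance I | I. has_winning_controller k m I}"
proof (rule decidable_set_dec)
  have "n \<in> {enc_instance I | I. has_winning_controller k m I} \<longleftrightarrow>
    instance_valid n \<and> (\<exists>W\<le>mem_bound n (grid_size k m n). check k m n (grid_size k m n) W)" for n
  proof -
    have "n \<in> {enc_instance I | I. has_winning_controller k m I} \<longleftrightarrow>
      (\<exists>na nb T. n = enc_instance (na, nb, T) \<and> has_winning_controller k m (na, nb, T))" by auto
    also have "\<dots> \<longleftrightarrow> (\<exists>na nb T. n = enc_instance (na, nb, T) \<and>
        (\<exists>W\<le>mem_bound n (grid_size k m n). check k m n (grid_size k m n) W))"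
      using has_winning_controller_iff_check[OF _ grid_size_closed] by blast
    also have "\<dots> \<longleftrightarrow> instance_valid n \<and> (\<exists>W\<le>mem_bound n (grid_size k m n). check k m n (grid_size k m n) W)"
      unfolding instance_valid_iff by auto
    finally show ?thesis .
  qed
  then show "decidable (\<lambda>n. n \<in> {enc_instance I | I. has_winning_controller k m I})"
    unfolding instance_valid_def by (simp only:) (intro comp_intros)
qed

end
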